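(* Let $\pi$ be a supersingular representation of $G=\mathrm{GL}_2(F)$. Then $\pi|_P$ is an irreducible representation of $P$.
   Context: $F$ non-Archimedean local field of residual characteristic $p$. $P$ the upper triangular Borel subgroup of $G$, $T$ the diagonal torus. Representations are smooth on $\overline{\mathbf F}_p$-vector spaces. For a smooth character $\chi$ of $T$ viewed as a character of $P$, $\mathrm{Ind}_P^G\chi$ is the smooth induction (locally constant $f:G\to\overline{\mathbf F}_p$ with $f(bg)=\chi(b)f(g)$, $G$ acting by right translation). A supersingular representation is an irreducible smooth representation of $G$ admitting a central character which is not isomorphic to a subquotient of $\mathrm{Ind}_P^G\chi$ for any smooth character $\chi$ of $T$. *)

theory Defs
  imports "HOL-Analysis.Analysis" "HOL-Computational_Algebra.Polynomial" "HOL-Library.Function_Algebras"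
begin

text \<open>v is the normalized valuation on nonzero elements (its value at 0 is irrelevant).
  val_ideal v n is the fractional ideal of elements of valuation at least n (with 0);
  val_ideal v 0 is the ring of integers O, val_ideal v 1 its maximal ideal m.\<close>

definition val_ideal :: "('f::field \<Rightarrow> int) \<Rightarrow> int \<Rightarrow> 'f set" where
  "val_ideal v n = {x. x = 0 \<or> v x \<ge> n}"

definition nonarch_local_field :: "('f::field \<Rightarrow> int) \<Rightarrow> nat \<Rightarrow> bool" where
  "nonarch_local_field v p \<longleftrightarrow>
     prime p
   \<and> (\<forall>x y. x \<noteq> 0 \<longrightarrow> y \<noteq> 0 \<longrightarrow> v (x * y) = v x + v y)
   \<and> (\<forall>x y. x \<noteq> 0 \<longrightarrow> y \<noteq> 0 \<longrightarrow> x + y \<noteq> 0 \<longrightarrow> v (x + y) \<ge> min (v x) (v y))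
   \<and> (\<forall>n::int. \<exists>x. x \<noteq> 0 \<and> v x = n)
   \<comment> \<open>complete w.r.t. the valuation\<close>
   \<and> (\<forall>s::nat \<Rightarrow> 'f.
        (\<forall>N. \<exists>M. \<forall>m\<ge>M. \<forall>n\<ge>M. s m - s n \<in> val_ideal v N) \<longrightarrow>
        (\<exists>L. \<forall>N. \<exists>M. \<forall>n\<ge>M. s n - L \<in> val_ideal v N))
   \<comment> \<open>residue field O/m is finite\<close>
   \<and> finite ((\<lambda>x. {y \<in> val_ideal v 0. x - y \<in> val_ideal v 1}) ` val_ideal v 0)
   \<comment> \<open>residue field has characteristic p\<close>
   \<and> of_nat p \<in> val_ideal v 1"

definition is_alg_closure_of_Fp :: "'k::field itself \<Rightarrow> nat \<Rightarrow> bool" where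
  "is_alg_closure_of_Fp _ p \<longleftrightarrow>
     prime p \<and> CHAR('k) = p
   \<and> (\<forall>q :: 'k poly. degree q > 0 \<longrightarrow> (\<exists>x. poly q x = 0))
   \<and> (\<forall>x :: 'k. \<exists>q :: 'k poly. q \<noteq> 0 \<and> (\<forall>i. coeff q i \<in> range of_nat) \<and> poly q x = 0)"

definition GL2 :: "('f::field ^2^2) set" where
  "GL2 = {g. det g \<noteq> 0}"

definition Borel :: "('f::field ^2^2) set" where
  "Borel = {g \<in> GL2. g $ 2 $ 1 = 0}"

text \<open>Subspace topology on GL_2(F) inside F^4: basic neighbourhoods of g.\<close>
definition close_mat :: "('f::field \<Rightarrow> int) \<Rightarrow> int \<Rightarrow> 'f^2^2 \<Rightarrow> 'f^2^2 \<Rightarrow> bool" where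
  "close_mat v n g h \<longleftrightarrow> (\<forall>i j. h $ i $ j - g $ i $ j \<in> val_ideal v n)"

definition G_open :: "('f::field \<Rightarrow> int) \<Rightarrow> ('f^2^2) set \<Rightarrow> bool" where
  "G_open v U \<longleftrightarrow> U \<subseteq> GL2 \<and> (\<forall>g\<in>U. \<exists>n. \<forall>h\<in>GL2. close_mat v n g h \<longrightarrow> h \<in> U)"

definition locally_constant_on_G :: "('f::field \<Rightarrow> int) \<Rightarrow> ('f^2^2 \<Rightarrow> 'k) \<Rightarrow> bool" where
  "locally_constant_on_G v f \<longleftrightarrow>
     (\<forall>g\<in>GL2. \<exists>n. \<forall>h\<in>GL2. close_mat v n g h \<longrightarrow> f h = f g)"

definition smooth_rep ::
  "('f::field \<Rightarrow> int) \<Rightarrow> ('k::field \<Rightarrow> 'v::ab_group_add \<Rightarrow> 'v) \<Rightarrow> ('f^2^2 \<Rightarrow> 'v \<Rightarrow> 'v) \<Rightarrow> bool" where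
  "smooth_rep v smul act \<longleftrightarrow>
     vector_space smul
   \<and> (\<forall>g\<in>GL2. \<forall>x y. act g (x + y) = act g x + act g y)
   \<and> (\<forall>g\<in>GL2. \<forall>c x. act g (smul c x) = smul c (act g x))
   \<and> (\<forall>x. act (mat 1) x = x)
   \<and> (\<forall>g\<in>GL2. \<forall>h\<in>GL2. \<forall>x. act (g ** h) x = act g (act h x))
   \<and> (\<forall>x. G_open v {g \<in> GL2. act g x = x})"

definition stable_subspace ::
  "('f::field^2^2) set \<Rightarrow> ('k::field \<Rightarrow> 'v::ab_group_add \<Rightarrow> 'v) \<Rightarrow> ('f^2^2 \<Rightarrow> 'v \<Rightarrow> 'v) \<Rightarrow> 'v set \<Rightarrow> bool" where
  "stable_subspace H smul act W \<longleftrightarrow>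
     module.subspace smul W \<and> (\<forall>g\<in>H. \<forall>w\<in>W. act g w \<in> W)"

definition irreducible_rep ::
  "('f::field^2^2) set \<Rightarrow> ('k::field \<Rightarrow> 'v::ab_group_add \<Rightarrow> 'v) \<Rightarrow> ('f^2^2 \<Rightarrow> 'v \<Rightarrow> 'v) \<Rightarrow> bool" where
  "irreducible_rep H smul act \<longleftrightarrow>
     (\<exists>x::'v. x \<noteq> 0) \<and> (\<forall>W. stable_subspace H smul act W \<longrightarrow> W = {0} \<or> W = UNIV)"

definition has_central_character ::
  "('k::field \<Rightarrow> 'v::ab_group_add \<Rightarrow> 'v) \<Rightarrow> ('f::field^2^2 \<Rightarrow> 'v \<Rightarrow> 'v) \<Rightarrow> bool" where
  "has_central_character smul act \<longleftrightarrow>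
     (\<exists>\<omega> :: 'f \<Rightarrow> 'k. \<forall>z. z \<noteq> 0 \<longrightarrow> (\<forall>x. act (mat z) x = smul (\<omega> z) x))"

text \<open>A character of T = {diag(a,d)} is given as chi a d.\<close>
definition smooth_char_T :: "('f::field \<Rightarrow> int) \<Rightarrow> ('f \<Rightarrow> 'f \<Rightarrow> 'k::field) \<Rightarrow> bool" where
  "smooth_char_T v chi \<longleftrightarrow>
     (\<forall>a d. a \<noteq> 0 \<longrightarrow> d \<noteq> 0 \<longrightarrow> chi a d \<noteq> 0)
   \<and> (\<forall>a d a' d'. a \<noteq> 0 \<longrightarrow> d \<noteq> 0 \<longrightarrow> a' \<noteq> 0 \<longrightarrow> d' \<noteq> 0 \<longrightarrow>
        chi (a * a') (d * d') = chi a d * chi a' d')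
   \<comment> \<open>smooth: the kernel contains an open neighbourhood of 1 in T\<close>
   \<and> (\<exists>n \<ge> 1. \<forall>a d. a \<noteq> 0 \<longrightarrow> d \<noteq> 0 \<longrightarrow> a - 1 \<in> val_ideal v n \<longrightarrow> d - 1 \<in> val_ideal v n
        \<longrightarrow> chi a d = 1)"

definition Ind :: "('f::field \<Rightarrow> int) \<Rightarrow> ('f \<Rightarrow> 'f \<Rightarrow> 'k::field) \<Rightarrow> ('f^2^2 \<Rightarrow> 'k) set" where
  "Ind v chi = {f. (\<forall>g. g \<notin> GL2 \<longrightarrow> f g = 0) \<and> locally_constant_on_G v f
      \<and> (\<forall>b\<in>Borel. \<forall>g\<in>GL2. f (b ** g) = chi (b $ 1 $ 1) (b $ 2 $ 2) * f g)}"

definition fun_scale :: "'k::field \<Rightarrow> ('a \<Rightarrow> 'k) \<Rightarrow> ('a \<Rightarrow> 'k)" where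
  "fun_scale c f = (\<lambda>x. c * f x)"

definition ind_act :: "'f::field^2^2 \<Rightarrow> ('f^2^2 \<Rightarrow> 'k) \<Rightarrow> ('f^2^2 \<Rightarrow> 'k)" where
  "ind_act g f = (\<lambda>x. f (x ** g))"

definition iso_subquotient_Ind ::
  "('f::field \<Rightarrow> int) \<Rightarrow> ('f \<Rightarrow> 'f \<Rightarrow> 'k::field) \<Rightarrow> ('k \<Rightarrow> 'v::ab_group_add \<Rightarrow> 'v)
     \<Rightarrow> ('f^2^2 \<Rightarrow> 'v \<Rightarrow> 'v) \<Rightarrow> bool" where
  "iso_subquotient_Ind v chi smul act \<longleftrightarrow>
     (\<exists>W1 W2. W2 \<subseteq> W1 \<and> W1 \<subseteq> Ind v chi
        \<and> stable_subspace GL2 fun_scale ind_act W1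
        \<and> stable_subspace GL2 fun_scale ind_act W2
        \<and> (\<exists>\<phi> :: ('f^2^2 \<Rightarrow> 'k) \<Rightarrow> 'v.
              (\<forall>f\<in>W1. \<forall>f'\<in>W1. \<phi> (f + f') = \<phi> f + \<phi> f')
            \<and> (\<forall>c. \<forall>f\<in>W1. \<phi> (fun_scale c f) = smul c (\<phi> f))
            \<and> (\<forall>g\<in>GL2. \<forall>f\<in>W1. \<phi> (ind_act g f) = act g (\<phi> f))
            \<and> \<phi> ` W1 = UNIV
            \<and> (\<forall>f\<in>W1. \<phi> f = 0 \<longleftrightarrow> f \<in> W2)))"

definition supersingular ::
  "('f::field \<Rightarrow> int) \<Rightarrow> ('k::field \<Rightarrow> 'v::ab_group_add \<Rightarrow> 'v) \<Rightarrow> ('f^2^2 \<Rightarrow> 'v \<Rightarrow> 'v) \<Rightarrow> bool" where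
  "supersingular v smul act \<longleftrightarrow>
     smooth_rep v smul act
   \<and> irreducible_rep (GL2 :: ('f^2^2) set) smul act
   \<and> has_central_character smul act
   \<and> \<not> (\<exists>chi :: 'f \<Rightarrow> 'f \<Rightarrow> 'k. smooth_char_T v chi \<and> iso_subquotient_Ind v chi smul act)"

end

theory Submission
  imports Defs
begin

text \<open>Let W be a nonzero B-stable subspace. Dilating by the torus and using that pro-p groups in characteristic p have
  fixed vectors, W contains a vector y on which the Iwahori subgroup acts by a character. The operator U, the sum of n(l) t
  over residues l, preserves such vectors and W. If U y = 0, an explicit matrix identity puts the translate of y by the
  Weyl element into W, so W is everything. It remains to see that U has eigenvalue 0 and no other.

  Let f0 be the indicator function of the ball O in the universal principal series, realized as functions on G so that U
  becomes a shift. Comparing f0 with U y inside the product of this function space with pi, the G-span of the pair (f0, U y) is the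
  graph of a map onto pi: its elements are sums over the vertices of the tree, and the values at the deepest vertex show
  that no nonzero sum has vanishing function part. Specializing the shift to 1, the map has a nonzero kernel because pi is not
  a subquotient of a principal series; an Iwahori eigenvector in the kernel is a polynomial in U applied to f0. So a nonzero
  polynomial in U kills U y, and U has an eigenvector in W. A nonzero eigenvalue would make pi a subquotient of an honest
  principal series, where functions are cut into small balls with disjoint supports.\<close>

section \<open>Two by two matrices\<close>

text \<open>The obstacle is that f0 may be sent to a vector only if that vector satisfies every
  relation of f0. Already K = GL2(O) produces one: the operator S, the sum of n(l)
  \<open>swp\<close> over residues l, multiplies f0 by a scalar, because outside the ball it adds q
  equal values and q = 0 in characteristic p. An eigenvector y has no reason to satisfy this. The
  vector U y does: U = S Pi, so up to a scalar (f0, U y) is S applied to a pair built from Pi y,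
  whose q + 1 translates by coset representatives of K modulo the Iwahori subgroup have linearly
  independent first components. Relations between different vertices are excluded by supports, and
  this needs the unramified part of the inducing character to be a free variable: left translation
  by \<open>tm 1\<close> plays that role, finite support along it means Laurent polynomials, and
  setting the variable to 1 is summation over all powers. In an honest principal series the
  generator is a U-eigenvector, hence a combination of its own translates; there the relations must
  first be brought to one level of small balls.\<close>

definition mk :: "'f \<Rightarrow> 'f \<Rightarrow> 'f \<Rightarrow> 'f \<Rightarrow> ('f::field)^2^2" where
  "mk a b c d = (\<chi> i j. if i = 1 then (if j = 1 then a else b) else (if j = 1 then c else d))"

lemma mk_nth [simp]:
  "mk a b c d $ 1 $ 1 = a" "mk a b c d $ 1 $ 2 = b" "mk a b c d $ 2 $ 1 = c" "mk a b c d $ 2 $ 2 = d"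
  by (simp_all add: mk_def)

lemma mk_eqI:
  assumes "g $ 1 $ 1 = h $ 1 $ 1" "g $ 1 $ 2 = h $ 1 $ 2" "g $ 2 $ 1 = h $ 2 $ 1" "g $ 2 $ 2 = h $ 2 $ 2"
  shows "g = (h :: ('f::field)^2^2)"
  using assms by (simp add: vec_eq_iff forall_2)

lemma mk_eta: "mk (g $ 1 $ 1) (g $ 1 $ 2) (g $ 2 $ 1) (g $ 2 $ 2) = g"
  by (rule mk_eqI) auto

lemma mk_cases: obtains a b c d where "g = mk a b c d"
  using mk_eta[of g, symmetric] by (rule that)

lemma mk_eq_iff [simp]: "mk a b c d = mk a' b' c' d' \<longleftrightarrow> a = a' \<and> b = b' \<and> c = c' \<and> d = d'"
proof
  assume *: "mk a b c d = mk a' b' c' d'"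
  show "a = a' \<and> b = b' \<and> c = c' \<and> d = d'"
    using arg_cong[OF *, of "\<lambda>g. g $ 1 $ 1"] arg_cong[OF *, of "\<lambda>g. g $ 1 $ 2"]
      arg_cong[OF *, of "\<lambda>g. g $ 2 $ 1"] arg_cong[OF *, of "\<lambda>g. g $ 2 $ 2"] by simp
qed simp

lemma mk_mult [simp]:
  "mk a b c d ** mk a' b' c' d' = mk (a*a' + b*c') (a*b' + b*d') (c*a' + d*c') (c*b' + d*d')"
  by (rule mk_eqI) (simp_all add: matrix_matrix_mult_def sum_2)

lemma det_mk [simp]: "det (mk a b c d) = a*d - b*c"
  by (simp add: det_2)

lemma mat_mk: "mat z = mk z 0 0 z"
  by (rule mk_eqI) (simp_all add: mat_def)

lemma mk_GL2 [simp]: "mk a b c d \<in> GL2 \<longleftrightarrow> a*d - b*c \<noteq> 0"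
  by (simp add: GL2_def)

lemma GL2_mult [simp]: "g \<in> GL2 \<Longrightarrow> h \<in> GL2 \<Longrightarrow> g ** h \<in> GL2"
  by (simp add: GL2_def det_mul)

lemma GL2_mult_left_iff [simp]: "h \<in> GL2 \<Longrightarrow> g ** h \<in> GL2 \<longleftrightarrow> g \<in> GL2"
  by (simp add: GL2_def det_mul)

lemma mk_Borel [simp]: "mk a b c d \<in> Borel \<longleftrightarrow> c = 0 \<and> a*d \<noteq> 0"
  by (auto simp: Borel_def)

lemma one_GL2 [simp]: "mat 1 \<in> GL2" and one_Borel [simp]: "mat 1 \<in> Borel"
  by (simp_all add: mat_mk)

lemma Borel_GL2: "b \<in> Borel \<Longrightarrow> b \<in> GL2"
  by (simp add: Borel_def)

lemma Borel_cases:
  assumes "b \<in> Borel"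
  obtains a x d where "b = mk a x 0 d" "a \<noteq> 0" "d \<noteq> 0"
  using assms by (cases b rule: mk_cases) auto

lemma GL2_right_inverse:
  assumes "g \<in> GL2"
  obtains h where "h \<in> GL2" "g ** h = mat 1" "h ** g = mat 1"
proof -
  obtain a b c d where g: "g = mk a b c d" by (rule mk_cases)
  define D where "D = a*d - b*c"
  have D: "D \<noteq> 0" using assms by (simp add: g D_def)
  have 1: "(a * d - b * c) / D = 1" using D by (simp add: D_def)
  have "mk (d/D) (-b/D) (-c/D) (a/D) \<in> GL2"
    using D by (simp add: D_def[symmetric] divide_simps mult.commute)
  then show ?thesis
    using 1 by (intro that[of "mk (d/D) (-b/D) (-c/D) (a/D)"])
      (simp_all add: g mat_mk diff_divide_distrib mult.commute)
qed

definition uni :: "'f \<Rightarrow> ('f::field)^2^2" where "uni b = mk 1 b 0 1"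
definition low :: "'f \<Rightarrow> ('f::field)^2^2" where "low c = mk 1 0 c 1"
definition swp :: "('f::field)^2^2" where "swp = mk 0 1 1 0"

lemma uni_GL2 [simp]: "uni b \<in> GL2" and low_GL2 [simp]: "low b \<in> GL2" and swp_GL2 [simp]: "swp \<in> GL2"
  and uni_Borel [simp]: "uni b \<in> Borel"
  by (simp_all add: uni_def low_def swp_def)

lemma uni_add: "uni a ** uni b = uni (a + b)"
  by (simp add: uni_def add.commute)

section \<open>The valuation\<close>

locale local_field =
  fixes v :: "'f::field \<Rightarrow> int" and p :: nat and pi :: 'f
  assumes v_mult: "\<And>x y. x \<noteq> 0 \<Longrightarrow> y \<noteq> 0 \<Longrightarrow> v (x * y) = v x + v y"
    and v_add: "\<And>x y. x \<noteq> 0 \<Longrightarrow> y \<noteq> 0 \<Longrightarrow> x + y \<noteq> 0 \<Longrightarrow> v (x + y) \<ge> min (v x) (v y)"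
    and pi_nz [simp]: "pi \<noteq> 0" and v_pi [simp]: "v pi = 1"
    and finite_residue: "finite ((\<lambda>x. {y \<in> val_ideal v 0. x - y \<in> val_ideal v 1}) ` val_ideal v 0)"
    and prime_p: "prime p" and p_in: "of_nat p \<in> val_ideal v 1"
begin

abbreviation V :: "int \<Rightarrow> 'f set" where "V \<equiv> val_ideal v"

definition unit :: "'f \<Rightarrow> bool" where "unit u \<longleftrightarrow> u \<noteq> 0 \<and> v u = 0"

lemma v_one [simp]: "v 1 = 0"
  using v_mult[of 1 1] by simp

lemma v_minus [simp]: "v (- x) = v x"
proof (cases "x = 0")
  case False
  have "v (-1) = 0" using v_mult[of "-1" "-1"] by simp
  then show ?thesis using v_mult[of "-1" x] False by simp
qed simp

lemma v_inverse: "x \<noteq> 0 \<Longrightarrow> v (inverse x) = - v x"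
  using v_mult[of x "inverse x"] by simp

lemma v_divide: "x \<noteq> 0 \<Longrightarrow> y \<noteq> 0 \<Longrightarrow> v (x / y) = v x - v y"
  by (simp add: divide_inverse v_mult v_inverse)

lemma v_powi [simp]: "v (pi powi n) = n"
proof -
  have *: "v (pi ^ k) = int k" for k by (induction k) (simp_all add: v_mult)
  show ?thesis
  proof (cases "n \<ge> 0")
    case True
    then show ?thesis using *[of "nat n"] by (simp add: power_int_def)
  next
    case False
    then show ?thesis using *[of "nat (- n)"] by (simp add: power_int_def v_inverse power_inverse)
  qed
qed

lemma powi_nz [simp]: "pi powi n \<noteq> 0"
  by (simp add: power_int_not_zero)

lemma V_0 [simp]: "0 \<in> V n"
  by (simp add: val_ideal_def)

lemma V_iff: "x \<noteq> 0 \<Longrightarrow> x \<in> V n \<longleftrightarrow> v x \<ge> n"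
  by (simp add: val_ideal_def)

lemma V_mono: "x \<in> V m \<Longrightarrow> n \<le> m \<Longrightarrow> x \<in> V n"
  by (auto simp: val_ideal_def)

lemma V_add: "x \<in> V n \<Longrightarrow> y \<in> V n \<Longrightarrow> x + y \<in> V n"
  using v_add[of x y] by (cases "x = 0"; cases "y = 0"; cases "x + y = 0") (auto simp: val_ideal_def)

lemma V_minus [simp]: "- x \<in> V n \<longleftrightarrow> x \<in> V n"
  by (simp add: val_ideal_def)

lemma V_diff: "x \<in> V n \<Longrightarrow> y \<in> V n \<Longrightarrow> x - y \<in> V n"
  using V_add[of x n "- y"] by simp

lemma V_mult: "x \<in> V m \<Longrightarrow> y \<in> V n \<Longrightarrow> x * y \<in> V (m + n)"
  by (cases "x = 0"; cases "y = 0") (simp_all add: V_iff v_mult)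

lemma V_mult0: "x \<in> V 0 \<Longrightarrow> y \<in> V n \<Longrightarrow> x * y \<in> V n"
  and V_mult0': "x \<in> V n \<Longrightarrow> y \<in> V 0 \<Longrightarrow> x * y \<in> V n"
  using V_mult[of x 0 y n] V_mult[of x n y 0] by simp_all

lemma V_1 [simp]: "1 \<in> V 0" by (simp add: V_iff)

lemma V1_V0: "x \<in> V 1 \<Longrightarrow> x \<in> V 0" by (erule V_mono) simp

lemma powi_V [simp]: "pi powi n \<in> V m \<longleftrightarrow> m \<le> n" by (simp add: V_iff)

lemma pi_V [simp]: "pi \<in> V n \<longleftrightarrow> n \<le> 1" by (simp add: V_iff)

lemma V_powi_mult: "pi powi n * x \<in> V m \<longleftrightarrow> x \<in> V (m - n)"
  by (cases "x = 0") (auto simp: V_iff v_mult)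

lemma V_div_powi: "x / pi powi n \<in> V m \<longleftrightarrow> x \<in> V (m + n)"
  by (cases "x = 0") (auto simp: V_iff v_divide)

lemma V_div_pi: "x / pi \<in> V m \<longleftrightarrow> x \<in> V (m + 1)"
  by (cases "x = 0") (auto simp: V_iff v_divide)

lemma V_pi_mult: "pi * x \<in> V m \<longleftrightarrow> x \<in> V (m - 1)"
  by (cases "x = 0") (auto simp: V_iff v_mult)

lemma V_of_nat: "of_nat n \<in> V 0"
  by (induction n) (auto intro: V_add)

lemma V_of_int: "of_int n \<in> V 0"
  by (cases n rule: int_cases2) (simp_all add: V_of_nat)

lemma unit_nz: "unit u \<Longrightarrow> u \<noteq> 0" by (simp add: unit_def)
lemma unit_V0: "unit u \<Longrightarrow> u \<in> V 0" by (simp add: unit_def V_iff)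
lemma unit_1 [simp]: "unit 1" by (simp add: unit_def)
lemma unit_minus [simp]: "unit (- u) \<longleftrightarrow> unit u" by (simp add: unit_def)
lemma unit_mult: "unit x \<Longrightarrow> unit y \<Longrightarrow> unit (x * y)" by (simp add: unit_def v_mult)
lemma unit_inverse: "unit x \<Longrightarrow> unit (inverse x)" by (simp add: unit_def v_inverse)
lemma unit_divide: "unit x \<Longrightarrow> unit y \<Longrightarrow> unit (x / y)" by (simp add: unit_def v_divide)
lemma unit_power: "unit x \<Longrightarrow> unit (x ^ n)" by (induction n) (auto intro: unit_mult)

lemma unit_iff: "unit u \<longleftrightarrow> u \<in> V 0 \<and> u \<notin> V 1"
  by (auto simp: unit_def val_ideal_def)

lemma unit_add: "unit u \<Longrightarrow> x \<in> V 1 \<Longrightarrow> unit (u + x)"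
  unfolding unit_iff using V_add[of u 0 x] V_diff[of "u + x" 1 x] V1_V0[of x] by auto

lemma unit_diff: "unit u \<Longrightarrow> x \<in> V 1 \<Longrightarrow> unit (u - x)"
  using unit_add[of u "- x"] by simp

lemma unit_congI: "unit u \<Longrightarrow> w - u \<in> V 1 \<Longrightarrow> unit w"
  using unit_add[of u "w - u"] by simp

lemma V_div_unit: "unit u \<Longrightarrow> x / u \<in> V n \<longleftrightarrow> x \<in> V n"
  by (cases "x = 0") (auto simp: unit_def V_iff v_divide)

lemma V_mult_unit: "unit u \<Longrightarrow> u * x \<in> V n \<longleftrightarrow> x \<in> V n"
  by (cases "x = 0") (auto simp: unit_def V_iff v_mult)

lemma unit_decomp: "x \<noteq> 0 \<Longrightarrow> unit (x / pi powi (v x))"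
  by (simp add: unit_def v_divide)

lemma V_exists: "\<exists>M\<ge>0. x \<in> V (- M)"
  by (intro exI[of _ "\<bar>v x\<bar>"]) (auto simp: val_ideal_def)

lemma one_notin_V1: "1 \<notin> V 1" by (simp add: V_iff)

section \<open>Representatives of residue classes\<close>

text \<open>The class of 0 gets the representative 0, so that 0 lies in \<open>L\<close> and the
  term of the identity coset can be split off from sums over \<open>L\<close>. General
  \<open>n\<close> serves to normalize vertices of the tree and centres of balls.\<close>

definition rep :: "int \<Rightarrow> 'f \<Rightarrow> 'f" where
  "rep n a = (if a \<in> V n then 0 else (SOME b. b - a \<in> V n))"

lemma rep_diff: "rep n a - a \<in> V n"
proof (cases "a \<in> V n")
  case False
  have "(SOME b. b - a \<in> V n) - a \<in> V n"
    by (rule someI[of _ a]) simp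
  then show ?thesis using False by (simp add: rep_def)
qed (simp add: rep_def)

lemma V_diff_commute: "x - y \<in> V n \<longleftrightarrow> y - x \<in> V n"
  using V_minus[of "x - y" n] by simp

text \<open>The choice in \<open>rep\<close> depends on \<open>a\<close> only through predicates
  that agree for congruent elements, and equal predicates receive equal choices.\<close>

lemma rep_eq_iff: "rep n a = rep n b \<longleftrightarrow> a - b \<in> V n"
proof
  assume "rep n a = rep n b"
  then show "a - b \<in> V n"
    using V_diff[OF rep_diff[of n b] rep_diff[of n a]] by simp
next
  assume ab: "a - b \<in> V n"
  have "x - a \<in> V n \<longleftrightarrow> x - b \<in> V n" for x
    using V_add[OF _ ab, of "x - a"] V_diff[OF _ ab, of "x - b"] by auto
  moreover have "a \<in> V n \<longleftrightarrow> b \<in> V n"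
    using V_diff[OF _ ab, of a] V_add[OF _ ab, of b] by auto
  ultimately show "rep n a = rep n b" by (simp add: rep_def)
qed

lemma rep_rep [simp]: "rep n (rep n a) = rep n a"
  using rep_diff by (simp add: rep_eq_iff)

definition L :: "'f set" where "L = rep 1 ` V 0"

lemma rep_V0: "a \<in> V 0 \<Longrightarrow> rep 1 a \<in> V 0"
  using V_add[OF V1_V0[OF rep_diff[of 1 a]], of a] by simp

lemma L_V0: "l \<in> L \<Longrightarrow> l \<in> V 0"
  by (auto simp: L_def rep_V0)

lemma rep_L: "l \<in> L \<Longrightarrow> rep 1 l = l"
  by (auto simp: L_def)

lemma rep_in_L: "a \<in> V 0 \<Longrightarrow> rep 1 a \<in> L"
  by (simp add: L_def)

lemma L_0 [simp]: "0 \<in> L"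
  using rep_in_L[of 0] by (simp add: rep_def)

lemma L_eqI: "l \<in> L \<Longrightarrow> l' \<in> L \<Longrightarrow> l - l' \<in> V 1 \<Longrightarrow> l = l'"
  using rep_L rep_eq_iff by metis

lemma L_unit: "l \<in> L \<Longrightarrow> l \<noteq> 0 \<Longrightarrow> unit l"
  using L_eqI[of l 0] L_V0[of l] by (auto simp: unit_iff)

lemma finite_L [simp]: "finite L"
proof -
  have "L = (\<lambda>C. rep 1 (SOME x. x \<in> C)) ` (\<lambda>x. {y \<in> V 0. x - y \<in> V 1}) ` V 0"
    unfolding L_def image_image
  proof (rule image_cong[OF refl])
    fix x assume x: "x \<in> V 0"
    have "(SOME y. y \<in> {y \<in> V 0. x - y \<in> V 1}) \<in> {y \<in> V 0. x - y \<in> V 1}"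
      by (rule someI[of _ x]) (simp add: x)
    then show "rep 1 x = rep 1 (SOME y. y \<in> {y \<in> V 0. x - y \<in> V 1})"
      by (simp add: rep_eq_iff)
  qed
  then show ?thesis using finite_residue by (simp only: finite_imageI)
qed

lemma L_affine_bij:
  assumes "unit e" "b \<in> V 0"
  shows "bij_betw (\<lambda>l. rep 1 (e * l + b)) L L"
proof -
  have mem: "rep 1 (e * l + b) \<in> L" if "l \<in> L" for l
    by (intro rep_in_L V_add V_mult0 unit_V0 assms L_V0 that)
  have inj: "inj_on (\<lambda>l. rep 1 (e * l + b)) L"
  proof (rule inj_onI)
    fix l l' assume *: "l \<in> L" "l' \<in> L" "rep 1 (e * l + b) = rep 1 (e * l' + b)"
    then have "e * (l - l') \<in> V 1" by (simp add: rep_eq_iff algebra_simps)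
    then show "l = l'" using * L_eqI assms(1) by (simp add: V_mult_unit)
  qed
  then show ?thesis
    using mem by (intro bij_betw_imageI inj endo_inj_surj) auto
qed

text \<open>A function constant on residue classes is summed over the residue field, which
  invertible affine maps permute.\<close>

lemma sum_L_affine:
  assumes "unit e" "b \<in> V 0"
    and per: "\<And>x y. x \<in> V 0 \<Longrightarrow> y \<in> V 0 \<Longrightarrow> x - y \<in> V 1 \<Longrightarrow> f x = f y"
  shows "(\<Sum>l\<in>L. f (e * l + b)) = (\<Sum>l\<in>L. f l)"
proof -
  have "(\<Sum>l\<in>L. f (e * l + b)) = (\<Sum>l\<in>L. f (rep 1 (e * l + b)))"
  proof (rule sum.cong[OF refl])
    fix l assume "l \<in> L"
    then have x: "e * l + b \<in> V 0"
      by (intro V_add V_mult0 unit_V0 assms L_V0)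
    then show "f (e * l + b) = f (rep 1 (e * l + b))"
      using rep_diff rep_V0[OF x] by (intro per) (auto simp: V_diff_commute)
  qed
  also have "\<dots> = (\<Sum>l\<in>L. f l)"
    by (rule sum.reindex_bij_betw[OF L_affine_bij[OF assms(1,2)]])
  finally show ?thesis .
qed

text \<open>If p and a number prime to p both lay in the maximal ideal, so would 1, by
  Bezout.\<close>

lemma of_nat_V1: "of_nat i \<in> V 1 \<longleftrightarrow> p dvd i"
proof
  assume "p dvd i"
  then obtain j where "i = p * j" by (auto elim: dvdE)
  then show "of_nat i \<in> V 1"
    using V_mult0'[OF p_in V_of_nat[of j]] by simp
next
  assume i: "of_nat i \<in> V 1"
  show "p dvd i"
  proof (rule ccontr)
    assume "\<not> p dvd i"
    then have "coprime p i" using prime_p by (simp add: prime_imp_coprime)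
    then have "gcd (int p) (int i) = 1" by (simp add: coprime_iff_gcd_eq_1)
    then obtain x y where "x * int p + y * int i = 1" using bezout_int[of "int p" "int i"] by auto
    then have "of_int (x * int p + y * int i) = (1 :: 'f)" by simp
    then have "1 = of_nat p * of_int x + of_nat i * (of_int y :: 'f)" by (simp add: mult.commute)
    also have "\<dots> \<in> V 1" by (intro V_add V_mult0' p_in i V_of_int)
    finally show False using one_notin_V1 by simp
  qed
qed

text \<open>Translation by 1 permutes the residue classes with all orbits of size p.\<close>

lemma p_dvd_card_L: "p dvd card L"
proof -
  define C where "C l = (\<lambda>i. rep 1 (l + of_nat i)) ` {..<p}" for l
  have mem: "rep 1 (l + of_nat i) \<in> L" if "l \<in> L" for l i
    by (intro rep_in_L V_add V_of_nat L_V0 that)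
  have p0: "p > 0" using prime_p by (simp add: prime_gt_0_nat)
  have U: "\<Union> (C ` L) = L"
  proof
    show "\<Union> (C ` L) \<subseteq> L" by (auto simp: C_def mem)
    show "L \<subseteq> \<Union> (C ` L)"
    proof
      fix l assume l: "l \<in> L"
      then have "l = rep 1 (l + of_nat 0)" by (simp add: rep_L)
      then have "l \<in> C l" unfolding C_def using p0 by blast
      then show "l \<in> \<Union> (C ` L)" using l by blast
    qed
  qed
  have "p dvd card (\<Union> (C ` L))"
  proof (rule dvd_partition)
    show "finite (\<Union> (C ` L))" by (simp add: U)
    have "card (C l) = p" for l
    proof -
      have "inj_on (\<lambda>i. rep 1 (l + of_nat i)) {..<p}"
      proof (rule linorder_inj_onI)
        fix i j :: nat assume ij: "i < j" "i \<in> {..<p}" "j \<in> {..<p}"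
        show "rep 1 (l + of_nat i) \<noteq> rep 1 (l + of_nat j)"
        proof
          assume "rep 1 (l + of_nat i) = rep 1 (l + of_nat j)"
          then have "of_nat j - of_nat i \<in> V 1" by (simp add: rep_eq_iff V_diff_commute)
          then have "of_nat (j - i) \<in> V 1" using ij by (simp add: of_nat_diff)
          then have "p dvd j - i" by (simp only: of_nat_V1)
          then show False using ij dvd_imp_le[of p "j - i"] by simp
        qed
      qed auto
      then show ?thesis by (simp add: C_def card_image)
    qed
    then show "\<forall>c\<in>C ` L. p dvd card c" by auto
    have sub: "C l \<subseteq> C l'" if l: "l \<in> L" "l' \<in> L" and x: "x \<in> C l" "x \<in> C l'" for l l' x
    proof
      obtain i i' where i: "x = rep 1 (l + of_nat i)" "x = rep 1 (l' + of_nat i')" "i < p" "i' < p"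
        using x unfolding C_def by blast
      fix y assume "y \<in> C l"
      then obtain j where j: "y = rep 1 (l + of_nat j)" "j < p" by (auto simp: C_def)
      have e: "l + of_nat i - (l' + of_nat i') \<in> V 1" using i by (metis rep_eq_iff)
      \<comment> \<open>\<open>r\<close> is j + i' - i modulo p; \<open>p - i\<close> replaces -i in
        order to stay within the naturals.\<close>
      define r where "r = (j + i' + (p - i)) mod p"
      have "of_nat p * of_nat ((j + i' + (p - i)) div p) + of_nat r = (of_nat (j + i' + (p - i)) :: 'f)"
        unfolding r_def of_nat_mult[symmetric] of_nat_add[symmetric] mult_div_mod_eq ..
      then have r: "of_nat r = of_nat j + of_nat i' + of_nat p - of_nat i - of_nat p * (of_nat ((j + i' + (p - i)) div p) :: 'f)"
        using i by (simp add: of_nat_diff algebra_simps)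
      have "l + of_nat j - (l' + of_nat r)
          = (l + of_nat i - (l' + of_nat i')) + of_nat p * (of_nat ((j + i' + (p - i)) div p) - 1)"
        unfolding r by (simp add: algebra_simps)
      also have "\<dots> \<in> V 1"
        by (intro V_add[OF e] V_mult0'[OF p_in] V_diff V_of_nat V_1)
      finally have "y = rep 1 (l' + of_nat r)" by (simp add: j rep_eq_iff)
      then show "y \<in> C l'" using p0 by (auto simp: C_def r_def)
    qed
    show "\<forall>c1\<in>C ` L. \<forall>c2\<in>C ` L. c1 \<noteq> c2 \<longrightarrow> c1 \<inter> c2 = {}"
    proof (intro ballI impI)
      fix A B assume "A \<in> C ` L" "B \<in> C ` L" "A \<noteq> B"
      moreover from this obtain l l' where "A = C l" "l \<in> L" "B = C l'" "l' \<in> L" by (elim imageE)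
      ultimately show "A \<inter> B = {}" using sub[of l l'] sub[of l' l] by (meson disjoint_iff subset_antisym)
    qed
  qed
  then show ?thesis by (simp add: U)
qed

end

section \<open>Congruence subgroups and the Iwahori subgroup\<close>

context local_field
begin

definition ent :: "int \<Rightarrow> 'f^2^2 \<Rightarrow> bool" where
  "ent n X \<longleftrightarrow> (\<forall>i j. X $ i $ j \<in> V n)"

lemma ent_mk [simp]: "ent n (mk a b c d) \<longleftrightarrow> a \<in> V n \<and> b \<in> V n \<and> c \<in> V n \<and> d \<in> V n"
  by (auto simp: ent_def forall_2)

lemma ent_0 [simp]: "ent n 0"
  by (simp add: ent_def)

lemma ent_mono: "ent m X \<Longrightarrow> n \<le> m \<Longrightarrow> ent n X"
  by (auto simp: ent_def intro: V_mono)

lemma ent_add: "ent n X \<Longrightarrow> ent n Y \<Longrightarrow> ent n (X + Y)"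
  by (auto simp: ent_def intro: V_add)

lemma ent_mult: "ent m X \<Longrightarrow> ent n Y \<Longrightarrow> ent (m + n) (X ** Y)"
  unfolding ent_def by (auto simp: matrix_matrix_mult_def sum_2 intro!: V_add V_mult)

lemma matrix_diff_rdistrib: "((A :: 'f^2^2) - B) ** C = A ** C - B ** (C :: 'f^2^2)"
  by (rule mk_eqI) (simp_all add: matrix_matrix_mult_def sum_2 algebra_simps)

lemma ent_exists: "\<exists>M\<ge>0. ent (- M) X"
proof -
  have "\<forall>i j. \<exists>M\<ge>0. X $ i $ j \<in> V (- M)" using V_exists by blast
  then obtain M where M: "\<And>i j. M i j \<ge> 0" "\<And>i j. X $ i $ j \<in> V (- M i j)" by metis
  have "M i j \<le> M 1 1 + M 1 2 + M 2 1 + M 2 2" for i j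
    using M(1)[of 1 1] M(1)[of 1 2] M(1)[of 2 1] M(1)[of 2 2]
    by (cases i rule: exhaust_2[THEN disjE]; cases j rule: exhaust_2[THEN disjE]) auto
  then have "ent (- (M 1 1 + M 1 2 + M 2 1 + M 2 2)) X"
    unfolding ent_def by (intro allI V_mono[OF M(2)]) (simp only: neg_le_iff_le)
  then show ?thesis using M(1) by (metis add_nonneg_nonneg)
qed

definition Kn :: "int \<Rightarrow> ('f^2^2) set" where "Kn n = {k. ent n (k - mat 1)}"

lemma diff_mk: "mk a b c d - mk a' b' c' d' = mk (a - a') (b - b') (c - c') (d - d')"
  by (rule mk_eqI) simp_all

lemma mk_Kn [simp]: "mk a b c d \<in> Kn n \<longleftrightarrow> a - 1 \<in> V n \<and> b \<in> V n \<and> c \<in> V n \<and> d - 1 \<in> V n"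
  by (simp add: Kn_def mat_mk diff_mk)

lemma Kn_mono: "k \<in> Kn m \<Longrightarrow> n \<le> m \<Longrightarrow> k \<in> Kn n"
  by (auto simp: Kn_def intro: ent_mono)

text \<open>h = g (1 + g^-1 (h - g)); the denominators of g^-1, bounded by M, are paid for by the
  precision n + M.\<close>

lemma approx_aux:
  assumes "g ** g' = mat 1" "ent (- M) g'" "ent (n + M) (h - g)"
  shows "\<exists>k\<in>Kn n. h = g ** k"
proof
  have "ent n (g' ** (h - g))" using ent_mult[OF assms(2,3)] by simp
  then show "mat 1 + g' ** (h - g) \<in> Kn n" by (simp add: Kn_def)
  show "h = g ** (mat 1 + g' ** (h - g))"
    by (simp add: matrix_add_ldistrib matrix_mul_assoc assms(1))
qed

lemma approx:
  assumes "g \<in> GL2"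
  shows "\<exists>N. \<forall>h. ent N (h - g) \<longrightarrow> (\<exists>k\<in>Kn n. h = g ** k)"
proof -
  obtain g' where g': "g ** g' = mat 1" using GL2_right_inverse[OF assms] by blast
  obtain M where "ent (- M) g'" using ent_exists by blast
  then show ?thesis using approx_aux[OF g'] by blast
qed

text \<open>Normality of \<open>Kn n\<close> in GL2(O): for integral g the matrix
  \<open>k ** g\<close> is as close to g as k is to 1.\<close>

lemma conj_int:
  assumes "g ** g' = mat 1" "ent 0 g" "ent 0 g'" "k \<in> Kn n"
  shows "\<exists>k'\<in>Kn n. k ** g = g ** k'"
proof (rule approx_aux[OF assms(1), of 0])
  have "ent (n + 0) ((k - mat 1) ** g)" using assms(2,4) by (intro ent_mult) (auto simp: Kn_def)
  then show "ent (n + 0) (k ** g - g)" by (simp add: matrix_diff_rdistrib)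
qed (use assms in simp_all)

text \<open>For a g that is not integral the congruence subgroup has to shrink before its conjugate
  fits into \<open>Kn n\<close>. This makes translates of smooth vectors smooth.\<close>

lemma conj_Kn:
  assumes "g \<in> GL2"
  shows "\<exists>N\<ge>1. \<forall>k\<in>Kn N. \<exists>k'\<in>Kn n. k ** g = g ** k'"
proof -
  obtain N where N: "\<forall>h. ent N (h - g) \<longrightarrow> (\<exists>k\<in>Kn n. h = g ** k)" using approx[OF assms] by blast
  obtain M where M: "M \<ge> 0" "ent (- M) g" using ent_exists by blast
  define N' where "N' = max 1 (N + M)"
  have "ent N (k ** g - g)" if "k \<in> Kn N'" for k
  proof -
    have "ent (N' + - M) ((k - mat 1) ** g)" using that M by (intro ent_mult) (auto simp: Kn_def)
    then show ?thesis by (auto simp: N'_def matrix_diff_rdistrib intro: ent_mono)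
  qed
  then show ?thesis using N by (intro exI[of _ N']) (auto simp: N'_def)
qed

section \<open>The Iwahori subgroup, its pro-p part and GL2(O)\<close>

definition Iw :: "('f^2^2) set" where
  "Iw = {g. unit (g $ 1 $ 1) \<and> unit (g $ 2 $ 2) \<and> g $ 1 $ 2 \<in> V 0 \<and> g $ 2 $ 1 \<in> V 1}"

definition Iw1 :: "('f^2^2) set" where
  "Iw1 = {g. g $ 1 $ 1 - 1 \<in> V 1 \<and> g $ 2 $ 2 - 1 \<in> V 1 \<and> g $ 1 $ 2 \<in> V 0 \<and> g $ 2 $ 1 \<in> V 1}"

definition KK :: "('f^2^2) set" where
  "KK = {g. ent 0 g \<and> unit (det g)}"

lemma mk_Iw [simp]: "mk a b c d \<in> Iw \<longleftrightarrow> unit a \<and> unit d \<and> b \<in> V 0 \<and> c \<in> V 1"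
  by (auto simp: Iw_def)

lemma mk_Iw1 [simp]: "mk a b c d \<in> Iw1 \<longleftrightarrow> a - 1 \<in> V 1 \<and> d - 1 \<in> V 1 \<and> b \<in> V 0 \<and> c \<in> V 1"
  by (auto simp: Iw1_def)

lemma mk_KK [simp]: "mk a b c d \<in> KK \<longleftrightarrow> a \<in> V 0 \<and> b \<in> V 0 \<and> c \<in> V 0 \<and> d \<in> V 0 \<and> unit (a*d - b*c)"
  by (simp add: KK_def conj_assoc)

lemma KK_GL2: "k \<in> KK \<Longrightarrow> k \<in> GL2"
  by (simp add: KK_def GL2_def unit_nz)

lemma KK_mult: "k \<in> KK \<Longrightarrow> k' \<in> KK \<Longrightarrow> k ** k' \<in> KK"
  using ent_mult[of 0 k 0 k'] by (simp add: KK_def det_mul unit_mult)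

lemma Iw_KK: "i \<in> Iw \<Longrightarrow> i \<in> KK"
  by (cases i rule: mk_cases)
    (auto intro!: V1_V0[of "_ * _"] unit_diff unit_mult V_mult0 intro: unit_V0 V1_V0)

lemma Iw_GL2: "i \<in> Iw \<Longrightarrow> i \<in> GL2"
  using Iw_KK KK_GL2 by blast

lemma unit_add': "unit u \<Longrightarrow> x \<in> V 1 \<Longrightarrow> unit (x + u)"
  using unit_add[of u x] by (simp add: add.commute)

lemma Iw_mult:
  assumes "i \<in> Iw" "j \<in> Iw" shows "i ** j \<in> Iw"
proof -
  obtain a b c d where i: "i = mk a b c d" by (rule mk_cases)
  obtain a' b' c' d' where j: "j = mk a' b' c' d'" by (rule mk_cases)
  have *: "unit a" "unit d" "b \<in> V 0" "c \<in> V 1" "unit a'" "unit d'" "b' \<in> V 0" "c' \<in> V 1"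
    using assms by (simp_all add: i j)
  have "unit (a*a' + b*c')" by (intro unit_add unit_mult V_mult0 *)
  moreover have "unit (c*b' + d*d')" by (intro unit_add' unit_mult V_mult0' *)
  moreover have "a*b' + b*d' \<in> V 0" "c*a' + d*c' \<in> V 1"
    using * by (auto intro!: V_add intro: V_mult0 V_mult0' unit_V0)
  ultimately show ?thesis by (simp add: i j)
qed

lemma unit_of_one: "x - 1 \<in> V 1 \<Longrightarrow> unit x"
  by (rule unit_congI[OF unit_1])

lemma Iw1_Iw: "i \<in> Iw1 \<Longrightarrow> i \<in> Iw"
  by (cases i rule: mk_cases) (simp add: unit_of_one)

lemma Kn_Iw1: "n \<ge> 1 \<Longrightarrow> k \<in> Kn n \<Longrightarrow> k \<in> Iw1"
  by (cases k rule: mk_cases) (auto intro: V_mono)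

lemma Kn_GL2: "n \<ge> 1 \<Longrightarrow> k \<in> Kn n \<Longrightarrow> k \<in> GL2"
  using Kn_Iw1 Iw1_Iw Iw_GL2 by blast

lemma KK_inverse:
  assumes "k \<in> KK"
  obtains k' where "k' \<in> KK" "k ** k' = mat 1" "k' ** k = mat 1"
proof -
  obtain a b c d where k: "k = mk a b c d" by (rule mk_cases)
  define D where "D = a*d - b*c"
  have D: "unit D" using assms by (simp add: k D_def)
  have 1: "(a * d - b * c) / D = 1" using unit_nz[OF D] by (simp add: D_def)
  have "d/D * (a/D) - (-b/D) * (-c/D) = inverse D * ((a * d - b * c) / D)"
    by (simp add: divide_inverse algebra_simps)
  also have "\<dots> = inverse D" by (simp only: 1) simp
  finally have "mk (d/D) (-b/D) (-c/D) (a/D) \<in> KK"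
    using assms D unit_inverse[OF D] by (simp add: k V_div_unit del: times_divide_eq_right times_divide_eq_left)
  then show ?thesis
    using 1 by (intro that[of "mk (d/D) (-b/D) (-c/D) (a/D)"])
      (simp_all add: k mat_mk diff_divide_distrib mult.commute)
qed

definition tm :: "int \<Rightarrow> 'f^2^2" where "tm n = mk (pi powi n) 0 0 1"
definition Pi :: "'f^2^2" where "Pi = mk 0 1 pi 0"

lemma tm_GL2 [simp]: "tm n \<in> GL2" and tm_Borel [simp]: "tm n \<in> Borel" and Pi_GL2 [simp]: "Pi \<in> GL2"
  by (simp_all add: tm_def Pi_def)

lemma tm_add: "tm m ** tm n = tm (m + n)"
  by (simp add: tm_def power_int_add)

lemma tm_0: "tm 0 = mat 1"
  by (simp add: tm_def mat_mk)

lemma low_tm: "low c ** tm n = tm n ** low (pi powi n * c)"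
  by (simp add: tm_def low_def)

lemma swp_Pi: "swp ** Pi = tm 1"
  by (simp add: tm_def swp_def Pi_def)

lemma uni_Iw [simp]: "b \<in> V 0 \<Longrightarrow> uni b \<in> Iw" and low_Iw [simp]: "c \<in> V 1 \<Longrightarrow> low c \<in> Iw"
  by (simp_all add: uni_def low_def)

text \<open>The coset B g is the point [c : d] of the projective line given by the bottom row of g.
  Either c/d lies in the maximal ideal or d/c lies in O; these are the two double cosets of B and
  the Iwahori subgroup.\<close>

lemma GL2_decomp:
  assumes "g \<in> GL2"
  shows "(\<exists>b\<in>Borel. \<exists>x\<in>V 1. g = b ** low x) \<or> (\<exists>b\<in>Borel. \<exists>x\<in>V 0. g = b ** swp ** uni x)"
proof -
  obtain a b c d where g: "g = mk a b c d" by (rule mk_cases)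
  have D: "a*d - b*c \<noteq> 0" using assms by (simp add: g)
  show ?thesis
  proof (cases "d \<noteq> 0 \<and> c / d \<in> V 1")
    case True
    then have "g = mk ((a*d - b*c)/d) b 0 d ** low (c/d)"
      by (simp add: g low_def diff_divide_distrib)
    moreover have "mk ((a*d - b*c)/d) b 0 d \<in> Borel" using True D by simp
    ultimately show ?thesis using True by blast
  next
    case False
    have c: "c \<noteq> 0" using False D by auto
    have dc: "d / c \<in> V 0"
    proof (cases "d = 0")
      case False
      then show ?thesis using \<open>\<not> (d \<noteq> 0 \<and> c / d \<in> V 1)\<close> c by (auto simp: V_iff v_divide)
    qed simp
    have "g = mk (b - a*d/c) a 0 c ** swp ** uni (d/c)"
      using c by (simp add: g swp_def uni_def)
    moreover have "mk (b - a*d/c) a 0 c \<in> Borel" using c D by (simp add: field_simps)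
    ultimately show ?thesis using dc by blast
  qed
qed

lemma Borel_decomp:
  assumes "b \<in> Borel"
  obtains z a n u where "z \<noteq> 0" "unit u" "b = mat z ** uni a ** tm n ** mk u 0 0 1"
proof -
  obtain x y w where b: "b = mk x y 0 w" "x \<noteq> 0" "w \<noteq> 0" using Borel_cases[OF assms] .
  define n where "n = v (x / w)"
  have "unit (x / w / pi powi n)" unfolding n_def using b by (intro unit_decomp) simp
  moreover have "b = mat w ** uni (y/w) ** tm n ** mk (x / w / pi powi n) 0 0 1"
    using b by (simp add: mat_mk uni_def tm_def)
  ultimately show ?thesis using that b by blast
qed

section \<open>Characters trivial on 1 + m\<close>

definition ichar :: "('f \<Rightarrow> 'k::field) \<Rightarrow> bool" where
  "ichar \<eta> \<longleftrightarrow> (\<forall>u w. unit u \<longrightarrow> unit w \<longrightarrow> \<eta> (u * w) = \<eta> u * \<eta> w) \<and> (\<forall>x. x - 1 \<in> V 1 \<longrightarrow> \<eta> x = 1)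
    \<and> (\<forall>u. unit u \<longrightarrow> \<eta> u \<noteq> 0)"

definition cchar :: "('f \<Rightarrow> 'k::field) \<Rightarrow> bool" where
  "cchar \<omega> \<longleftrightarrow> (\<forall>u w. u \<noteq> 0 \<longrightarrow> w \<noteq> 0 \<longrightarrow> \<omega> (u * w) = \<omega> u * \<omega> w) \<and> (\<forall>x. x - 1 \<in> V 1 \<longrightarrow> \<omega> x = 1)
    \<and> (\<forall>u. u \<noteq> 0 \<longrightarrow> \<omega> u \<noteq> 0)"

lemma ichar_cong: assumes "ichar \<eta>" "unit u" "w - u \<in> V 1" shows "\<eta> w = \<eta> u"
proof -
  have "(w - u) / u \<in> V 1" using assms by (simp add: V_div_unit)
  then have "w / u - 1 \<in> V 1" using unit_nz[OF assms(2)] by (simp add: diff_divide_distrib)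
  then have "\<eta> (w / u) = 1" "unit (w / u)" using assms(1) by (auto simp: ichar_def unit_of_one)
  then show ?thesis using assms(1,2) unit_nz[OF assms(2)] unfolding ichar_def
    by (metis mult_1 nonzero_divide_eq_eq)
qed

lemma ichar_1: "ichar \<eta> \<Longrightarrow> \<eta> 1 = 1" by (simp add: ichar_def)
lemma ichar_mult: "ichar \<eta> \<Longrightarrow> unit u \<Longrightarrow> unit w \<Longrightarrow> \<eta> (u * w) = \<eta> u * \<eta> w" by (simp add: ichar_def)
lemma ichar_nz: "ichar \<eta> \<Longrightarrow> unit u \<Longrightarrow> \<eta> u \<noteq> 0" by (simp add: ichar_def)

lemma cchar_ichar: "cchar \<omega> \<Longrightarrow> ichar \<omega>"
  by (auto simp: ichar_def cchar_def unit_nz)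

lemma cchar_1: "cchar \<omega> \<Longrightarrow> \<omega> 1 = 1" by (simp add: cchar_def)
lemma cchar_mult: "cchar \<omega> \<Longrightarrow> u \<noteq> 0 \<Longrightarrow> w \<noteq> 0 \<Longrightarrow> \<omega> (u * w) = \<omega> u * \<omega> w" by (simp add: cchar_def)
lemma cchar_nz: "cchar \<omega> \<Longrightarrow> u \<noteq> 0 \<Longrightarrow> \<omega> u \<noteq> 0" by (simp add: cchar_def)

text \<open>Pigeonhole on the powers of u in the finite residue field. It makes diagonal units act
  with finite order on the vectors fixed by \<open>Iw1\<close>.\<close>

lemma unit_finite_order:
  assumes "unit u" shows "\<exists>m\<ge>1. u ^ m - 1 \<in> V 1"
proof -
  have "\<not> inj_on (\<lambda>i. rep 1 (u ^ i)) (UNIV :: nat set)"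
  proof
    assume "inj_on (\<lambda>i. rep 1 (u ^ i)) (UNIV :: nat set)"
    moreover have "(\<lambda>i. rep 1 (u ^ i)) ` UNIV \<subseteq> L"
      using assms by (auto intro!: rep_in_L unit_V0 unit_power)
    ultimately show False
      using finite_L finite_imageD finite_subset infinite_UNIV_nat by blast
  qed
  then obtain i j where "rep 1 (u ^ i) = rep 1 (u ^ j)" "i < j"
    unfolding inj_on_def by (metis linorder_neqE_nat)
  then have "u ^ j - u ^ i \<in> V 1" by (simp add: rep_eq_iff V_diff_commute)
  also have "u ^ j - u ^ i = u ^ i * (u ^ (j - i) - 1)"
    using \<open>i < j\<close> by (simp add: algebra_simps flip: power_add)
  finally have "u ^ (j - i) - 1 \<in> V 1" using V_mult_unit[OF unit_power[OF assms]] by simp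
  then show ?thesis using \<open>i < j\<close> by (intro exI[of _ "j - i"]) simp
qed

end

section \<open>Eigenvectors of commuting operators\<close>

locale closure_space = vector_space scale
  for scale :: "'k::field \<Rightarrow> 'v::ab_group_add \<Rightarrow> 'v" +
  fixes p :: nat
  assumes ac: "\<forall>q :: 'k poly. degree q > 0 \<longrightarrow> (\<exists>x. poly q x = 0)"
    and char_p: "CHAR('k) = p" and p: "prime p"
begin

definition lin :: "('v \<Rightarrow> 'v) \<Rightarrow> bool" where
  "lin T \<longleftrightarrow> (\<forall>x y. T (x + y) = T x + T y) \<and> (\<forall>c x. T (scale c x) = scale c (T x))"

lemma lin_0: "lin T \<Longrightarrow> T 0 = 0"
  unfolding lin_def by (metis scale_zero_left)

lemma lin_diff: "lin T \<Longrightarrow> T (x - y) = T x - T y"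
  unfolding lin_def by (metis add_diff_cancel diff_add_cancel)

lemma lin_pow: "lin T \<Longrightarrow> lin (T ^^ n)"
  by (induction n) (auto simp: lin_def)

lemma lin_sum: "lin T \<Longrightarrow> T (sum f A) = (\<Sum>i\<in>A. T (f i))"
  by (induction A rule: infinite_finite_induct) (auto simp: lin_0, auto simp: lin_def)

definition pact :: "('v \<Rightarrow> 'v) \<Rightarrow> 'k poly \<Rightarrow> 'v \<Rightarrow> 'v" where
  "pact T Q y = (\<Sum>i\<le>degree Q. scale (coeff Q i) ((T ^^ i) y))"

lemma pact_bound:
  assumes "degree Q \<le> n"
  shows "pact T Q y = (\<Sum>i\<le>n. scale (coeff Q i) ((T ^^ i) y))"
  unfolding pact_def using assms
  by (intro sum.mono_neutral_left) (auto simp: coeff_eq_0)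

lemma pact_linear_factor:
  assumes "lin T"
  shows "pact T ([:- \<kappa>, 1:] * Q) y = pact T Q (T y - scale \<kappa> y)"
proof -
  define n where "n = Suc (degree Q)"
  have c: "coeff ([:- \<kappa>, 1:] * Q) i = - \<kappa> * coeff Q i + coeff (pCons 0 Q) i" for i
    by simp
  have "pact T ([:- \<kappa>, 1:] * Q) y = (\<Sum>i\<le>n. scale (coeff ([:- \<kappa>, 1:] * Q) i) ((T ^^ i) y))"
    by (rule pact_bound) (use degree_mult_le[of "[:- \<kappa>, 1:]" Q] in \<open>simp add: n_def\<close>)
  also have "\<dots> = (\<Sum>i\<le>n. scale (coeff (pCons 0 Q) i) ((T ^^ i) y)) - scale \<kappa> (\<Sum>i\<le>n. scale (coeff Q i) ((T ^^ i) y))"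
    unfolding c by (simp add: scale_left_distrib sum.distrib sum_negf scale_sum_right sum_subtractf scale_left_diff_distrib)
  also have "(\<Sum>i\<le>n. scale (coeff (pCons 0 Q) i) ((T ^^ i) y)) = pact T Q (T y)"
    unfolding n_def pact_def by (subst sum.atMost_Suc_shift) (simp add: funpow_swap1)
  also have "(\<Sum>i\<le>n. scale (coeff Q i) ((T ^^ i) y)) = pact T Q y"
    by (rule pact_bound[symmetric]) (simp add: n_def)
  also have "pact T Q (T y) - scale \<kappa> (pact T Q y) = pact T Q (T y - scale \<kappa> y)"
  proof -
    have "(T ^^ i) (T y - scale \<kappa> y) = (T ^^ i) (T y) - scale \<kappa> ((T ^^ i) y)" for i
      using lin_diff[OF lin_pow[OF assms]] lin_pow[OF assms, of i] by (simp add: lin_def)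
    then show ?thesis
      by (simp add: pact_def scale_right_diff_distrib sum_subtractf scale_sum_right mult.commute)
  qed
  finally show ?thesis .
qed

text \<open>Over an algebraically closed field Q has a root \<kappa>. Either T - \<kappa> kills y,
  or (T - \<kappa>) y is a nonzero vector killed by the cofactor, which has smaller degree.\<close>

lemma eigen_poly:
  assumes T: "lin T" and W: "subspace W" "\<And>y. y \<in> W \<Longrightarrow> T y \<in> W"
    and "y \<in> W" "y \<noteq> 0" "Q \<noteq> 0" "pact T Q y = 0"
  shows "\<exists>\<kappa> z. z \<in> W \<and> z \<noteq> 0 \<and> T z = scale \<kappa> z"
  using assms(4-7)
proof (induction "degree Q" arbitrary: Q y)
  case 0
  then show ?case by (auto simp: pact_def) (metis coeff_0_degree_minus_1 leading_coeff_0_iff)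
next
  case (Suc n)
  obtain \<kappa> where "poly Q \<kappa> = 0" using ac Suc.hyps(2) by (metis zero_less_Suc)
  then obtain Q' where Q': "Q = [:- \<kappa>, 1:] * Q'" by (auto simp: poly_eq_0_iff_dvd elim: dvdE)
  have nz: "Q' \<noteq> 0" using Suc.prems Q' by auto
  have deg: "n = degree Q'"
    using Suc.hyps(2) nz unfolding Q' by (subst (asm) degree_mult_eq) auto
  define y' where "y' = T y - scale \<kappa> y"
  show ?case
  proof (cases "y' = 0")
    case True
    then show ?thesis using Suc.prems by (auto simp: y'_def)
  next
    case False
    have "y' \<in> W" unfolding y'_def using Suc.prems W by (intro subspace_diff subspace_scale) auto
    moreover have "pact T Q' y' = 0" using Suc.prems(4) by (simp only: Q' pact_linear_factor[OF T] y'_def)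
    ultimately show ?thesis using Suc.hyps(1)[OF deg] False nz by blast
  qed
qed

text \<open>An eigenspace of one operator is preserved by the others, so the operators can be
  treated one at a time. Each has finite order m on W, possibly divisible by p, and need not be
  diagonalizable; a single root of X^m - 1 is enough.\<close>

lemma commuting_eigen:
  assumes "finite B" "subspace W" "y \<in> W" "y \<noteq> 0"
    and "\<And>b. b \<in> B \<Longrightarrow> lin (T b)"
    and "\<And>b y. b \<in> B \<Longrightarrow> y \<in> W \<Longrightarrow> T b y \<in> W"
    and "\<And>b b' y. b \<in> B \<Longrightarrow> b' \<in> B \<Longrightarrow> y \<in> W \<Longrightarrow> T b (T b' y) = T b' (T b y)"
    and "\<And>b. b \<in> B \<Longrightarrow> \<exists>m\<ge>1. \<forall>y\<in>W. (T b ^^ m) y = y"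
  shows "\<exists>y\<in>W. y \<noteq> 0 \<and> (\<forall>b\<in>B. \<exists>\<kappa>. T b y = scale \<kappa> y)"
  using assms
proof (induction B arbitrary: W y rule: finite_induct)
  case empty
  then show ?case by auto
next
  case (insert b B)
  obtain m where m: "m \<ge> 1" "\<forall>y\<in>W. (T b ^^ m) y = y" using insert.prems(7)[of b] by auto
  define Q where "Q = (monom 1 m - 1 :: 'k poly)"
  have "coeff Q m = 1" using m(1) by (simp add: Q_def)
  then have "Q \<noteq> 0" by auto
  have "degree Q \<le> m" unfolding Q_def by (rule degree_diff_le) (simp_all add: degree_monom_le)
  then have "pact (T b) Q y = (\<Sum>i\<le>m. scale (coeff Q i) ((T b ^^ i) y))" by (rule pact_bound)
  also have "\<dots> = (\<Sum>i\<le>m. (if i = m then (T b ^^ i) y else 0) - (if i = 0 then (T b ^^ i) y else 0))"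
    by (rule sum.cong) (auto simp: Q_def scale_left_diff_distrib coeff_1)
  also have "\<dots> = (T b ^^ m) y - y" by (simp add: sum_subtractf)
  also have "\<dots> = 0" using m(2) insert.prems by simp
  finally have "pact (T b) Q y = 0" .
  then have "\<exists>\<kappa> z. z \<in> W \<and> z \<noteq> 0 \<and> T b z = scale \<kappa> z"
    using insert.prems \<open>Q \<noteq> 0\<close> by (intro eigen_poly[of "T b" W y Q]) auto
  then obtain \<kappa> z where z: "z \<in> W" "z \<noteq> 0" "T b z = scale \<kappa> z" by (elim exE conjE)
  define W' where "W' = {y \<in> W. T b y = scale \<kappa> y}"
  have sub: "subspace W'"
    using insert.prems(1) insert.prems(4)[of b]
    by (auto simp: W'_def subspace_def lin_0 scale_right_distrib mult.commute) (auto simp: lin_def mult.commute)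
  have "\<exists>y\<in>W'. y \<noteq> 0 \<and> (\<forall>b\<in>B. \<exists>\<kappa>. T b y = scale \<kappa> y)"
  proof (rule insert.IH[OF sub, of z])
    fix b' y assume b': "b' \<in> B" "y \<in> W'"
    then have "T b (T b' y) = T b' (T b y)" using insert.prems(6)[of b b'] by (simp add: W'_def)
    also have "\<dots> = scale \<kappa> (T b' y)"
      using b' insert.prems(4)[of b'] by (simp add: W'_def lin_def)
    finally show "T b' y \<in> W'" using b' insert.prems(5) by (simp add: W'_def)
  next
    fix b' assume "b' \<in> B"
    then show "\<exists>m\<ge>1. \<forall>y\<in>W'. (T b' ^^ m) y = y" using insert.prems(7)[of b'] by (auto simp: W'_def)
  qed (use insert.prems z in \<open>auto simp: W'_def\<close>)
  then show ?case by (auto simp: W'_def)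
qed

text \<open>\<open>R\<close> acts on \<open>W\<close> through a quotient with finitely many
  representatives \<open>B\<close>, and p-fold sums act trivially. On a common eigenvector the
  eigenvalues satisfy \<kappa>^p = 1, that is (\<kappa> - 1)^p = 0 in characteristic p, so they are
  1. The laws are asked for on \<open>W\<close> only, because the intended \<tau> is additive only
  on vectors fixed by a smaller subgroup.\<close>

lemma abelian_p_group_fixed:
  fixes \<tau> :: "'c::ab_group_add \<Rightarrow> 'v \<Rightarrow> 'v"
  assumes W: "subspace W" "y \<in> W" "y \<noteq> 0"
    and R: "0 \<in> R" "\<And>x y. x \<in> R \<Longrightarrow> y \<in> R \<Longrightarrow> x + y \<in> R"
    and lin: "\<And>x. x \<in> R \<Longrightarrow> lin (\<tau> x)"
    and pres: "\<And>x y. x \<in> R \<Longrightarrow> y \<in> W \<Longrightarrow> \<tau> x y \<in> W"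
    and zero: "\<And>y. y \<in> W \<Longrightarrow> \<tau> 0 y = y"
    and add: "\<And>x x' y. x \<in> R \<Longrightarrow> x' \<in> R \<Longrightarrow> y \<in> W \<Longrightarrow> \<tau> (x + x') y = \<tau> x (\<tau> x' y)"
    and pth: "\<And>x y. x \<in> R \<Longrightarrow> y \<in> W \<Longrightarrow> \<tau> (\<Sum>i<p. x) y = y"
    and B: "finite B" "B \<subseteq> R" "\<And>x. x \<in> R \<Longrightarrow> \<exists>b\<in>B. \<forall>y\<in>W. \<tau> x y = \<tau> b y"
  shows "\<exists>y\<in>W. y \<noteq> 0 \<and> (\<forall>x\<in>R. \<tau> x y = y)"
proof -
  have mem: "(\<Sum>i<n. x) \<in> R" if "x \<in> R" for x and n :: nat
    by (induction n) (auto intro: R that)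
  have pow: "(\<tau> x ^^ n) y = \<tau> (\<Sum>i<n. x) y" if "x \<in> R" "y \<in> W" for x y and n :: nat
  proof (induction n)
    case (Suc n)
    have "\<tau> x (\<tau> (\<Sum>i<n. x) y) = \<tau> (x + (\<Sum>i<n. x)) y" using that mem by (intro add[symmetric]) auto
    then show ?case using Suc by (simp add: add.commute)
  qed (simp add: zero that)
  have "\<exists>y\<in>W. y \<noteq> 0 \<and> (\<forall>b\<in>B. \<exists>\<kappa>. \<tau> b y = scale \<kappa> y)"
  proof (rule commuting_eigen[OF B(1) W])
    show "\<exists>m\<ge>1. \<forall>y\<in>W. (\<tau> b ^^ m) y = y" if "b \<in> B" for b
      using B(2) that pow pth p by (intro exI[of _ p]) (auto simp: Suc_le_eq prime_gt_0_nat)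
    show "\<tau> b (\<tau> b' y) = \<tau> b' (\<tau> b y)" if "b \<in> B" "b' \<in> B" "y \<in> W" for b b' y
      using add[of b b' y] add[of b' b y] that B(2) by (auto simp: add.commute subset_iff)
  qed (use B(2) lin pres in auto)
  then obtain y where y: "y \<in> W" "y \<noteq> 0" "\<forall>b\<in>B. \<exists>\<kappa>. \<tau> b y = scale \<kappa> y" by blast
  have "\<tau> b y = y" if b: "b \<in> B" for b
  proof -
    obtain \<kappa> where k: "\<tau> b y = scale \<kappa> y" using y b by blast
    have "(\<tau> b ^^ n) y = scale (\<kappa> ^ n) y" for n
      using k lin[of b] b B(2) by (induction n) (auto simp: lin_def mult.commute)
    moreover have "(\<tau> b ^^ p) y = y" using pow pth b B(2) y by auto
    ultimately have "scale (\<kappa> ^ p) y = scale 1 y" by simp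
    then have "\<kappa> ^ p = 1" using y(2) by (simp only: scale_right_imp_eq scale_cancel_right simp_thms)
    moreover have "((\<kappa> - 1) + 1) ^ p = (\<kappa> - 1) ^ p + 1 ^ p"
      by (rule freshmans_dream) (simp_all add: char_p p)
    ultimately have "(\<kappa> - 1) ^ p = 0" by simp
    then have "\<kappa> = 1" by simp
    then show ?thesis using k by simp
  qed
  then show ?thesis using y B(3) by metis
qed

end

section \<open>Iwahori eigenvectors in representations of G\<close>

text \<open>Smoothness is no part of this notion, so that the space of all functions on matrices and
  its product with the given representation are instances too.\<close>

locale G_rep = local_field v p pi + closure_space scale p
  for v :: "'f::field \<Rightarrow> int" and p :: nat and pi :: 'f
    and scale :: "'k::field \<Rightarrow> 'v::ab_group_add \<Rightarrow> 'v" +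
  fixes act :: "'f^2^2 \<Rightarrow> 'v \<Rightarrow> 'v"
  assumes act_add: "g \<in> GL2 \<Longrightarrow> act g (x + y) = act g x + act g y"
    and act_scale: "g \<in> GL2 \<Longrightarrow> act g (scale c x) = scale c (act g x)"
    and act_one [simp]: "act (mat 1) x = x"
    and act_mult: "g \<in> GL2 \<Longrightarrow> h \<in> GL2 \<Longrightarrow> act (g ** h) x = act g (act h x)"
begin

lemma act_lin: "g \<in> GL2 \<Longrightarrow> lin (act g)"
  by (simp add: lin_def act_add act_scale)

lemma act_0 [simp]: "g \<in> GL2 \<Longrightarrow> act g 0 = 0"
  by (simp add: lin_0 act_lin)

lemma act_sum: "g \<in> GL2 \<Longrightarrow> act g (sum f A) = (\<Sum>i\<in>A. act g (f i))"
  by (simp add: lin_sum act_lin)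

lemma act_eq_0_iff [simp]: assumes "g \<in> GL2" shows "act g y = 0 \<longleftrightarrow> y = 0"
proof
  assume *: "act g y = 0"
  obtain h where "h \<in> GL2" "h ** g = mat 1" using GL2_right_inverse[OF assms] .
  then have "y = act h (act g y)" using assms by (simp flip: act_mult)
  then show "y = 0" using * \<open>h \<in> GL2\<close> by simp
qed (simp add: assms)

section \<open>Stable subspaces and vectors fixed by pro-p groups\<close>

definition stable :: "('f^2^2) set \<Rightarrow> 'v set \<Rightarrow> bool" where
  "stable H W \<longleftrightarrow> subspace W \<and> (\<forall>g\<in>H. \<forall>y\<in>W. act g y \<in> W)"

lemma stableD: "stable H W \<Longrightarrow> subspace W" "stable H W \<Longrightarrow> g \<in> H \<Longrightarrow> y \<in> W \<Longrightarrow> act g y \<in> W"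
  by (auto simp: stable_def)

lemma stable_mono: "stable H W \<Longrightarrow> H' \<subseteq> H \<Longrightarrow> stable H' W"
  by (auto simp: stable_def)

lemma stable_fixed:
  assumes "stable H W" "N \<subseteq> GL2" "H \<subseteq> GL2"
    and "\<And>h k. h \<in> H \<Longrightarrow> k \<in> N \<Longrightarrow> \<exists>k'\<in>N. k ** h = h ** k'"
  shows "stable H {y \<in> W. \<forall>k\<in>N. act k y = y}"
proof -
  have "act k (act h y) = act h y" if "h \<in> H" "k \<in> N" "\<forall>k\<in>N. act k y = y" for h k y
  proof -
    have "\<exists>k'\<in>N. k ** h = h ** k'" using assms(4) that by blast
    then obtain k' where k': "k' \<in> N" "k ** h = h ** k'" by blast
    have "h \<in> GL2" "k \<in> GL2" "k' \<in> GL2" using assms(2,3) that k' by auto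
    then have "act k (act h y) = act h (act k' y)" by (simp add: k'(2) flip: act_mult)
    then show ?thesis using that k' by simp
  qed
  then show ?thesis
    using assms(1-3) unfolding stable_def
    by (auto simp: subspace_def act_add act_scale subset_iff)
qed

text \<open>The quotient of consecutive congruence subgroups is the additive group of matrices
  over the residue field.\<close>

definition cg :: "int \<Rightarrow> 'f^2^2 \<Rightarrow> 'f^2^2" where
  "cg j X = mk (1 + pi powi j * X $ 1 $ 1) (pi powi j * X $ 1 $ 2) (pi powi j * X $ 2 $ 1) (1 + pi powi j * X $ 2 $ 2)"

lemma cg_Kn: "ent n X \<Longrightarrow> cg j X \<in> Kn (j + n)"
  by (auto simp: cg_def V_powi_mult ent_def)

lemma cg_cong:
  assumes "j \<ge> 1" "ent 0 X" "ent 0 Y" "ent (j + 1) (h - cg j X)"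
  shows "\<exists>k\<in>Kn (j + 1). h = cg j X ** k"
proof -
  have "cg j X \<in> KK"
    using cg_Kn[OF assms(2), of j] assms(1) by (auto intro: Kn_Iw1 Iw1_Iw Iw_KK)
  then obtain g' where "cg j X ** g' = mat 1" "g' \<in> KK" using KK_inverse by metis
  then show ?thesis using approx_aux[of "cg j X" g' 0 "j + 1" h] assms by (simp add: KK_def)
qed

text \<open>\<open>Kn j\<close> acts on the vectors fixed by \<open>Kn (j + 1)\<close> through an
  elementary abelian p-group, which must fix a nonzero vector.\<close>

lemma Kn_step:
  assumes W: "stable Iw W" and j: "j \<ge> 1" and y: "y \<in> W" "y \<noteq> 0" "\<forall>k\<in>Kn (j + 1). act k y = y"
  shows "\<exists>y\<in>W. y \<noteq> 0 \<and> (\<forall>k\<in>Kn j. act k y = y)"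
proof -
  define W' where "W' = {y \<in> W. \<forall>k\<in>Kn (j + 1). act k y = y}"
  have Kj: "Kn j \<subseteq> Iw" "Kn (j + 1) \<subseteq> Iw" using j by (auto intro!: Iw1_Iw intro: Kn_Iw1[of j] Kn_Iw1[of "j + 1"])
  have "stable Iw W'" unfolding W'_def
  proof (rule stable_fixed[OF W])
    fix h k assume "h \<in> Iw" "k \<in> Kn (j + 1)"
    moreover obtain h' where "h' \<in> KK" "h ** h' = mat 1" using KK_inverse[OF Iw_KK[OF \<open>h \<in> Iw\<close>]] .
    ultimately show "\<exists>k'\<in>Kn (j + 1). k ** h = h ** k'"
      using Iw_KK[of h] by (intro conj_int[of h h']) (auto simp: KK_def)
  qed (use Kj Iw_GL2 in auto)
  then have W': "subspace W'" "\<And>i y. i \<in> Iw \<Longrightarrow> y \<in> W' \<Longrightarrow> act i y \<in> W'" by (auto dest: stableD)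
  have cgI: "cg j X \<in> Kn j" if "ent 0 X" for X using cg_Kn[OF that, of j] by simp
  have cgG: "cg j X \<in> GL2" if "ent 0 X" for X using cgI[OF that] Kj(1) Iw_GL2 by blast
  have fixK: "act (h ** k) y = act h y" if "k \<in> Kn (j + 1)" "y \<in> W'" "h \<in> GL2" for h k y
    using that Kj(2) by (auto simp: act_mult W'_def Iw_GL2 subset_iff)
  have "\<exists>y\<in>W'. y \<noteq> 0 \<and> (\<forall>X\<in>{X. ent 0 X}. act (cg j X) y = y)"
  proof (rule abelian_p_group_fixed)
    show "y \<in> W'" "y \<noteq> 0" using y by (auto simp: W'_def)
    show "finite ((\<lambda>(a, b, c, d). mk a b c d) ` (L \<times> L \<times> L \<times> L))" by simp
    show "(\<lambda>(a, b, c, d). mk a b c d) ` (L \<times> L \<times> L \<times> L) \<subseteq> {X. ent 0 X}" by (auto simp: L_V0)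
  next
    fix X assume X: "X \<in> {X. ent 0 X}"
    define b where "b = mk (rep 1 (X $ 1 $ 1)) (rep 1 (X $ 1 $ 2)) (rep 1 (X $ 2 $ 1)) (rep 1 (X $ 2 $ 2))"
    have b: "b \<in> (\<lambda>(a, b, c, d). mk a b c d) ` (L \<times> L \<times> L \<times> L)"
      using X by (auto simp: b_def ent_def intro!: image_eqI[of _ _ "(_, _, _, _)"] rep_in_L)
    have "ent 0 b" unfolding b_def ent_mk using X by (auto simp: ent_def intro: rep_V0)
    moreover have "ent (j + 1) (cg j X - cg j b)"
      using rep_diff[of 1] by (simp add: cg_def b_def diff_mk V_powi_mult V_diff_commute flip: right_diff_distrib)
    ultimately obtain k where "k \<in> Kn (j + 1)" "cg j X = cg j b ** k" using cg_cong[OF j] by blast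
    then show "\<exists>b\<in>(\<lambda>(a, b, c, d). mk a b c d) ` (L \<times> L \<times> L \<times> L). \<forall>y\<in>W'. act (cg j X) y = act (cg j b) y"
      using b fixK cgG[OF \<open>ent 0 b\<close>] by (intro bexI[OF _ b]) auto
  next
    fix X Y y assume XY: "X \<in> {X. ent 0 X}" "Y \<in> {X. ent 0 X}" and y: "y \<in> W'"
    have "ent 0 (X + Y)" using XY by (simp add: ent_add)
    moreover have "ent (j + 1) (cg j X ** cg j Y - cg j (X + Y))"
    proof -
      \<comment> \<open>Additivity fails only by pi^(2j) X Y, and 2j \<ge> j + 1 because j \<ge>
        1.\<close>
      have "cg j X ** cg j Y - cg j (X + Y) =
        mk (pi powi j * (pi powi j * (X$1$1 * Y$1$1 + X$1$2 * Y$2$1))) (pi powi j * (pi powi j * (X$1$1 * Y$1$2 + X$1$2 * Y$2$2)))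
           (pi powi j * (pi powi j * (X$2$1 * Y$1$1 + X$2$2 * Y$2$1))) (pi powi j * (pi powi j * (X$2$1 * Y$1$2 + X$2$2 * Y$2$2)))"
        by (simp add: cg_def diff_mk algebra_simps)
      moreover have "X$a$b * Y$b$c + X$a$d * Y$d$c \<in> V (1 - j)" for a b c d
        using XY j by (intro V_mono[OF V_add[OF V_mult0 V_mult0]]) (auto simp: ent_def)
      ultimately show ?thesis by (simp add: V_powi_mult)
    qed
    ultimately obtain k where k: "k \<in> Kn (j + 1)" "cg j X ** cg j Y = cg j (X + Y) ** k"
      using cg_cong[OF j] by blast
    then have "act (cg j X ** cg j Y) y = act (cg j (X + Y)) y"
      using fixK[OF k(1) y cgG[OF \<open>ent 0 (X + Y)\<close>]] by simp
    then show "act (cg j (X + Y)) y = act (cg j X) (act (cg j Y) y)"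
      using XY cgG by (simp add: act_mult)
  next
    fix X y assume X: "X \<in> {X. ent 0 X}" "y \<in> W'"
    have "(\<Sum>i<p. X) $ a $ b = of_nat p * X $ a $ b" for a b
      unfolding sum_component by simp
    moreover have "X $ a $ b \<in> V 0" for a b using X by (auto simp: ent_def)
    \<comment> \<open>p lies in the maximal ideal, so the p-fold sum of X is sent into
      \<open>Kn (j + 1)\<close>: the quotient has exponent p.\<close>
    ultimately have "(\<Sum>i<p. X) $ a $ b \<in> V 1" for a b
      using V_mult0'[OF p_in] by metis
    then have "ent 1 (\<Sum>i<p. X)" unfolding ent_def by blast
    then have "cg j (\<Sum>i<p. X) \<in> Kn (j + 1)" by (rule cg_Kn)
    then show "act (cg j (\<Sum>i<p. X)) y = y" using X by (simp add: W'_def)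
  next
    fix y assume "y \<in> W'"
    then show "act (cg j 0) y = y" using cg_Kn[of 1 0 j] by (simp add: W'_def)
  next
    fix X y assume X: "X \<in> {X. ent 0 X}" "y \<in> W'"
    then have "cg j X \<in> Iw" using cgI Kj(1) by blast
    then show "act (cg j X) y \<in> W'" using W'(2) X(2) by blast
  qed (use W'(1) cgG act_lin in \<open>auto intro: ent_add\<close>)
  then obtain y where y: "y \<in> W" "y \<noteq> 0" "\<And>X. ent 0 X \<Longrightarrow> act (cg j X) y = y" by (auto simp: W'_def)
  have "act k y = y" if k: "k \<in> Kn j" for k
  proof -
    obtain a b c d where kk: "k = mk a b c d" by (rule mk_cases)
    have "k = cg j (mk ((a - 1) / pi powi j) (b / pi powi j) (c / pi powi j) ((d - 1) / pi powi j))"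
      by (simp add: kk cg_def)
    moreover have "ent 0 (mk ((a - 1) / pi powi j) (b / pi powi j) (c / pi powi j) ((d - 1) / pi powi j))"
      using k by (simp add: kk V_div_powi)
    ultimately show ?thesis using y(3) by simp
  qed
  then show ?thesis using y by blast
qed

lemma Kn_descent:
  assumes W: "stable Iw W" and y: "y \<in> W" "y \<noteq> 0" "\<forall>k\<in>Kn (int n + 1). act k y = y"
  shows "\<exists>y\<in>W. y \<noteq> 0 \<and> (\<forall>k\<in>Kn 1. act k y = y)"
  using y
proof (induction n arbitrary: y)
  case (Suc n)
  have "\<exists>y\<in>W. y \<noteq> 0 \<and> (\<forall>k\<in>Kn (int n + 1). act k y = y)"
    using Suc.prems by (intro Kn_step[OF W, of _ y]) (simp_all add: add.commute)
  then show ?case using Suc.IH by blast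
qed auto

text \<open>Once \<open>Kn 1\<close> has been reached, what remains of \<open>Iw1\<close> are the
  matrices n(x) with x in O. On the vectors fixed by \<open>Kn 1\<close> they act through O/m, again
  an abelian p-group.\<close>

lemma pro_p_fixed:
  assumes W: "stable Iw W" and y: "y \<in> W" "y \<noteq> 0" and fx: "\<forall>k\<in>Kn n. act k y = y"
  shows "\<exists>y\<in>W. y \<noteq> 0 \<and> (\<forall>k\<in>Iw1. act k y = y)"
proof -
  have "\<forall>k\<in>Kn (int (nat n) + 1). act k y = y" using fx Kn_mono[of _ "int (nat n) + 1" n] by auto
  then obtain y where y: "y \<in> W" "y \<noteq> 0" "\<forall>k\<in>Kn 1. act k y = y" using Kn_descent[OF W y] by blast
  define W' where "W' = {y \<in> W. \<forall>k\<in>Kn 1. act k y = y}"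
  have K1: "Kn 1 \<subseteq> Iw" by (auto intro!: Iw1_Iw Kn_Iw1[of 1])
  have "stable Iw W'" unfolding W'_def
  proof (rule stable_fixed[OF W])
    fix h k assume "h \<in> Iw" "k \<in> Kn 1"
    moreover obtain h' where "h' \<in> KK" "h ** h' = mat 1" using KK_inverse[OF Iw_KK[OF \<open>h \<in> Iw\<close>]] .
    ultimately show "\<exists>k'\<in>Kn 1. k ** h = h ** k'"
      using Iw_KK[of h] by (intro conj_int[of h h']) (auto simp: KK_def)
  qed (use K1 Iw_GL2 in auto)
  then have W': "subspace W'" "\<And>i y. i \<in> Iw \<Longrightarrow> y \<in> W' \<Longrightarrow> act i y \<in> W'" by (auto dest: stableD)
  have uK: "uni x \<in> Kn 1" if "x \<in> V 1" for x using that by (simp add: uni_def)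
  have "\<exists>y\<in>W'. y \<noteq> 0 \<and> (\<forall>x\<in>V 0. act (uni x) y = y)"
  proof (rule abelian_p_group_fixed)
    show "finite L" "L \<subseteq> V 0" by (auto simp: L_V0)
  next
    fix x assume x: "x \<in> V 0"
    have "uni x = uni (rep 1 x) ** uni (x - rep 1 x)" by (simp add: uni_add)
    moreover have "uni (x - rep 1 x) \<in> Kn 1" using rep_diff[of 1 x] by (intro uK) (simp add: V_diff_commute)
    ultimately have "\<forall>y\<in>W'. act (uni x) y = act (uni (rep 1 x)) y" by (simp add: act_mult W'_def)
    then show "\<exists>b\<in>L. \<forall>y\<in>W'. act (uni x) y = act (uni b) y" using rep_in_L[OF x] by blast
  next
    fix x y assume x: "x \<in> V 0" "y \<in> W'"
    then have "uni (\<Sum>i<p. x) \<in> Kn 1" using p_in by (intro uK) (auto intro: V_mult0')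
    then show "act (uni (\<Sum>i<p. x)) y = y" using x by (simp add: W'_def)
  next
    show "act (uni 0) y = y" if "y \<in> W'" for y using that uK[of 0] by (simp add: W'_def)
  qed (use W' y in \<open>auto intro: V_add act_lin simp: W'_def simp flip: uni_add act_mult\<close>)
  then obtain y where y: "y \<in> W'" "y \<noteq> 0" "\<forall>x\<in>V 0. act (uni x) y = y" by blast
  have "act k y = y" if k: "k \<in> Iw1" for k
  proof -
    obtain a b c d where kk: "k = mk a b c d" by (rule mk_cases)
    have d: "unit d" using k by (simp add: kk unit_of_one)
    \<comment> \<open>Clearing the upper right entry of k by n(b/d) leaves an element of
      \<open>Kn 1\<close>.\<close>
    define k' where "k' = mk (a - b * c / d) 0 c d"
    have e: "k = uni (b / d) ** k'" using unit_nz[OF d] by (simp add: kk k'_def uni_def)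
    have "b * c / d \<in> V 1" using k d by (simp add: kk V_div_unit V_mult0)
    moreover have "a - 1 \<in> V 1" using k by (simp add: kk)
    ultimately have "(a - 1) - b * c / d \<in> V 1" by (rule V_diff[rotated])
    also have "(a - 1) - b * c / d = a - b * c / d - 1" by simp
    finally have k': "k' \<in> Kn 1" using k by (simp add: k'_def kk)
    have "act k y = act (uni (b / d)) (act k' y)" using k' K1 Iw_GL2 by (auto simp: e act_mult)
    also have "\<dots> = y" using k' y k d by (auto simp: W'_def kk V_div_unit)
    finally show ?thesis .
  qed
  then show ?thesis using y by (auto simp: W'_def)
qed

text \<open>A character of the Iwahori subgroup trivial on \<open>Iw1\<close> depends only on the
  diagonal entries a, d modulo m. Since diag(a, d) is the scalar a times diag(1, d/a) and scalars
  act by \<omega>, one character \<eta> of the units describes the rest.\<close>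

definition Ieig :: "('f \<Rightarrow> 'k) \<Rightarrow> ('f \<Rightarrow> 'k) \<Rightarrow> 'v \<Rightarrow> bool" where
  "Ieig \<omega> \<eta> y \<longleftrightarrow> (\<forall>i\<in>Iw. act i y = scale (\<omega> (i $ 1 $ 1) * \<eta> (i $ 2 $ 2 / i $ 1 $ 1)) y)"

text \<open>The matrices diag(1, u) with u a unit commute, normalize \<open>Iw1\<close> and have
  finite order modulo it, so a common eigenvector exists. Finitely many u, the nonzero elements of
  \<open>L\<close>, suffice.\<close>

lemma Iw_eigen:
  assumes W: "stable Iw W" and y: "y \<in> W" "y \<noteq> 0" "\<forall>k\<in>Iw1. act k y = y"
    and \<omega>: "cchar \<omega>" "\<And>z y. z \<noteq> 0 \<Longrightarrow> y \<in> W \<Longrightarrow> act (mat z) y = scale (\<omega> z) y"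
  shows "\<exists>y \<eta>. y \<in> W \<and> y \<noteq> 0 \<and> ichar \<eta> \<and> Ieig \<omega> \<eta> y"
proof -
  define W' where "W' = {y \<in> W. \<forall>k\<in>Iw1. act k y = y}"
  define dg where "dg u = mk 1 0 0 (u :: 'f)" for u
  have dgI: "dg u \<in> Iw" if "unit u" for u using that by (simp add: dg_def)
  have dgG: "dg u \<in> GL2" if "u \<noteq> 0" for u using that by (simp add: dg_def)
  have dg_mult: "dg u ** dg w = dg (u * w)" for u w by (simp add: dg_def)
  have I1G: "Iw1 \<subseteq> GL2" using Iw1_Iw Iw_GL2 by blast
  have st: "stable (dg ` Collect unit) W'" unfolding W'_def
  proof (rule stable_fixed[OF stable_mono[OF W]])
    fix h k assume "h \<in> dg ` Collect unit" and k: "k \<in> Iw1"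
    then obtain u where u: "h = dg u" "unit u" by blast
    obtain a b c d where kk: "k = mk a b c d" by (rule mk_cases)
    have "k ** h = h ** mk a (b * u) (c / u) d" using unit_nz[OF u(2)] by (simp add: u kk dg_def)
    moreover have "mk a (b * u) (c / u) d \<in> Iw1"
      using k u unit_V0[of u] by (simp add: kk V_div_unit V_mult0)
    ultimately show "\<exists>k'\<in>Iw1. k ** h = h ** k'" by blast
  qed (use dgI dgG I1G in \<open>auto simp: unit_nz\<close>)
  have pres: "act (dg u) y \<in> W'" if "unit u" "y \<in> W'" for u y using stableD(2)[OF st] that by blast
  have pow: "(act (dg u) ^^ m) y = act (dg (u ^ m)) y" if u: "unit u" for u y m
  proof (induction m)
    case 0
    then show ?case by (simp add: dg_def flip: mat_mk)
  next
    case (Suc m)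
    then show ?case using unit_nz[OF u] by (simp add: dgG dg_mult flip: act_mult)
  qed
  have "\<exists>y\<in>W'. y \<noteq> 0 \<and> (\<forall>l\<in>L - {0}. \<exists>\<kappa>. act (dg l) y = scale \<kappa> y)"
  proof (rule commuting_eigen)
    show "subspace W'" using stableD(1)[OF st] .
    show "y \<in> W'" "y \<noteq> 0" using y by (auto simp: W'_def)
    fix l assume "l \<in> L - {0}"
    then have l: "unit l" by (auto simp: L_unit)
    show "lin (act (dg l))" using l by (intro act_lin dgG unit_nz)
    obtain m where m: "m \<ge> 1" "l ^ m - 1 \<in> V 1" using unit_finite_order[OF l] by blast
    then have "dg (l ^ m) \<in> Iw1" by (simp add: dg_def)
    then show "\<exists>m\<ge>1. \<forall>y\<in>W'. (act (dg l) ^^ m) y = y"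
      using m(1) by (intro exI[of _ m]) (auto simp: pow[OF l] W'_def)
    show "act (dg l) y \<in> W'" if "y \<in> W'" for y using pres l that by blast
    show "act (dg l) (act (dg b) y) = act (dg b) (act (dg l) y)" if "b \<in> L - {0}" for b y
      using l that by (simp add: dgG unit_nz dg_mult mult.commute flip: act_mult)
  qed simp
  then obtain y where y: "y \<in> W'" "y \<noteq> 0" "\<forall>l\<in>L - {0}. \<exists>\<kappa>. act (dg l) y = scale \<kappa> y" by blast
  have ex: "\<exists>\<kappa>. act (dg u) y = scale \<kappa> y" if u: "unit u" for u
  proof -
    define l where "l = rep 1 u"
    have lu: "l - u \<in> V 1" unfolding l_def by (rule rep_diff)
    have l: "unit l" using unit_congI[OF u lu] .
    have "dg u = dg l ** dg (u / l)" using unit_nz[OF l] by (simp add: dg_mult)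
    moreover have "(u - l) / l \<in> V 1" using lu by (simp add: V_div_unit[OF l] V_diff_commute)
    then have "dg (u / l) \<in> Iw1" using unit_nz[OF l] by (simp add: dg_def diff_divide_distrib)
    ultimately have "act (dg u) y = act (dg l) y"
      using y(1) l u by (simp add: act_mult dgG unit_nz W'_def)
    then show ?thesis using y(3) l u by (auto simp: l_def rep_in_L unit_V0 unit_nz)
  qed
  define \<eta> where "\<eta> u = (SOME \<kappa>. act (dg u) y = scale \<kappa> y)" for u
  have \<eta>: "act (dg u) y = scale (\<eta> u) y" if "unit u" for u
    unfolding \<eta>_def by (rule someI_ex[OF ex[OF that]])
  have uniq: "a = b" if "scale a y = scale b y" for a b using that y(2) by simp
  have "ichar \<eta>"
    unfolding ichar_def
  proof (intro conjI allI impI)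
    fix u w assume *: "unit u" "unit w"
    have "scale (\<eta> (u * w)) y = act (dg u) (act (dg w) y)"
      using * by (simp add: dgG unit_nz dg_mult unit_mult flip: \<eta> act_mult)
    also have "\<dots> = scale (\<eta> u * \<eta> w) y"
      using * by (simp add: \<eta> act_scale dgG unit_nz mult.commute)
    finally show "\<eta> (u * w) = \<eta> u * \<eta> w" by (rule uniq)
  next
    fix x assume x: "x - 1 \<in> V 1"
    then have "dg x \<in> Iw1" by (simp add: dg_def)
    then have "scale (\<eta> x) y = scale 1 y" using y(1) x by (simp add: unit_of_one W'_def flip: \<eta>)
    then show "\<eta> x = 1" by (rule uniq)
  next
    fix u assume u: "unit u"
    then show "\<eta> u \<noteq> 0" using \<eta>[OF u] y(2) by (metis act_eq_0_iff dgG scale_zero_left unit_nz)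
  qed
  moreover have "Ieig \<omega> \<eta> y"
    unfolding Ieig_def
  proof
    fix i assume i: "i \<in> Iw"
    obtain a b c d where ii: "i = mk a b c d" by (rule mk_cases)
    have *: "unit a" "unit d" "b \<in> V 0" "c \<in> V 1" using i by (simp_all add: ii)
    have nz: "a \<noteq> 0" "d \<noteq> 0" using * unit_nz by auto
    define k where "k = mk 1 (b / a) (c / d) 1"
    have k: "k \<in> Iw1" using * by (simp add: k_def V_div_unit)
    have "i = mat a ** (dg (d / a) ** k)" using nz by (simp add: ii dg_def k_def mat_mk)
    moreover have "k \<in> GL2" "mat a \<in> GL2" "dg (d / a) \<in> GL2" using k I1G nz by (auto simp: dgG mat_mk)
    ultimately have "act i y = act (mat a) (act (dg (d / a)) (act k y))"
      by (simp only: act_mult GL2_mult)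
    also have "\<dots> = scale (\<omega> a * \<eta> (d / a)) y"
      using k y(1) * nz \<omega>(2)[of a y] by (simp add: W'_def \<eta> unit_divide act_scale mat_mk mult.commute)
    finally show "act i y = scale (\<omega> (i $ 1 $ 1) * \<eta> (i $ 2 $ 2 / i $ 1 $ 1)) y" by (simp add: ii)
  qed
  ultimately show ?thesis using y by (auto simp: W'_def)
qed

section \<open>The operators U and S on Iwahori eigenvectors\<close>

definition hecke_U :: "'v \<Rightarrow> 'v" where "hecke_U y = (\<Sum>l\<in>L. act (uni l ** tm 1) y)"
text \<open>With I the Iwahori subgroup, the matrices n(l) \<open>tm 1\<close> and n(l)
  \<open>swp\<close> for l in \<open>L\<close> represent the left cosets of I in I
  \<open>tm 1\<close> I and in I \<open>swp\<close> I.\<close>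

definition hecke_S :: "'v \<Rightarrow> 'v" where "hecke_S y = (\<Sum>l\<in>L. act (uni l ** swp) y)"

lemma hecke_U_lin: "lin hecke_U"
  by (simp add: lin_def hecke_U_def act_add act_scale sum.distrib scale_sum_right)

lemma hecke_S_lin: "lin hecke_S"
  by (simp add: lin_def hecke_S_def act_add act_scale sum.distrib scale_sum_right)

text \<open>\<open>tm 1\<close> is \<open>swp ** Pi\<close>. So U y lies in the image of S, which
  will force on it the relations that \<open>f0\<close> satisfies.\<close>

lemma hecke_U_S: "hecke_U y = hecke_S (act Pi y)"
  by (simp add: hecke_U_def hecke_S_def flip: act_mult matrix_mul_assoc swp_Pi)

lemma hecke_U_mem: "stable Borel W \<Longrightarrow> y \<in> W \<Longrightarrow> hecke_U y \<in> W"
  unfolding hecke_U_def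
  by (intro subspace_sum stableD) (auto simp: uni_def tm_def)

lemma IeigD: "Ieig \<omega> \<eta> y \<Longrightarrow> mk a b c d \<in> Iw \<Longrightarrow> act (mk a b c d) y = scale (\<omega> a * \<eta> (d / a)) y"
  by (auto simp: Ieig_def)

lemma Ieig_fixed: assumes "cchar \<omega>" "ichar \<eta>" "Ieig \<omega> \<eta> y" "k \<in> Iw1" shows "act k y = y"
proof -
  obtain a b c d where k: "k = mk a b c d" by (rule mk_cases)
  have *: "unit a" "unit d" "d - 1 \<in> V 1" "a - 1 \<in> V 1" using assms(4) by (auto simp: k unit_of_one)
  have "(d - a) / a \<in> V 1" using V_diff[OF *(3,4)] *(1) by (simp add: V_div_unit)
  then have "d / a - 1 \<in> V 1" using unit_nz[OF *(1)] by (simp add: diff_divide_distrib)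
  then have "\<eta> (d / a) = 1" using assms(2) by (simp add: ichar_def)
  moreover have "\<omega> a = 1" using assms(1) *(4) by (simp add: cchar_def)
  ultimately show ?thesis using IeigD[OF assms(3), of a b c d] assms(4) * by (simp add: k)
qed

lemma Ieig_uni: "cchar \<omega> \<Longrightarrow> ichar \<eta> \<Longrightarrow> Ieig \<omega> \<eta> y \<Longrightarrow> b \<in> V 0 \<Longrightarrow> act (uni b) y = y"
  by (rule Ieig_fixed) (auto simp: uni_def)

lemma Ieig_low: "cchar \<omega> \<Longrightarrow> ichar \<eta> \<Longrightarrow> Ieig \<omega> \<eta> y \<Longrightarrow> c \<in> V 1 \<Longrightarrow> act (low c) y = y"
  by (rule Ieig_fixed) (auto simp: low_def)

lemma Ieig_subspace: "subspace {y. Ieig \<omega> \<eta> y}"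
  by (auto simp: subspace_def Ieig_def act_add act_scale scale_right_distrib Iw_GL2 mult.commute)

text \<open>i permutes the cosets of n(l) t through an affine map of the residue field, and the
  Iwahori element left over on the right has the same diagonal as i modulo m.\<close>

lemma Ieig_U:
  assumes \<omega>: "cchar \<omega>" and \<eta>: "ichar \<eta>" and y: "Ieig \<omega> \<eta> y"
  shows "Ieig \<omega> \<eta> (hecke_U y)"
  unfolding Ieig_def
proof
  fix i assume i: "i \<in> Iw"
  obtain a b c d where ii: "i = mk a b c d" by (rule mk_cases)
  have *: "unit a" "unit d" "b \<in> V 0" "c \<in> V 1" using i by (simp_all add: ii)
  have nz: "a \<noteq> 0" "d \<noteq> 0" using * unit_nz by auto
  define \<sigma> where "\<sigma> l = rep 1 (a / d * l + b / d)" for l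
  have bij: "bij_betw \<sigma> L L"
    unfolding \<sigma>_def using * by (intro L_affine_bij) (auto intro: unit_divide simp: V_div_unit)
  have step: "act i (act (uni l ** tm 1) y) = scale (\<omega> a * \<eta> (d / a)) (act (uni (\<sigma> l) ** tm 1) y)" if l: "l \<in> L" for l
  proof -
    have lV: "l \<in> V 0" "\<sigma> l \<in> V 0" using l L_V0 bij_betwE[OF bij] by auto
    define E where "E = a * l + b - \<sigma> l * (c * l + d)"
    \<comment> \<open>j solves i n(l) t = n(\<sigma> l) t j. Division by pi in its corner is
      possible because \<sigma> l was chosen to make E divisible by pi.\<close>
    define j where "j = mk (a - \<sigma> l * c) (E / pi) (pi * c) (c * l + d)"
    have s: "a / d * l + b / d - \<sigma> l \<in> V 1" unfolding \<sigma>_def using rep_diff V_diff_commute by blast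
    have "E = d * (a / d * l + b / d - \<sigma> l) - c * (\<sigma> l * l)"
      using nz by (simp add: E_def field_simps)
    also have "\<dots> \<in> V 1"
      by (rule V_diff[OF V_mult0[OF unit_V0[OF *(2)] s] V_mult0'[OF *(4) V_mult0[OF lV(2,1)]]])
    finally have e: "E \<in> V 1" .
    have u: "unit (a - \<sigma> l * c)" "unit (c * l + d)"
      using * lV by (auto intro!: unit_diff unit_add' intro: V_mult0 V_mult0')
    have j: "j \<in> Iw" using e u V_mult0[OF V1_V0, of pi c 1] * by (simp add: j_def V_div_pi V_pi_mult V1_V0)
    have "i ** (uni l ** tm 1) = uni (\<sigma> l) ** tm 1 ** j"
      by (simp add: ii uni_def tm_def j_def) (simp add: E_def algebra_simps)
    then have "act i (act (uni l ** tm 1) y) = act (uni (\<sigma> l) ** tm 1) (act j y)"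
      using Iw_GL2[OF i] Iw_GL2[OF j] by (simp flip: act_mult)
    also have "act j y = scale (\<omega> (a - \<sigma> l * c) * \<eta> ((c * l + d) / (a - \<sigma> l * c))) y"
      using IeigD[OF y] j by (simp add: j_def)
    also have "\<omega> (a - \<sigma> l * c) = \<omega> a"
      using * lV by (intro ichar_cong[OF cchar_ichar[OF \<omega>]]) (auto intro: V_mult0)
    also have "\<eta> ((c * l + d) / (a - \<sigma> l * c)) = \<eta> (d / a)"
    proof (rule ichar_cong[OF \<eta> unit_divide])
      have "(c * l + d) / (a - \<sigma> l * c) - d / a = (c * (a * l + d * \<sigma> l)) / (a * (a - \<sigma> l * c))"
        using nz unit_nz[OF u(1)] by (simp add: field_simps)
      also have "\<dots> \<in> V 1"
        using V_mult0'[OF *(4) V_add[OF V_mult0[OF unit_V0[OF *(1)] lV(1)] V_mult0[OF unit_V0[OF *(2)] lV(2)]]]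
        by (simp only: V_div_unit[OF unit_mult[OF *(1) u(1)]])
      finally show "(c * l + d) / (a - \<sigma> l * c) - d / a \<in> V 1" .
    qed (use * in auto)
    finally show ?thesis by (simp add: act_scale)
  qed
  have "act i (hecke_U y) = (\<Sum>l\<in>L. scale (\<omega> a * \<eta> (d / a)) (act (uni (\<sigma> l) ** tm 1) y))"
    unfolding hecke_U_def act_sum[OF Iw_GL2[OF i]] by (intro sum.cong refl step)
  also have "\<dots> = scale (\<omega> a * \<eta> (d / a)) (\<Sum>l\<in>L. act (uni (\<sigma> l) ** tm 1) y)"
    by (simp add: scale_sum_right)
  also have "(\<Sum>l\<in>L. act (uni (\<sigma> l) ** tm 1) y) = hecke_U y"
    unfolding hecke_U_def by (rule sum.reindex_bij_betw[OF bij])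
  finally show "act i (hecke_U y) = scale (\<omega> (i $ 1 $ 1) * \<eta> (i $ 2 $ 2 / i $ 1 $ 1)) (hecke_U y)"
    by (simp add: ii)
qed

lemma Pi_Iw:
  assumes "i \<in> Iw"
  shows "\<exists>j\<in>Iw. i ** Pi = Pi ** j \<and> j $ 1 $ 1 = i $ 2 $ 2 \<and> j $ 2 $ 2 = i $ 1 $ 1"
proof -
  obtain a b c d where ii: "i = mk a b c d" by (rule mk_cases)
  have "i ** Pi = Pi ** mk d (c / pi) (pi * b) a" by (simp add: ii Pi_def)
  then show ?thesis using assms by (intro bexI[of _ "mk d (c / pi) (pi * b) a"]) (auto simp: ii V_div_pi V_pi_mult)
qed

text \<open>Conjugation by \<open>Pi\<close> exchanges the diagonal entries. With u = d/a, the value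
  \<omega>(d) \<eta>(a/d) is \<omega>(a) times \<omega>(u) \<eta>(1/u).\<close>

lemma Ieig_Pi:
  assumes \<omega>: "cchar \<omega>" and \<eta>: "ichar \<eta>" and y: "Ieig \<omega> \<eta> y"
  shows "ichar (\<lambda>u. \<omega> u * \<eta> (inverse u))" "Ieig \<omega> (\<lambda>u. \<omega> u * \<eta> (inverse u)) (act Pi y)"
proof -
  have inv: "inverse x - 1 \<in> V 1" if "x - 1 \<in> V 1" for x
  proof -
    have x: "unit x" using that by (rule unit_of_one)
    then have "(x - 1) / x \<in> V 1" using that by (simp add: V_div_unit)
    then show ?thesis using unit_nz[OF x] V_diff_commute by (simp add: diff_divide_distrib inverse_eq_divide)
  qed
  show "ichar (\<lambda>u. \<omega> u * \<eta> (inverse u))"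
    using \<eta> cchar_ichar[OF \<omega>] inv by (auto simp: ichar_def unit_inverse)
  show "Ieig \<omega> (\<lambda>u. \<omega> u * \<eta> (inverse u)) (act Pi y)"
    unfolding Ieig_def
  proof
    fix i assume i: "i \<in> Iw"
    then obtain j where j: "j \<in> Iw" "i ** Pi = Pi ** j" "j $ 1 $ 1 = i $ 2 $ 2" "j $ 2 $ 2 = i $ 1 $ 1"
      using Pi_Iw by blast
    have u: "i $ 1 $ 1 \<noteq> 0" "i $ 2 $ 2 \<noteq> 0" using i by (auto simp: Iw_def unit_nz)
    have "act i (act Pi y) = act Pi (act j y)" using i j by (simp add: Iw_GL2 flip: act_mult)
    also have "\<dots> = scale (\<omega> (i $ 2 $ 2) * \<eta> (i $ 1 $ 1 / i $ 2 $ 2)) (act Pi y)"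
      using y j by (simp add: Ieig_def act_scale)
    also have "\<omega> (i $ 2 $ 2) = \<omega> (i $ 1 $ 1) * \<omega> (i $ 2 $ 2 / i $ 1 $ 1)"
      using u by (simp flip: cchar_mult[OF \<omega>])
    finally show "act i (act Pi y) = scale (\<omega> (i $ 1 $ 1) * (\<omega> (i $ 2 $ 2 / i $ 1 $ 1)
        * \<eta> (inverse (i $ 2 $ 2 / i $ 1 $ 1)))) (act Pi y)"
      by (simp add: mult.assoc)
  qed
qed

text \<open>Only the term of the identity coset leaves B: the elements swp n(l) t lie in B n^-(pi / l) for l a unit.\<close>

lemma swp_U:
  assumes "cchar \<omega>" "ichar \<eta>" "Ieig \<omega> \<eta> y"
  shows "act swp (hecke_U y) = act Pi y + (\<Sum>l\<in>L - {0}. act (mk (- pi / l) 1 0 l) y)"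
proof -
  have "act swp (hecke_U y) = (\<Sum>l\<in>L. act (swp ** (uni l ** tm 1)) y)"
    by (simp add: hecke_U_def act_sum act_mult)
  also have "\<dots> = act (swp ** (uni 0 ** tm 1)) y + (\<Sum>l\<in>L - {0}. act (swp ** (uni l ** tm 1)) y)"
    by (rule sum.remove) auto
  also have "swp ** (uni 0 ** tm 1) = Pi" by (simp add: swp_def uni_def tm_def Pi_def)
  also have "(\<Sum>l\<in>L - {0}. act (swp ** (uni l ** tm 1)) y) = (\<Sum>l\<in>L - {0}. act (mk (- pi / l) 1 0 l) y)"
  proof (rule sum.cong[OF refl])
    fix l assume "l \<in> L - {0}"
    then have l: "l \<noteq> 0" "unit l" by (auto simp: L_unit)
    have "swp ** (uni l ** tm 1) = mk (- pi / l) 1 0 l ** low (pi / l)"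
      using l by (simp add: swp_def uni_def tm_def low_def)
    then show "act (swp ** (uni l ** tm 1)) y = act (mk (- pi / l) 1 0 l) y"
      using l Ieig_low[OF assms, of "pi / l"] by (simp add: act_mult V_div_unit)
  qed
  finally show ?thesis .
qed

text \<open>The unipotent factors on the right of the two cells fix y, so only y and its
  \<open>swp\<close>-translate have to be moved by B.\<close>

lemma Borel_to_GL2:
  assumes "cchar \<omega>" "ichar \<eta>" "Ieig \<omega> \<eta> y" and W: "stable Borel W" "y \<in> W" "act swp y \<in> W" "g \<in> GL2"
  shows "act g y \<in> W"
  using GL2_decomp[OF \<open>g \<in> GL2\<close>]
proof (elim disjE bexE)
  fix b x assume "b \<in> Borel" "x \<in> V 1" "g = b ** low x"
  then show ?thesis using assms by (simp add: act_mult Borel_GL2 Ieig_low stableD)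
next
  fix b x assume "b \<in> Borel" "x \<in> V 0" "g = b ** swp ** uni x"
  then show ?thesis using assms by (simp add: act_mult Borel_GL2 Ieig_uni stableD)
qed

text \<open>With U y = 0, \<open>swp_U\<close> writes the \<open>Pi\<close>-translate of y as minus
  a sum of B-translates of y, so it lies in W; and diag(1, 1/pi) \<open>Pi\<close> is
  \<open>swp\<close>.\<close>

lemma U_kernel:
  assumes y: "cchar \<omega>" "ichar \<eta>" "Ieig \<omega> \<eta> y" and W: "stable Borel W" "y \<in> W"
    and U: "hecke_U y = 0" and g: "g \<in> GL2"
  shows "act g y \<in> W"
proof -
  have "(\<Sum>l\<in>L - {0}. act (mk (- pi / l) 1 0 l) y) \<in> W"
    using W by (intro subspace_sum stableD) auto
  moreover have "act Pi y = - (\<Sum>l\<in>L - {0}. act (mk (- pi / l) 1 0 l) y)"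
    using swp_U[OF y] by (simp add: U eq_neg_iff_add_eq_0)
  ultimately have "act Pi y \<in> W" using subspace_neg[OF stableD(1)[OF W(1)]] by simp
  then have "act (mk 1 0 0 (inverse pi)) (act Pi y) \<in> W" using W(1) by (rule_tac stableD(2)) auto
  also have "act (mk 1 0 0 (inverse pi)) (act Pi y) = act swp y"
    by (simp flip: act_mult) (simp add: Pi_def swp_def)
  finally show ?thesis by (rule Borel_to_GL2[OF y W _ g])
qed

end

section \<open>Functions on G\<close>

lemma sum_fun_apply: "(\<Sum>i\<in>A. f i) x = (\<Sum>i\<in>A. f i x)" for f :: "'a \<Rightarrow> 'b \<Rightarrow> 'c::comm_monoid_add"
  by (induction A rule: infinite_finite_induct) auto

lemma fun_scale_apply: "fun_scale c f x = c * f x"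
  by (simp add: fun_scale_def)

locale central_rep = G_rep v p pi scale act
  for v :: "'f::field \<Rightarrow> int" and p :: nat and pi :: 'f
    and scale :: "'k::field \<Rightarrow> 'v::ab_group_add \<Rightarrow> 'v" and act :: "'f^2^2 \<Rightarrow> 'v \<Rightarrow> 'v" +
  fixes \<omega> :: "'f \<Rightarrow> 'k"
  assumes \<omega>: "cchar \<omega>"
    and central: "z \<noteq> 0 \<Longrightarrow> act (mat z) y = scale (\<omega> z) y"
begin

text \<open>The full function space under right translation. Left translations commute with this
  action, which lets \<open>tm 1\<close> on the left serve as a variable.\<close>

sublocale fn: G_rep v p pi "fun_scale :: 'k \<Rightarrow> ('f^2^2 \<Rightarrow> 'k) \<Rightarrow> _" ind_act
  by unfold_locales
    (use ac char_p p in \<open>auto simp: fun_scale_def ind_act_def fun_eq_iff algebra_simps matrix_mul_assoc\<close>)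

lemma fn_hecke_U: "fn.hecke_U f g = (\<Sum>l\<in>L. f (g ** (uni l ** tm 1)))"
  by (simp add: fn.hecke_U_def sum_fun_apply ind_act_def)

lemma fn_hecke_S: "fn.hecke_S f g = (\<Sum>l\<in>L. f (g ** (uni l ** swp)))"
  by (simp add: fn.hecke_S_def sum_fun_apply ind_act_def)

lemma card_L_k: "(of_nat (card L) :: 'k) = 0"
  using p_dvd_card_L char_p by (simp add: of_nat_eq_0_iff_char_dvd)

section \<open>Functions on the big cell over the ball O\<close>

definition twist :: "('f \<Rightarrow> 'k) \<Rightarrow> ('f \<Rightarrow> 'k) \<Rightarrow> bool" where
  "twist \<eta> \<theta> \<longleftrightarrow> (\<forall>u x. unit u \<longrightarrow> x \<noteq> 0 \<longrightarrow> \<theta> (u * x) = \<eta> u * \<theta> x)"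

text \<open>A function equivariant under the part of B on which theta transforms, supported on the big cell
  over the ball O of the affine line.\<close>

definition F :: "('f \<Rightarrow> 'k) \<Rightarrow> 'f^2^2 \<Rightarrow> 'k" where
  "F \<theta> g = (if det g \<noteq> 0 \<and> g $ 2 $ 1 \<noteq> 0 \<and> g $ 2 $ 2 / g $ 2 $ 1 \<in> V 0
    then \<omega> (g $ 2 $ 1) * \<theta> (- det g / (g $ 2 $ 1)^2) else 0)"

lemma F_mk: "F \<theta> (mk a b c d) = (if a*d - b*c \<noteq> 0 \<and> c \<noteq> 0 \<and> d / c \<in> V 0
    then \<omega> c * \<theta> (- (a*d - b*c) / c^2) else 0)"
  by (simp add: F_def)

lemma F_notin: "g \<notin> GL2 \<Longrightarrow> F \<theta> g = 0"
  by (simp add: F_def GL2_def)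

text \<open>For c \<noteq> 0 an invertible matrix with bottom row (c, d) is b \<open>swp\<close>
  n(d/c), where b is upper triangular with diagonal (-det/c, c). On its support F is therefore
  \<omega> of the lower diagonal entry of b times \<theta> of the quotient of the two entries,
  whence the argument -det/c^2.\<close>

lemma F_left:
  assumes "\<alpha> \<noteq> 0" "\<delta> \<noteq> 0"
  shows "F \<theta> (mk \<alpha> \<beta> 0 \<delta> ** g) = \<omega> \<delta> * F (\<lambda>x. \<theta> (\<alpha> / \<delta> * x)) g"
proof -
  obtain a b c d where g: "g = mk a b c d" by (rule mk_cases)
  define D where "D = a * d - b * c"
  have det: "(\<alpha> * a + \<beta> * c) * (\<delta> * d) - (\<alpha> * b + \<beta> * d) * (\<delta> * c) = \<alpha> * \<delta> * D"
    by (simp add: D_def algebra_simps)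
  have arg: "- (\<alpha> * \<delta> * D) / (\<delta> * c)^2 = \<alpha> / \<delta> * (- D / c^2)"
    using assms by (simp add: power2_eq_square)
  have gm: "mk \<alpha> \<beta> 0 \<delta> ** g = mk (\<alpha> * a + \<beta> * c) (\<alpha> * b + \<beta> * d) (\<delta> * c) (\<delta> * d)"
    by (simp add: g)
  have "F \<theta> (mk \<alpha> \<beta> 0 \<delta> ** g) = (if D \<noteq> 0 \<and> c \<noteq> 0 \<and> d / c \<in> V 0
      then \<omega> (\<delta> * c) * \<theta> (\<alpha> / \<delta> * (- D / c^2)) else 0)"
    unfolding gm F_mk det arg using assms by simp
  also have "\<dots> = \<omega> \<delta> * F (\<lambda>x. \<theta> (\<alpha> / \<delta> * x)) g"
    unfolding g F_mk D_def[symmetric] using assms by (simp add: cchar_mult[OF \<omega>] del: times_divide_eq_right times_divide_eq_left)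
  finally show ?thesis .
qed

lemma F_tm: "F \<theta> (tm j ** g) = F (\<lambda>x. \<theta> (pi powi j * x)) g"
  using F_left[of "pi powi j" 1 \<theta> 0 g] by (simp add: tm_def cchar_1[OF \<omega>])

lemma F_central:
  assumes "z \<noteq> 0" shows "ind_act (mat z) (F \<theta>) = fun_scale (\<omega> z) (F \<theta>)"
proof
  fix g :: "'f^2^2"
  have "g ** mat z = mk z 0 0 z ** g"
    by (cases g rule: mk_cases) (simp add: mat_mk mult.commute)
  then show "ind_act (mat z) (F \<theta>) g = fun_scale (\<omega> z) (F \<theta>) g"
    using F_left[of z z \<theta> 0 g] assms by (simp add: ind_act_def fun_scale_def)
qed

text \<open>The Iwahori subgroup maps the ball of points d/c in O to itself by fractional linear
  maps. It multiplies c by a unit congruent to \<alpha>, and the argument of \<theta> by a unit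
  congruent to \<delta>/\<alpha>.\<close>

lemma F_Iw:
  assumes \<eta>: "ichar \<eta>" and \<theta>: "twist \<eta> \<theta>"
  shows "fn.Ieig \<omega> \<eta> (F \<theta>)"
  unfolding fn.Ieig_def
proof (intro ballI ext)
  fix i g :: "'f^2^2" assume i: "i \<in> Iw"
  obtain \<alpha> \<beta> \<gamma> \<delta> where ii: "i = mk \<alpha> \<beta> \<gamma> \<delta>" by (rule mk_cases)
  have *: "unit \<alpha>" "unit \<delta>" "\<beta> \<in> V 0" "\<gamma> \<in> V 1" using i by (simp_all add: ii)
  obtain a b c d where g: "g = mk a b c d" by (rule mk_cases)
  define D where "D = a * d - b * c"
  have detI: "unit (\<alpha> * \<delta> - \<beta> * \<gamma>)" using * by (intro unit_diff unit_mult V_mult0)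
  have det: "(a * \<alpha> + b * \<gamma>) * (c * \<beta> + d * \<delta>) - (a * \<beta> + b * \<delta>) * (c * \<alpha> + d * \<gamma>) = D * (\<alpha> * \<delta> - \<beta> * \<gamma>)"
    by (simp add: D_def algebra_simps)
  have goal: "F \<theta> (g ** i) = \<omega> \<alpha> * \<eta> (\<delta> / \<alpha>) * F \<theta> g"
  proof (cases "D \<noteq> 0 \<and> c \<noteq> 0 \<and> d / c \<in> V 0")
    case True
    define x where "x = d / c"
    have d: "d = c * x" using True by (simp add: x_def)
    have x: "x \<in> V 0" using True by (simp add: x_def)
    define e where "e = \<alpha> + x * \<gamma>"
    have ea: "e - \<alpha> \<in> V 1" using x * by (simp add: e_def V_mult0)
    have e: "unit e" by (rule unit_congI[OF *(1) ea])
    have nz: "\<alpha> \<noteq> 0" "e \<noteq> 0" "\<alpha> * \<delta> - \<beta> * \<gamma> \<noteq> 0" using unit_nz[OF *(1)] unit_nz[OF e] unit_nz[OF detI] by simp_all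
    have c': "c * \<alpha> + d * \<gamma> = c * e" by (simp add: e_def d algebra_simps)
    have d': "(c * \<beta> + d * \<delta>) / (c * e) = (\<beta> + x * \<delta>) / e" using True by (simp add: d algebra_simps add_divide_distrib)
    have "\<beta> + x * \<delta> \<in> V 0" using V_add[OF *(3) V_mult0[OF x unit_V0[OF *(2)]]] .
    then have d'': "(c * \<beta> + d * \<delta>) / (c * e) \<in> V 0" using e by (simp add: d' V_div_unit)
    define u where "u = (\<alpha> * \<delta> - \<beta> * \<gamma>) / e^2"
    have u: "unit u" unfolding u_def by (intro unit_divide unit_power detI e)
    have arg: "- (D * (\<alpha> * \<delta> - \<beta> * \<gamma>)) / (c * e)^2 = u * (- D / c^2)"
      by (simp only: u_def power2_eq_square times_divide_times_eq mult_minus_left mult_minus_right mult_ac)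
    have "F \<theta> (g ** i) = \<omega> (c * e) * \<theta> (u * (- D / c^2))"
      unfolding g ii mk_mult F_mk c' det[unfolded c'] arg using True nz d'' by simp
    also have "\<theta> (u * (- D / c^2)) = \<eta> u * \<theta> (- D / c^2)"
      using \<theta> u True unfolding twist_def by (intro \<theta>[unfolded twist_def, rule_format]) auto
    also have "\<omega> (c * e) = \<omega> c * \<omega> \<alpha>"
      using True nz ichar_cong[OF cchar_ichar[OF \<omega>] *(1) ea] by (simp add: cchar_mult[OF \<omega>])
    also have "\<eta> u = \<eta> (\<delta> / \<alpha>)"
    proof (rule ichar_cong[OF \<eta> unit_divide[OF *(2,1)]])
      have "u - \<delta> / \<alpha> = (\<alpha> * (\<alpha> * \<delta> - \<beta> * \<gamma>) - \<delta> * e^2) / (\<alpha> * e^2)"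
        using nz by (simp add: u_def field_simps)
      also have "\<alpha> * (\<alpha> * \<delta> - \<beta> * \<gamma>) - \<delta> * e^2 = \<gamma> * (- \<alpha> * \<beta> - \<delta> * x * (\<alpha> + e))"
        by (simp add: e_def power2_eq_square algebra_simps)
      also have "\<gamma> * (- \<alpha> * \<beta> - \<delta> * x * (\<alpha> + e)) / (\<alpha> * e^2) \<in> V 1"
        unfolding V_div_unit[OF unit_mult[OF *(1) unit_power[OF e]]]
      proof (rule V_mult0'[OF *(4) V_diff])
        show "- \<alpha> * \<beta> \<in> V 0" using V_mult0[OF unit_V0[OF *(1)] *(3)] by simp
        show "\<delta> * x * (\<alpha> + e) \<in> V 0"
          using V_mult0[OF V_mult0[OF unit_V0[OF *(2)] x] V_add[OF unit_V0[OF *(1)] unit_V0[OF e]]] .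
      qed
      finally show "u - \<delta> / \<alpha> \<in> V 1" .
    qed
    finally show ?thesis using True by (simp add: g F_mk D_def[symmetric])
  next
    case False
    have "F \<theta> (g ** i) = 0"
    proof (rule ccontr)
      assume "F \<theta> (g ** i) \<noteq> 0"
      then have h: "D \<noteq> 0" "c * \<alpha> + d * \<gamma> \<noteq> 0" "(c * \<beta> + d * \<delta>) / (c * \<alpha> + d * \<gamma>) \<in> V 0"
        by (auto simp: g ii F_mk det split: if_splits)
      \<comment> \<open>y is the image of the point d/c. Inverting the fractional linear map shows
        that d/c would lie in O too.\<close>
      define y where "y = (c * \<beta> + d * \<delta>) / (c * \<alpha> + d * \<gamma>)"
      have y: "y \<in> V 0" using h by (simp add: y_def)
      have "y * (c * \<alpha> + d * \<gamma>) = c * \<beta> + d * \<delta>" using h by (simp add: y_def)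
      then have eq: "d * (\<delta> - y * \<gamma>) = c * (y * \<alpha> - \<beta>)" by (simp add: algebra_simps)
      have u: "unit (\<delta> - y * \<gamma>)" using * y by (intro unit_diff V_mult0)
      have c: "c \<noteq> 0"
      proof
        assume "c = 0"
        then have "d = 0" using eq unit_nz[OF u] by simp
        then show False using h(2) \<open>c = 0\<close> by simp
      qed
      have "d / c = (y * \<alpha> - \<beta>) / (\<delta> - y * \<gamma>)"
        using eq c unit_nz[OF u] by (simp add: field_simps)
      also have "\<dots> \<in> V 0" unfolding V_div_unit[OF u] using V_diff[OF V_mult0[OF y unit_V0[OF *(1)]] *(3)] .
      finally show False using False c h(1) by simp
    qed
    moreover have "F \<theta> g = 0" using False by (auto simp: g F_mk D_def)
    ultimately show ?thesis by simp
  qed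
  then show "ind_act i (F \<theta>) g = fun_scale (\<omega> (i $ 1 $ 1) * \<eta> (i $ 2 $ 2 / i $ 1 $ 1)) (F \<theta>) g"
    by (simp add: ii ind_act_def fun_scale_def)
qed

lemma sum_L_delta:
  "(\<Sum>l\<in>L. if x + l \<in> V 1 then A else (0 :: 'k)) = (if x \<in> V 0 then A else 0)"
proof (cases "x \<in> V 0")
  case True
  have "x + l \<in> V 1 \<longleftrightarrow> l = rep 1 (- x)" if "l \<in> L" for l
    using rep_L[OF that] rep_eq_iff[of 1 l "- x"] by (auto simp: add.commute)
  then have "(\<Sum>l\<in>L. if x + l \<in> V 1 then A else (0 :: 'k)) = (\<Sum>l\<in>L. if l = rep 1 (- x) then A else 0)"
    by (intro sum.cong) auto
  then show ?thesis using True rep_in_L[of "- x"] by simp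
next
  case False
  have "x + l \<notin> V 1" if "l \<in> L" for l
    using V_diff[OF V1_V0[of "x + l"] L_V0[OF that]] False by auto
  then show ?thesis using False by (simp cong: sum.cong if_cong)
qed

text \<open>The translate by n(l) t lives over the points congruent to -l modulo m. These q balls
  partition O, so at most one summand is nonzero at any point, and U merely rescales the argument of
  \<theta>.\<close>

lemma F_U: "fn.hecke_U (F \<theta>) = fun_scale (\<omega> pi) (F (\<lambda>x. \<theta> (x / pi)))"
proof
  fix g :: "'f^2^2"
  obtain a b c d where g: "g = mk a b c d" by (rule mk_cases)
  define D where "D = a * d - b * c"
  have eq: "F \<theta> (g ** (uni l ** tm 1)) =
    (if d / c + l \<in> V 1 then (if D \<noteq> 0 \<and> c \<noteq> 0 then \<omega> pi * \<omega> c * \<theta> (- D / c^2 / pi) else 0) else 0)" for l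
  proof (cases "D \<noteq> 0 \<and> c \<noteq> 0")
    case True
    have "g ** (uni l ** tm 1) = mk (a * pi) (a * l + b) (c * pi) (c * l + d)"
      by (simp add: g uni_def tm_def)
    moreover have "a * pi * (c * l + d) - (a * l + b) * (c * pi) = pi * D" by (simp add: D_def algebra_simps)
    moreover have "(c * l + d) / (c * pi) = (d / c + l) / pi" using True by (simp add: field_simps)
    moreover have "- (pi * D) / (c * pi)^2 = - D / c^2 / pi" by (simp add: power2_eq_square)
    ultimately show ?thesis
      using True by (simp add: F_mk V_div_pi cchar_mult[OF \<omega>] mult.commute del: minus_diff_eq)
  next
    case False
    then show ?thesis by (auto simp: g uni_def tm_def F_mk D_def algebra_simps)
  qed
  show "fn.hecke_U (F \<theta>) g = fun_scale (\<omega> pi) (F (\<lambda>x. \<theta> (x / pi))) g"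
    unfolding fn_hecke_U eq sum_L_delta fun_scale_apply unfolding g F_mk D_def[symmetric] by simp
qed

text \<open>n(l) \<open>swp\<close> moves the point x to 1/(l + x), which for x in O lies in O
  exactly when l + x is a unit. \<open>rho\<close> at l + x is the factor that the value of F then
  acquires.\<close>

definition rho :: "('f \<Rightarrow> 'k) \<Rightarrow> 'f \<Rightarrow> 'k" where
  "rho \<eta> u = (if unit u then \<omega> u * \<eta> (- 1 / u^2) else 0)"

lemma rho_periodic:
  assumes \<eta>: "ichar \<eta>" and x: "x \<in> V 0" "y \<in> V 0" "x - y \<in> V 1"
  shows "rho \<eta> x = rho \<eta> y"
proof (cases "unit y")
  case True
  then have ux: "unit x" using x(3) unit_congI by blast
  have "- 1 / x^2 - - 1 / y^2 = (x - y) * (x + y) / (x^2 * y^2)"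
    using True ux unit_nz by (simp add: field_simps power2_eq_square)
  also have "\<dots> \<in> V 1"
    unfolding V_div_unit[OF unit_mult[OF unit_power[OF ux] unit_power[OF True]]]
    by (rule V_mult0'[OF x(3) V_add[OF x(1,2)]])
  finally have "\<eta> (- 1 / x^2) = \<eta> (- 1 / y^2)"
    using True by (intro ichar_cong[OF \<eta>] unit_divide unit_power) auto
  moreover have "\<omega> x = \<omega> y" using ichar_cong[OF cchar_ichar[OF \<omega>] True x(3)] .
  ultimately show ?thesis using True ux by (simp add: rho_def)
next
  case False
  then have "\<not> unit x" using unit_congI[of x y] x(3) V_diff_commute by blast
  then show ?thesis using False by (simp add: rho_def)
qed

text \<open>Over a point x of the ball the summands are F g times \<open>rho\<close> at l + x, and
  translation by x permutes the residues. Outside the ball all q summands are equal, and q is 0 in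
  characteristic p, so S creates no new support.\<close>

lemma F_S:
  assumes \<eta>: "ichar \<eta>" and \<theta>: "twist \<eta> \<theta>"
  shows "fn.hecke_S (F \<theta>) = fun_scale (\<Sum>l\<in>L. rho \<eta> l) (F \<theta>)"
proof
  fix g :: "'f^2^2"
  obtain a b c d where g: "g = mk a b c d" by (rule mk_cases)
  define D where "D = a * d - b * c"
  have gl: "g ** (uni l ** swp) = mk (a * l + b) a (c * l + d) c" for l
    by (simp add: g uni_def swp_def)
  have det: "(a * l + b) * c - a * (c * l + d) = - D" for l by (simp add: D_def algebra_simps)
  have Fl: "F \<theta> (g ** (uni l ** swp)) = (if D \<noteq> 0 \<and> c * l + d \<noteq> 0 \<and> c / (c * l + d) \<in> V 0
      then \<omega> (c * l + d) * \<theta> (D / (c * l + d)^2) else 0)" for l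
    unfolding gl F_mk det by simp
  consider "D = 0" | "D \<noteq> 0" "c \<noteq> 0" "d / c \<in> V 0" | "D \<noteq> 0" "d \<noteq> 0" "c / d \<in> V 1" "c = 0 \<or> d / c \<notin> V 0"
  proof -
    have "d \<noteq> 0 \<and> c / d \<in> V 1" if "D \<noteq> 0" "c = 0 \<or> d / c \<notin> V 0"
    proof (cases "c = 0")
      case True then show ?thesis using that by (auto simp: D_def)
    next
      case False
      then have "d \<noteq> 0" "d / c \<notin> V 0" using that by auto
      then show ?thesis using False by (auto simp: V_iff v_divide)
    qed
    then show ?thesis using that by blast
  qed
  then show "fn.hecke_S (F \<theta>) g = fun_scale (\<Sum>l\<in>L. rho \<eta> l) (F \<theta>) g"
  proof cases
    case 1
    then show ?thesis unfolding fn_hecke_S Fl fun_scale_apply by (simp add: g F_mk flip: D_def)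
  next
    case 2
    define x where "x = d / c"
    have d: "d = c * x" using 2 by (simp add: x_def)
    have x: "x \<in> V 0" using 2 by (simp add: x_def)
    have "F \<theta> (g ** (uni l ** swp)) = F \<theta> g * rho \<eta> (1 * l + x)" if l: "l \<in> L" for l
    proof -
      define y where "y = l + x"
      have y: "y \<in> V 0" using L_V0[OF l] x by (auto simp: y_def intro: V_add)
      have cy: "c * l + d = c * y" by (simp add: d y_def algebra_simps)
      have iff: "c * y \<noteq> 0 \<and> c / (c * y) \<in> V 0 \<longleftrightarrow> unit y"
      proof (cases "y = 0")
        case False
        then show ?thesis using y 2 by (auto simp: unit_def V_iff v_divide v_mult)
      qed (simp add: unit_def)
      show ?thesis
      proof (cases "unit y")
        case True
        have nz: "- D / c^2 \<noteq> 0" using 2 by simp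
        have arg: "D / (c * y)^2 = (- 1 / y^2) * (- D / c^2)" by (simp add: power2_eq_square)
        have "\<theta> (D / (c * y)^2) = \<eta> (- 1 / y^2) * \<theta> (- D / c^2)"
          unfolding arg using \<theta> True nz unfolding twist_def by (metis unit_divide unit_minus unit_1 unit_power)
        moreover have "F \<theta> g = \<omega> c * \<theta> (- D / c^2)" using 2 by (simp add: g F_mk flip: D_def)
        ultimately show ?thesis
          using True 2 iff unit_nz[OF True] unfolding Fl cy
          by (simp add: rho_def cchar_mult[OF \<omega>] y_def[symmetric])
      next
        case False
        then show ?thesis using iff unfolding Fl cy by (auto simp: rho_def y_def[symmetric])
      qed
    qed
    then have "fn.hecke_S (F \<theta>) g = F \<theta> g * (\<Sum>l\<in>L. rho \<eta> (1 * l + x))"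
      unfolding fn_hecke_S sum_distrib_left by (intro sum.cong) auto
    also have "(\<Sum>l\<in>L. rho \<eta> (1 * l + x)) = (\<Sum>l\<in>L. rho \<eta> l)"
      using x by (intro sum_L_affine rho_periodic[OF \<eta>]) auto
    finally show ?thesis by (simp add: fun_scale_apply)
  next
    case 3
    have "F \<theta> (g ** (uni l ** swp)) = \<omega> d * \<theta> (D / d^2)" if l: "l \<in> L" for l
    proof -
      define e where "e = 1 + c / d * l"
      have e1: "e - 1 \<in> V 1" using V_mult0'[OF 3(3) L_V0[OF l]] by (simp add: e_def)
      have e: "unit e" using e1 by (rule unit_of_one)
      have eq: "c * l + d = d * e" using 3 by (simp add: e_def algebra_simps)
      have u: "unit (1 / e^2)" using e by (intro unit_divide unit_power) auto
      have nz: "d * e \<noteq> 0" using 3 unit_nz[OF e] by simp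
      have mem: "c / (d * e) \<in> V 0"
        using V1_V0[OF 3(3)] unfolding divide_divide_eq_left[symmetric] V_div_unit[OF e] .
      have arg: "D / (d * e)^2 = 1 / e^2 * (D / d^2)" by (simp add: power2_eq_square)
      have "1 / e^2 - 1 = (1 - e) * (1 + e) / e^2" using unit_nz[OF e] by (simp add: field_simps power2_eq_square)
      also have "\<dots> \<in> V 1" unfolding V_div_unit[OF unit_power[OF e]]
        using e1 by (intro V_mult0' V_add V_1 unit_V0[OF e]) (simp add: V_diff_commute)
      finally have "\<eta> (1 / e^2) = 1" using \<eta> by (simp add: ichar_def)
      moreover have "\<theta> (1 / e^2 * (D / d^2)) = \<eta> (1 / e^2) * \<theta> (D / d^2)"
        using 3 u \<theta>[unfolded twist_def, rule_format, OF u, of "D / d^2"] by simp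
      moreover have "\<omega> (d * e) = \<omega> d"
        using 3 e1 unit_nz[OF e] \<omega> by (simp add: cchar_def)
      ultimately show ?thesis unfolding Fl eq arg using nz mem 3 by simp
    qed
    then have "fn.hecke_S (F \<theta>) g = (\<Sum>l\<in>L. \<omega> d * \<theta> (D / d^2))"
      unfolding fn_hecke_S by (intro sum.cong) auto
    then show ?thesis using 3 card_L_k by (auto simp: fun_scale_apply g F_mk)
  qed
qed

section \<open>The generator f0 and its specializations\<close>

definition theta0 :: "('f \<Rightarrow> 'k) \<Rightarrow> 'f \<Rightarrow> 'k" where
  "theta0 \<eta> x = (if v x = 0 then \<eta> x else 0)"

text \<open>The quasi-character that extends \<eta> with value \<mu> at pi. The dilates of
  \<open>theta0\<close> by powers of pi have disjoint supports instead, and they add up to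
  \<open>thetam\<close> with \<mu> = 1 on nonzero elements.\<close>

definition thetam :: "('f \<Rightarrow> 'k) \<Rightarrow> 'k \<Rightarrow> 'f \<Rightarrow> 'k" where
  "thetam \<eta> \<mu> x = \<eta> (x / pi powi (v x)) * \<mu> powi (v x)"

abbreviation f0 :: "('f \<Rightarrow> 'k) \<Rightarrow> 'f^2^2 \<Rightarrow> 'k" where "f0 \<eta> \<equiv> F (theta0 \<eta>)"
abbreviation fm :: "('f \<Rightarrow> 'k) \<Rightarrow> 'k \<Rightarrow> 'f^2^2 \<Rightarrow> 'k" where "fm \<eta> \<mu> \<equiv> F (thetam \<eta> \<mu>)"

lemma twist_theta0: "ichar \<eta> \<Longrightarrow> twist \<eta> (theta0 \<eta>)"
  by (auto simp: twist_def theta0_def unit_def v_mult ichar_def)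

lemma thetam_mult:
  assumes \<eta>: "ichar \<eta>" and "\<mu> \<noteq> 0" "x \<noteq> 0" "y \<noteq> 0"
  shows "thetam \<eta> \<mu> (x * y) = thetam \<eta> \<mu> x * thetam \<eta> \<mu> y"
proof -
  have "x * y / pi powi (v x + v y) = (x / pi powi v x) * (y / pi powi v y)"
    by (simp add: power_int_add)
  then have "\<eta> (x * y / pi powi (v x + v y)) = \<eta> (x / pi powi v x) * \<eta> (y / pi powi v y)"
    using ichar_mult[OF \<eta> unit_decomp[OF assms(3)] unit_decomp[OF assms(4)]] by (simp add: power_int_add)
  then show ?thesis using assms by (simp add: thetam_def v_mult power_int_add)
qed

lemma thetam_unit: "unit u \<Longrightarrow> thetam \<eta> \<mu> u = \<eta> u"
  by (simp add: thetam_def unit_def)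

lemma thetam_pi: "ichar \<eta> \<Longrightarrow> thetam \<eta> \<mu> pi = \<mu>"
  by (simp add: thetam_def ichar_1)

lemma twist_thetam: "ichar \<eta> \<Longrightarrow> \<mu> \<noteq> 0 \<Longrightarrow> twist \<eta> (thetam \<eta> \<mu>)"
  by (auto simp: twist_def thetam_mult thetam_unit unit_nz)

lemma fm_U:
  assumes "ichar \<eta>" "\<mu> \<noteq> 0"
  shows "fn.hecke_U (fm \<eta> \<mu>) = fun_scale (\<omega> pi / \<mu>) (fm \<eta> \<mu>)"
proof -
  have *: "thetam \<eta> \<mu> (x / pi) = thetam \<eta> \<mu> x / \<mu>" if "x \<noteq> 0" for x
    using thetam_mult[OF assms, of "x / pi" pi] that by (simp add: thetam_pi assms)
  have "F (\<lambda>x. thetam \<eta> \<mu> (x / pi)) g = fm \<eta> \<mu> g / \<mu>" for g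
    using *[of "- det g / (g $ 2 $ 1)^2"] by (simp add: F_def)
  then show ?thesis by (auto simp: F_U fun_scale_def)
qed

text \<open>Dilating \<theta> by a power of pi is a left translation, so on \<open>f0\<close> the
  operator U agrees up to a scalar with a map that commutes with G.\<close>

lemma f0_U: "fn.hecke_U (f0 \<eta>) = (\<lambda>g. \<omega> pi * f0 \<eta> (tm (- 1) ** g))"
proof -
  have "(\<lambda>x. theta0 \<eta> (pi powi - 1 * x)) = (\<lambda>x. theta0 \<eta> (x / pi))"
    by (simp add: divide_inverse mult.commute)
  then show ?thesis by (simp only: F_U F_tm fun_scale_def)
qed

end

section \<open>The compact induction inside the universal principal series\<close>

context vector_space
begin

lemma span_image_finite:
  assumes "finite A" "x \<in> span (f ` A)"
  shows "\<exists>c. x = (\<Sum>a\<in>A. scale (c a) (f a))"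
  using assms
proof (induction A arbitrary: x rule: finite_induct)
  case (insert a A)
  then obtain k where "x - scale k (f a) \<in> span (f ` A)" by (auto simp: span_breakdown_eq)
  then obtain c where c: "x - scale k (f a) = (\<Sum>a\<in>A. scale (c a) (f a))" using insert.IH by blast
  have "(\<Sum>b\<in>A. scale (if b = a then k else c b) (f b)) = (\<Sum>b\<in>A. scale (c b) (f b))"
    using insert.hyps by (intro sum.cong) auto
  then have "x = (\<Sum>b\<in>insert a A. scale (if b = a then k else c b) (f b))"
    using insert.hyps c by (simp add: algebra_simps)
  then show ?case by (rule exI[of _ "\<lambda>b. if b = a then k else c b"])
qed simp

lemma span_insert_image_finite:
  assumes "finite A" "x \<in> span (insert y (f ` A))"
  shows "\<exists>k c. x = scale k y + (\<Sum>a\<in>A. scale (c a) (f a))"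
proof -
  obtain k where "x - scale k y \<in> span (f ` A)" using assms(2) by (auto simp: span_breakdown_eq)
  then obtain c where "x - scale k y = (\<Sum>a\<in>A. scale (c a) (f a))" using span_image_finite[OF assms(1)] by blast
  then have "x = scale k y + (\<Sum>a\<in>A. scale (c a) (f a))" by (simp add: algebra_simps)
  then show ?thesis by (intro exI)
qed

end

context G_rep
begin

lemma span_orbit_stable:
  assumes "H \<subseteq> GL2" "\<And>g h. g \<in> H \<Longrightarrow> h \<in> H \<Longrightarrow> g ** h \<in> H"
  shows "stable H (span ((\<lambda>g. act g y) ` H))"
  unfolding stable_def
proof (intro conjI ballI)
  fix h x assume h: "h \<in> H" and x: "x \<in> span ((\<lambda>g. act g y) ` H)"
  from x show "act h x \<in> span ((\<lambda>g. act g y) ` H)"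
  proof (induction rule: span_induct_alt)
    case base
    then show ?case using h assms(1) by (auto simp: span_zero subset_iff)
  next
    case (step c x z)
    then obtain g where "g \<in> H" "x = act g y" by blast
    then have "act h x \<in> (\<lambda>g. act g y) ` H"
      using h assms by (auto simp: subset_iff intro!: image_eqI[of _ _ "h ** g"] simp flip: act_mult)
    then have "act h x \<in> span ((\<lambda>g. act g y) ` H)" by (rule span_base)
    moreover have "h \<in> GL2" using h assms(1) by blast
    ultimately show ?case using step by (simp add: act_add act_scale span_add span_scale)
  qed
qed (rule subspace_span)

lemma span_orbit_stable_GL2: "stable GL2 (span ((\<lambda>g. act g y) ` GL2))"
  by (rule span_orbit_stable) auto

lemma span_orbit_stable_KK: "stable KK (span ((\<lambda>g. act g y) ` KK))"
  by (rule span_orbit_stable) (auto intro: KK_GL2 KK_mult)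

section \<open>Cosets of the Iwahori subgroup in GL2(O) and vertices of the tree\<close>

lemma uni_swp_KK: "l \<in> V 0 \<Longrightarrow> uni l ** swp \<in> KK"
  by (simp add: uni_def swp_def)

text \<open>Bruhat decomposition over the residue field: GL2(O) is the union of the Iwahori subgroup
  I and the q cosets n(l) \<open>swp\<close> I, where l is the class of a/c.\<close>

lemma KK_span:
  assumes y: "Ieig \<omega> \<eta> y" and k: "k \<in> KK"
  shows "act k y \<in> span (insert y ((\<lambda>l. act (uni l ** swp) y) ` L))"
proof -
  obtain a b c d where kk: "k = mk a b c d" by (rule mk_cases)
  have *: "a \<in> V 0" "b \<in> V 0" "c \<in> V 0" "d \<in> V 0" and det: "unit (a * d - b * c)"
    using k by (simp_all add: kk)
  show ?thesis
  proof (cases "c \<in> V 1")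
    case True
    have "unit (a * d)" using unit_add[OF det V_mult0[OF *(2) True]] by simp
    then have nz: "a \<noteq> 0" "d \<noteq> 0" and "v a + v d = 0" by (auto simp: unit_def v_mult)
    moreover have "v a \<ge> 0" "v d \<ge> 0" using * nz by (simp_all add: V_iff)
    ultimately have "unit a" "unit d" by (auto simp: unit_def)
    then have "act k y = scale (\<omega> a * \<eta> (d / a)) y"
      using IeigD[OF y, of a b c d] True * by (simp add: kk)
    then show ?thesis by (simp add: span_scale span_base)
  next
    case False
    then have c: "unit c" using *(3) by (simp add: unit_iff)
    define l where "l = rep 1 (a / c)"
    have l: "l \<in> L" unfolding l_def using * c by (intro rep_in_L) (simp add: V_div_unit)
    have lV: "l \<in> V 0" using l by (rule L_V0)
    have "c * (l - a / c) \<in> V 1" unfolding l_def by (rule V_mult0[OF *(3) rep_diff])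
    also have "c * (l - a / c) = l * c - a" using unit_nz[OF c] by (simp add: algebra_simps)
    finally have ac: "a - l * c \<in> V 1" using V_diff_commute by blast
    define j where "j = mk c d (a - l * c) (b - l * d)"
    have "c * (b - l * d) = - (a * d - b * c) + d * (a - l * c)" by (simp add: algebra_simps)
    moreover have "unit (- (a * d - b * c) + d * (a - l * c))"
      by (rule unit_add[OF _ V_mult0[OF *(4) ac]]) (use det in \<open>simp only: unit_minus\<close>)
    ultimately have "unit (c * (b - l * d))" by simp
    then have "unit (c * (b - l * d) / c)" using c by (rule unit_divide)
    then have "unit (b - l * d)" using unit_nz[OF c] by simp
    then have j: "j \<in> Iw" using c * ac by (simp add: j_def)
    have "k = uni l ** swp ** j" by (simp add: kk j_def uni_def swp_def algebra_simps)
    then have "act k y = act (uni l ** swp) (act j y)" using Iw_GL2[OF j] by (simp add: act_mult)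
    also have "act j y = scale (\<omega> c * \<eta> ((b - l * d) / c)) y"
      using IeigD[OF y] j by (simp add: j_def)
    finally have "act k y = scale (\<omega> c * \<eta> ((b - l * d) / c)) (act (uni l ** swp) y)"
      by (simp add: act_scale)
    moreover have "act (uni l ** swp) y \<in> span (insert y ((\<lambda>l. act (uni l ** swp) y) ` L))"
      using l by (intro span_base) blast
    ultimately show ?thesis by (simp only: span_scale)
  qed
qed

text \<open>Iwasawa decomposition. A pair (a, n) with a normalized modulo pi^n names a coset of the
  centre times GL2(O), that is, a vertex of the tree.\<close>

lemma GL2_vertex:
  assumes "g \<in> GL2"
  obtains z a n k where "z \<noteq> 0" "rep n a = a" "k \<in> KK" "g = mat z ** (uni a ** tm n) ** k"
proof -
  have "\<exists>b\<in>Borel. \<exists>k\<in>KK. g = b ** k"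
    using GL2_decomp[OF assms]
  proof (elim disjE bexE)
    fix b x assume "b \<in> Borel" "x \<in> V 1" "g = b ** low x"
    then show ?thesis using Iw_KK[OF low_Iw[of x]] by blast
  next
    fix b x assume "b \<in> Borel" "x \<in> V 0" "g = b ** swp ** uni x"
    moreover have "swp ** uni x \<in> KK" using \<open>x \<in> V 0\<close> by (simp add: swp_def uni_def)
    ultimately show ?thesis by (metis matrix_mul_assoc)
  qed
  then obtain b k where b: "b \<in> Borel" "k \<in> KK" "g = b ** k" by blast
  obtain z a n u where z: "z \<noteq> 0" "unit u" "b = mat z ** uni a ** tm n ** mk u 0 0 1"
    using Borel_decomp[OF b(1)] .
  define a0 where "a0 = rep n a"
  have x: "(a - a0) / pi powi n \<in> V 0"
    using rep_diff[of n a] by (simp add: V_div_powi a0_def V_diff_commute)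
  have "uni a ** tm n = uni a0 ** tm n ** uni ((a - a0) / pi powi n)"
    by (simp add: uni_def tm_def)
  then have "g = mat z ** (uni a0 ** tm n) ** (uni ((a - a0) / pi powi n) ** mk u 0 0 1 ** k)"
    by (simp add: b(3) z(3) matrix_mul_assoc) (simp add: matrix_mul_assoc[symmetric])
  moreover have "uni ((a - a0) / pi powi n) ** mk u 0 0 1 ** k \<in> KK"
    using x z(2) unit_V0 by (intro KK_mult b(2)) (auto simp: uni_def)
  ultimately show ?thesis using that z(1) by (metis a0_def rep_rep)
qed

end

locale edge_rep = central_rep v p pi scale act \<omega>
  for v :: "'f::field \<Rightarrow> int" and p :: nat and pi :: 'f
    and scale :: "'k::field \<Rightarrow> 'v::ab_group_add \<Rightarrow> 'v" and act :: "'f^2^2 \<Rightarrow> 'v \<Rightarrow> 'v"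
    and \<omega> :: "'f \<Rightarrow> 'k" +
  fixes \<eta> :: "'f \<Rightarrow> 'k" and y :: 'v
  assumes \<eta>: "ichar \<eta>" and y: "Ieig \<omega> \<eta> y"
begin

text \<open>Left equivariance is imposed only under unipotent, central and integral diagonal
  matrices. The remaining direction of the torus is that of \<open>tm 1\<close>, along which the
  support is finite. This models the principal series with Laurent polynomial coefficients.\<close>

definition Univ :: "('f^2^2 \<Rightarrow> 'k) set" where
  "Univ = {f. (\<forall>\<alpha> \<beta> \<delta> g. \<delta> \<noteq> 0 \<longrightarrow> unit (\<alpha> / \<delta>) \<longrightarrow> f (mk \<alpha> \<beta> 0 \<delta> ** g) = \<omega> \<delta> * \<eta> (\<alpha> / \<delta>) * f g)
    \<and> (\<forall>g. \<exists>N. \<forall>m. N < \<bar>m\<bar> \<longrightarrow> f (tm m ** g) = 0) \<and> (\<forall>g. g \<notin> GL2 \<longrightarrow> f g = 0)}"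

lemma UnivD:
  assumes "f \<in> Univ"
  shows "\<delta> \<noteq> 0 \<Longrightarrow> unit (\<alpha> / \<delta>) \<Longrightarrow> f (mk \<alpha> \<beta> 0 \<delta> ** g) = \<omega> \<delta> * \<eta> (\<alpha> / \<delta>) * f g"
    and "\<exists>N. \<forall>m. N < \<bar>m\<bar> \<longrightarrow> f (tm m ** g) = 0" and "g \<notin> GL2 \<Longrightarrow> f g = 0"
  using assms unfolding Univ_def by blast+

lemma Univ_stable: "fn.stable GL2 Univ"
  unfolding fn.stable_def fn.subspace_def
proof (intro conjI ballI allI)
  show "0 \<in> Univ" by (simp add: Univ_def)
  fix f assume f: "f \<in> Univ"
  show "fun_scale c f \<in> Univ" for c
    unfolding Univ_def
  proof (intro CollectI conjI allI impI)
    show "\<exists>N. \<forall>m. N < \<bar>m\<bar> \<longrightarrow> fun_scale c f (tm m ** g) = 0" for g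
      using UnivD(2)[OF f, of g] by (auto simp: fun_scale_def)
  qed (use UnivD(1,3)[OF f] in \<open>auto simp: fun_scale_def\<close>)
  show "ind_act g f \<in> Univ" if "g \<in> GL2" for g
    unfolding Univ_def
  proof (intro CollectI conjI allI impI)
    show "\<exists>N. \<forall>m. N < \<bar>m\<bar> \<longrightarrow> ind_act g f (tm m ** g') = 0" for g'
      using UnivD(2)[OF f, of "g' ** g"] by (simp add: ind_act_def matrix_mul_assoc)
  qed (use UnivD(1,3)[OF f] that in \<open>auto simp: ind_act_def simp flip: matrix_mul_assoc\<close>)
  fix f' assume f': "f' \<in> Univ"
  have "\<exists>N. \<forall>m. N < \<bar>m\<bar> \<longrightarrow> (f + f') (tm m ** g) = 0" for g
  proof -
    obtain N N' where "\<forall>m. N < \<bar>m\<bar> \<longrightarrow> f (tm m ** g) = 0" "\<forall>m. N' < \<bar>m\<bar> \<longrightarrow> f' (tm m ** g) = 0"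
      using UnivD(2)[OF f] UnivD(2)[OF f'] by meson
    then show ?thesis by (intro exI[of _ "max N N'"]) auto
  qed
  then show "f + f' \<in> Univ" using f f' unfolding Univ_def by (simp add: distrib_left)
qed

lemma F_unit:
  assumes "twist \<eta> \<theta>" "unit u"
  shows "F (\<lambda>x. \<theta> (u * x)) g = \<eta> u * F \<theta> g"
  using assms(1)[unfolded twist_def, rule_format, OF assms(2), of "- det g / (g $ 2 $ 1)^2"]
  by (simp add: F_def)

lemma f0_Univ: "f0 \<eta> \<in> Univ"
  unfolding Univ_def
proof (intro CollectI conjI allI impI)
  fix \<alpha> \<beta> \<delta> :: 'f and g assume *: "\<delta> \<noteq> 0" "unit (\<alpha> / \<delta>)"
  then have "\<alpha> \<noteq> 0" by (auto simp: unit_def)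
  then show "f0 \<eta> (mk \<alpha> \<beta> 0 \<delta> ** g) = \<omega> \<delta> * \<eta> (\<alpha> / \<delta>) * f0 \<eta> g"
    using F_left[of \<alpha> \<delta> "theta0 \<eta>" \<beta> g] F_unit[OF twist_theta0[OF \<eta>] *(2), of g] * by simp
next
  fix g :: "'f^2^2"
  show "\<exists>N. \<forall>m. N < \<bar>m\<bar> \<longrightarrow> f0 \<eta> (tm m ** g) = 0"
    unfolding F_tm
    by (intro exI[of _ "\<bar>v (- det g / (g $ 2 $ 1)^2)\<bar>"])
      (auto simp: F_def theta0_def v_mult simp del: times_divide_eq_right)
qed (rule F_notin)

section \<open>Invariants in the universal principal series\<close>

definition Inv :: "('f^2^2 \<Rightarrow> 'k) set" where
  "Inv = {f \<in> Univ. (\<forall>g. \<forall>b\<in>V 0. f (g ** uni b) = f g) \<and> (\<forall>g. \<forall>c\<in>V 1. f (g ** low c) = f g)}"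

lemma Inv_subspace: "fn.subspace Inv"
  using fn.stableD(1)[OF Univ_stable] by (auto simp: fn.subspace_def Inv_def fun_scale_def)

lemma Ieig_Inv:
  assumes "f \<in> Univ" "ichar \<eta>'" "fn.Ieig \<omega> \<eta>' f"
  shows "f \<in> Inv"
  using fn.Ieig_uni[OF \<omega> assms(2,3)] fn.Ieig_low[OF \<omega> assms(2,3)] assms(1)
  by (auto simp: Inv_def ind_act_def fun_eq_iff)

lemma InvD:
  assumes "f \<in> Inv"
  shows "f \<in> Univ" "b \<in> V 0 \<Longrightarrow> f (g ** uni b) = f g" "c \<in> V 1 \<Longrightarrow> f (g ** low c) = f g"
  using assms by (auto simp: Inv_def)

lemma Univ_Borel:
  assumes f: "f \<in> Univ" and b: "b \<in> Borel"
  obtains c n where "\<And>g. f (b ** g) = c * f (tm n ** g)" "c \<noteq> 0"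
proof -
  obtain x z w where bb: "b = mk x z 0 w" "x \<noteq> 0" "w \<noteq> 0" using Borel_cases[OF b] .
  define n where "n = v (x / w)"
  have u: "unit (x / w / pi powi n)" unfolding n_def using bb by (intro unit_decomp) simp
  have "b = mk (x / pi powi n) z 0 w ** tm n" using bb by (simp add: tm_def)
  moreover have "unit (x / pi powi n / w)" using u by (simp add: mult.commute)
  ultimately have "f (b ** g) = \<omega> w * \<eta> (x / pi powi n / w) * f (tm n ** g)" for g
    using UnivD(1)[OF f bb(3)] by (metis matrix_mul_assoc)
  moreover have "\<omega> w * \<eta> (x / pi powi n / w) \<noteq> 0"
    using bb \<open>unit (x / pi powi n / w)\<close> cchar_nz[OF \<omega>] ichar_nz[OF \<eta>] by simp
  ultimately show ?thesis by (rule that)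
qed

text \<open>B and the Iwahori subgroup have two double cosets, represented by 1 and
  \<open>swp\<close>. By the equivariance of \<open>Univ\<close> only a power of \<open>tm 1\<close>
  remains of the factor in B.\<close>

lemma Inv_eq_0:
  assumes f: "f \<in> Inv" and A: "\<And>m. f (tm m ** swp) = 0" and B: "\<And>m. f (tm m) = 0"
  shows "f = 0"
proof
  fix g :: "'f^2^2"
  show "f g = 0 g"
  proof (cases "g \<in> GL2")
    case True
    then show ?thesis
      using GL2_decomp[OF True]
    proof (elim disjE bexE)
      fix b x assume *: "b \<in> Borel" "x \<in> V 1" "g = b ** low x"
      obtain c n where "\<And>g. f (b ** g) = c * f (tm n ** g)" using Univ_Borel[OF InvD(1)[OF f] *(1)] by blast
      from this[of "mat 1"] show ?thesis using * InvD(3)[OF f *(2)] B by simp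
    next
      fix b x assume *: "b \<in> Borel" "x \<in> V 0" "g = b ** swp ** uni x"
      obtain c n where "\<And>g. f (b ** g) = c * f (tm n ** g)" using Univ_Borel[OF InvD(1)[OF f] *(1)] by blast
      from this[of swp] show ?thesis using * InvD(2)[OF f *(2)] A by simp
    qed
  qed (use UnivD(3)[OF InvD(1)[OF f]] in simp)
qed

text \<open>n(l) can be moved to the left of \<open>tm m\<close>, where f ignores it; the q equal
  values add up to 0.\<close>

lemma U_at_tm:
  assumes f: "f \<in> Univ"
  shows "fn.hecke_U f (tm m) = 0"
proof -
  have "f (tm m ** (uni l ** tm 1)) = f (tm (m + 1))" for l
  proof -
    have "tm m ** (uni l ** tm 1) = mk 1 (pi powi m * l) 0 1 ** tm (m + 1)"
      by (simp add: tm_def uni_def power_int_add)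
    then show ?thesis using UnivD(1)[OF f, of 1 1] by (simp add: cchar_1[OF \<omega>] ichar_1[OF \<eta>])
  qed
  then show ?thesis by (simp add: fn_hecke_U card_L_k)
qed

lemma at_tm_Pi:
  assumes f: "f \<in> Univ" shows "f (tm m ** Pi) = \<omega> pi * f (tm (m - 1) ** swp)"
proof -
  have "tm m ** Pi = mk pi 0 0 pi ** (tm (m - 1) ** swp)"
    by (simp add: tm_def Pi_def swp_def power_int_diff)
  then show ?thesis using UnivD(1)[OF f, of pi pi] by (simp add: ichar_1[OF \<eta>])
qed

text \<open>The summand l = 0 is a shift up to the centre. For l a unit a lower unipotent factor,
  which f ignores on the right, leads into the double coset of 1, as in
  \<open>swp_U\<close>.\<close>

lemma U_at_swp:
  assumes f: "f \<in> Inv"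
  shows "fn.hecke_U f (tm m ** swp) = \<omega> pi * f (tm (m - 1) ** swp) + (\<Sum>l\<in>L - {0}. \<omega> l * \<eta> (- 1 / l^2)) * f (tm (m + 1))"
proof -
  have "fn.hecke_U f (tm m ** swp) = f (tm m ** swp ** (uni 0 ** tm 1)) + (\<Sum>l\<in>L - {0}. f (tm m ** swp ** (uni l ** tm 1)))"
    unfolding fn_hecke_U by (rule sum.remove) auto
  also have "tm m ** swp ** (uni 0 ** tm 1) = tm m ** Pi"
    by (simp add: tm_def Pi_def swp_def uni_def)
  also have "(\<Sum>l\<in>L - {0}. f (tm m ** swp ** (uni l ** tm 1))) = (\<Sum>l\<in>L - {0}. \<omega> l * \<eta> (- 1 / l^2) * f (tm (m + 1)))"
  proof (rule sum.cong[OF refl])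
    fix l assume "l \<in> L - {0}"
    then have l: "l \<noteq> 0" "unit l" by (auto simp: L_unit)
    have "tm m ** swp ** (uni l ** tm 1) = mk (- 1 / l) (pi powi m) 0 l ** tm (m + 1) ** low (pi / l)"
      using l by (simp add: swp_def uni_def tm_def low_def power_int_add)
    moreover have "unit (- 1 / l / l)" using l by (intro unit_divide) auto
    ultimately have "f (tm m ** swp ** (uni l ** tm 1)) = \<omega> l * \<eta> (- 1 / l / l) * f (tm (m + 1))"
      using InvD(3)[OF f, of "pi / l"] UnivD(1)[OF InvD(1)[OF f], of l "- 1 / l"] l by (simp add: V_div_unit)
    then show "f (tm m ** swp ** (uni l ** tm 1)) = \<omega> l * \<eta> (- 1 / l^2) * f (tm (m + 1))"
      by (simp add: power2_eq_square)
  qed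
  finally show ?thesis by (simp add: at_tm_Pi[OF InvD(1)[OF f]] sum_distrib_right)
qed

text \<open>When the values at \<open>tm m\<close> vanish, the second term of
  \<open>U_at_swp\<close> drops out and U is a pure shift.\<close>

lemma U_power_at:
  assumes h: "h \<in> Univ" "ichar \<eta>'" "fn.Ieig \<omega> \<eta>' h" and B: "\<And>m. h (tm m) = 0"
  shows "(fn.hecke_U ^^ n) h \<in> Inv \<and> (\<forall>m. (fn.hecke_U ^^ n) h (tm m) = 0)
    \<and> (\<forall>m. (fn.hecke_U ^^ n) h (tm m ** swp) = \<omega> pi ^ n * h (tm (m - int n) ** swp))"
proof -
  have *: "(fn.hecke_U ^^ n) h \<in> Univ \<and> fn.Ieig \<omega> \<eta>' ((fn.hecke_U ^^ n) h)" for n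
    by (induction n)
      (use h fn.hecke_U_mem[OF fn.stable_mono[OF Univ_stable]] fn.Ieig_U[OF \<omega>] in \<open>auto simp: Borel_GL2 subset_iff\<close>)
  have inv: "(fn.hecke_U ^^ n) h \<in> Inv" for n using * Ieig_Inv[OF _ h(2)] by blast
  have "(\<forall>m. (fn.hecke_U ^^ n) h (tm m) = 0)
    \<and> (\<forall>m. (fn.hecke_U ^^ n) h (tm m ** swp) = \<omega> pi ^ n * h (tm (m - int n) ** swp))"
  proof (induction n)
    case (Suc n)
    show ?case
    proof (intro conjI allI)
      fix m
      show "(fn.hecke_U ^^ Suc n) h (tm m) = 0" using * by (simp add: U_at_tm)
      have "(fn.hecke_U ^^ Suc n) h (tm m ** swp) = \<omega> pi * (fn.hecke_U ^^ n) h (tm (m - 1) ** swp)"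
        using U_at_swp[OF inv] Suc by simp
      also have "\<dots> = \<omega> pi * (\<omega> pi ^ n * h (tm (m - 1 - int n) ** swp))" using Suc by simp
      also have "m - 1 - int n = m - int (Suc n)" by simp
      finally show "(fn.hecke_U ^^ Suc n) h (tm m ** swp) = \<omega> pi ^ Suc n * h (tm (m - int (Suc n)) ** swp)"
        by (simp only: power_Suc mult.assoc)
    qed
  qed (use B in simp)
  then show ?thesis using inv by blast
qed

text \<open>If U annihilates both f and its Pi-translate, the values of f on the two Iwahori orbits
  satisfy a recursion that contradicts their finite support.\<close>

lemma exists_U_nonzero:
  assumes f: "f \<in> Univ" "ichar \<eta>'" "fn.Ieig \<omega> \<eta>' f" and nz: "f \<noteq> 0"
  shows "fn.hecke_U f \<noteq> 0 \<or> fn.hecke_U (ind_act Pi f) \<noteq> 0"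
proof (rule ccontr)
  assume "\<not> ?thesis"
  then have Z: "fn.hecke_U f = 0" "fn.hecke_U (ind_act Pi f) = 0" by auto
  define c where "c = (\<Sum>l\<in>L - {0}. \<omega> l * \<eta> (- 1 / l^2))"
  have inv: "f \<in> Inv" using Ieig_Inv f by blast
  have "ind_act Pi f \<in> Univ" using f(1) fn.stableD(2)[OF Univ_stable] by auto
  then have inv': "ind_act Pi f \<in> Inv" using Ieig_Inv fn.Ieig_Pi[OF \<omega> f(2,3)] by blast
  have om: "\<omega> pi \<noteq> 0" by (simp add: cchar_nz[OF \<omega>])
  have A: "\<omega> pi * f (tm (m - 1) ** swp) + c * f (tm (m + 1)) = 0" for m
    using U_at_swp[OF inv, of m] Z(1) by (simp add: c_def)
  have "\<omega> pi * f (tm (m - 1) ** swp ** Pi) + c * f (tm (m + 1) ** Pi) = 0" for m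
    using U_at_swp[OF inv', of m] Z(2) by (simp add: c_def ind_act_def)
  moreover have "f (tm (m - 1) ** swp ** Pi) = f (tm m)" for m
    by (simp add: tm_add swp_Pi flip: matrix_mul_assoc)
  moreover have "f (tm (m + 1) ** Pi) = \<omega> pi * f (tm m ** swp)" for m
    using at_tm_Pi[OF f(1), of "m + 1"] by simp
  ultimately have "\<omega> pi * (f (tm m) + c * f (tm m ** swp)) = 0" for m
    by (simp add: distrib_left mult.left_commute)
  then have B: "f (tm m) = - c * f (tm m ** swp)" for m
    using om by (simp add: eq_neg_iff_add_eq_0)
  have rec: "f (tm m ** swp) = c^2 / \<omega> pi * f (tm (m + 2) ** swp)" for m
    using A[of "m + 1"] B[of "m + 2"] om by (simp add: field_simps power2_eq_square)
  have it: "f (tm m ** swp) = (c^2 / \<omega> pi) ^ k * f (tm (m + 2 * int k) ** swp)" for m k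
  proof (induction k)
    case (Suc k)
    then show ?case using rec[of "m + 2 * int k"] by (simp add: algebra_simps)
  qed simp
  obtain N where N: "\<And>m. N < \<bar>m\<bar> \<Longrightarrow> f (tm m ** swp) = 0" using UnivD(2)[OF f(1)] by blast
  have "f (tm m ** swp) = 0" for m
    using it[of m "nat (\<bar>N\<bar> + \<bar>m\<bar> + 1)"] N[of "m + 2 * int (nat (\<bar>N\<bar> + \<bar>m\<bar> + 1))"] by simp
  then show False using Inv_eq_0[OF inv] B nz by simp
qed

text \<open>After one application of U, possibly to the \<open>Pi\<close>-translate, an eigenvector
  is described by the finite sequence of its values at \<open>tm m ** swp\<close>. U shifts such
  sequences up to a scalar and \<open>f0\<close> is the unit sequence, so a suitably shifted
  eigenvector is a polynomial in U applied to \<open>f0\<close>.\<close>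

lemma polynomial_in_stable:
  assumes R: "fn.stable GL2 R" "R \<subseteq> Univ" and f: "f \<in> R" "f \<noteq> 0" "ichar \<eta>'" "fn.Ieig \<omega> \<eta>' f"
  shows "\<exists>Q. Q \<noteq> 0 \<and> fn.pact fn.hecke_U Q (f0 \<eta>) \<in> R"
proof -
  have RB: "fn.stable Borel R" using R(1) by (rule fn.stable_mono) (auto simp: Borel_GL2)
  note UR = fn.hecke_U_mem[OF RB]
  have "\<exists>h \<eta>'. h \<in> R \<and> h \<noteq> 0 \<and> ichar \<eta>' \<and> fn.Ieig \<omega> \<eta>' h \<and> (\<forall>m. h (tm m) = 0)"
  proof (cases "fn.hecke_U f = 0")
    case False
    then show ?thesis
      using UR f R(2) fn.Ieig_U[OF \<omega> f(3,4)] U_at_tm[of f] by (intro exI[of _ "fn.hecke_U f"] exI[of _ \<eta>']) auto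
  next
    case True
    have P: "ind_act Pi f \<in> R" using fn.stableD(2)[OF R(1)] f by simp
    have "fn.hecke_U (ind_act Pi f) \<noteq> 0" using exists_U_nonzero f R(2) True by blast
    then show ?thesis
      using UR[OF P] P R(2) fn.Ieig_Pi[OF \<omega> f(3,4)] fn.Ieig_U[OF \<omega> fn.Ieig_Pi[OF \<omega> f(3,4)]] U_at_tm[of "ind_act Pi f"]
      by blast
  qed
  then obtain h \<eta>' where h: "h \<in> R" "h \<noteq> 0" "ichar \<eta>'" "fn.Ieig \<omega> \<eta>' h" "\<And>m. h (tm m) = 0" by blast
  have hU: "h \<in> Univ" using h R(2) by blast
  obtain N where N: "\<And>m. N < \<bar>m\<bar> \<Longrightarrow> h (tm m ** swp) = 0" using UnivD(2)[OF hU] by blast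
  \<comment> \<open>Applying U this often moves the support from -n..n to 0..2n, so that no negative
    powers of U are needed.\<close>
  define n where "n = nat \<bar>N\<bar>"
  define h' where "h' = (fn.hecke_U ^^ n) h"
  have h'R: "h' \<in> R" unfolding h'_def by (induction n) (auto simp: h UR)
  have h': "h' \<in> Inv" "\<And>m. h' (tm m) = 0" "\<And>m. h' (tm m ** swp) = \<omega> pi ^ n * h (tm (m - int n) ** swp)"
    using U_power_at[OF hU h(3,4,5)] by (auto simp: h'_def)
  have om: "\<omega> pi \<noteq> 0" by (simp add: cchar_nz[OF \<omega>])
  \<comment> \<open>The i-th power of U sends \<open>f0\<close> to a function with value
    \<omega>(pi)^i at \<open>tm i ** swp\<close>, whence the division.\<close>
  define a where "a i = h' (tm (int i) ** swp) / \<omega> pi ^ i" for i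
  have f0B: "f0 \<eta> (tm m) = 0" for m by (simp add: tm_def F_mk)
  have f0A: "f0 \<eta> (tm m ** swp) = (if m = 0 then 1 else 0)" for m
    by (simp add: tm_def swp_def F_mk theta0_def cchar_1[OF \<omega>] ichar_1[OF \<eta>])
  note P = U_power_at[OF f0_Univ \<eta> F_Iw[OF \<eta> twist_theta0[OF \<eta>]] f0B]
  have supp: "h' (tm m ** swp) = 0" if "m < 0 \<or> m > int (2 * n)" for m
  proof -
    have "N < \<bar>m - int n\<bar>" using that by (auto simp: n_def)
    then show ?thesis by (simp add: h'(3) N)
  qed
  define Q where "Q = (\<Sum>i\<le>2*n. monom (a i) i)"
  have cQ: "coeff Q i = (if i \<le> 2*n then a i else 0)" for i
    by (simp add: Q_def coeff_sum)
  have "degree Q \<le> 2*n" by (rule degree_le) (simp add: cQ)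
  then have "fn.pact fn.hecke_U Q (f0 \<eta>) = (\<Sum>i\<le>2*n. fun_scale (coeff Q i) ((fn.hecke_U ^^ i) (f0 \<eta>)))"
    by (rule fn.pact_bound)
  also have "\<dots> = (\<Sum>i\<le>2*n. fun_scale (a i) ((fn.hecke_U ^^ i) (f0 \<eta>)))" (is "_ = ?s")
    by (intro sum.cong) (auto simp: cQ)
  finally have pact: "fn.pact fn.hecke_U Q (f0 \<eta>) = ?s" .
  have "?s - h' = 0"
  proof (rule Inv_eq_0)
    show "?s - h' \<in> Inv"
      using P h'(1) by (intro fn.subspace_diff Inv_subspace fn.subspace_sum fn.subspace_scale) auto
    show "(?s - h') (tm m) = 0" for m
      using P h'(2) by (simp add: sum_fun_apply fun_scale_apply)
    show "(?s - h') (tm m ** swp) = 0" for m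
    proof -
      have "?s (tm m ** swp) = (\<Sum>i\<le>2*n. if i = nat m \<and> m \<ge> 0 then a i * \<omega> pi ^ i else 0)"
        unfolding sum_fun_apply fun_scale_apply by (intro sum.cong) (auto simp: P f0A)
      also have "\<dots> = h' (tm m ** swp)"
      proof (cases "m < 0 \<or> m > int (2 * n)")
        case False
        then have "(\<Sum>i\<le>2*n. if i = nat m \<and> m \<ge> 0 then a i * \<omega> pi ^ i else 0) = a (nat m) * \<omega> pi ^ nat m"
          by (simp add: nat_le_iff)
        then show ?thesis using False om by (simp add: a_def)
      qed (use supp in \<open>auto intro!: sum.neutral\<close>)
      finally show ?thesis by simp
    qed
  qed
  then have eq: "fn.pact fn.hecke_U Q (f0 \<eta>) = h'" by (simp add: pact)
  have "Q \<noteq> 0"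
  proof
    assume "Q = 0"
    then have "h' = 0" using eq by (simp add: fn.pact_def)
    have "h (tm m ** swp) = 0" for m
      using h'(3)[of "m + int n"] om by (simp add: \<open>h' = 0\<close>)
    then show False using Inv_eq_0[OF Ieig_Inv[OF hU h(3,4)]] h by simp
  qed
  then show ?thesis using eq h'R by (intro exI[of _ Q]) simp
qed

end

context central_rep
begin

section \<open>The product of the function space with the representation\<close>

definition scale2 :: "'k \<Rightarrow> ('f^2^2 \<Rightarrow> 'k) \<times> 'v \<Rightarrow> ('f^2^2 \<Rightarrow> 'k) \<times> 'v" where
  "scale2 c x = (fun_scale c (fst x), scale c (snd x))"

definition act2 :: "'f^2^2 \<Rightarrow> ('f^2^2 \<Rightarrow> 'k) \<times> 'v \<Rightarrow> ('f^2^2 \<Rightarrow> 'k) \<times> 'v" where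
  "act2 g x = (ind_act g (fst x), act g (snd x))"

lemma scale2_simps [simp]: "fst (scale2 c x) = fun_scale c (fst x)" "snd (scale2 c x) = scale c (snd x)"
  by (simp_all add: scale2_def)

lemma act2_simps [simp]: "fst (act2 g x) = ind_act g (fst x)" "snd (act2 g x) = act g (snd x)"
  by (simp_all add: act2_def)

sublocale pr: G_rep v p pi scale2 act2
proof unfold_locales
  show "scale2 a (x + y) = scale2 a x + scale2 a y" for a x y
    by (rule prod_eqI) (simp_all add: scale_right_distrib fn.scale_right_distrib)
  show "scale2 (a + b) x = scale2 a x + scale2 b x" for a b x
    by (rule prod_eqI) (simp_all add: scale_left_distrib fn.scale_left_distrib)
  show "act2 g (x + y) = act2 g x + act2 g y" if "g \<in> GL2" for g x y
    using that by (intro prod_eqI) (simp_all add: act_add fn.act_add)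
  show "act2 g (scale2 c x) = scale2 c (act2 g x)" if "g \<in> GL2" for g x c
    using that by (intro prod_eqI) (simp_all add: act_scale fn.act_scale)
  show "act2 (g ** h) x = act2 g (act2 h x)" if "g \<in> GL2" "h \<in> GL2" for g h x
    using that by (intro prod_eqI) (simp_all add: act_mult fn.act_mult)
qed (use ac char_p p in \<open>auto intro!: prod_eqI\<close>)

lemma fst_sum2: "fst (sum f A) = (\<Sum>i\<in>A. fst (f i))" for f :: "'a \<Rightarrow> 'b::comm_monoid_add \<times> 'c::comm_monoid_add"
  by (induction A rule: infinite_finite_induct) auto

lemma snd_sum2: "snd (sum f A) = (\<Sum>i\<in>A. snd (f i))" for f :: "'a \<Rightarrow> 'b::comm_monoid_add \<times> 'c::comm_monoid_add"
  by (induction A rule: infinite_finite_induct) auto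

lemma pr_hecke_U: "pr.hecke_U x = (fn.hecke_U (fst x), hecke_U (snd x))"
  by (rule prod_eqI) (simp_all add: pr.hecke_U_def fn.hecke_U_def hecke_U_def fst_sum2 snd_sum2)

lemma pr_hecke_S: "pr.hecke_S x = (fn.hecke_S (fst x), hecke_S (snd x))"
  by (rule prod_eqI) (simp_all add: pr.hecke_S_def fn.hecke_S_def hecke_S_def fst_sum2 snd_sum2)

lemma pr_Ieig: "pr.Ieig \<omega> \<eta> x \<longleftrightarrow> fn.Ieig \<omega> \<eta> (fst x) \<and> Ieig \<omega> \<eta> (snd x)"
  by (auto simp: pr.Ieig_def fn.Ieig_def Ieig_def prod_eq_iff)

lemma pr_pact: "pr.pact pr.hecke_U Q x = (fn.pact fn.hecke_U Q (fst x), pact hecke_U Q (snd x))"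
proof -
  have "(pr.hecke_U ^^ n) x = ((fn.hecke_U ^^ n) (fst x), (hecke_U ^^ n) (snd x))" for n
    by (induction n) (simp_all add: pr_hecke_U)
  then show ?thesis
    by (intro prod_eqI) (simp_all add: pr.pact_def fn.pact_def pact_def fst_sum2 snd_sum2)
qed

lemma fst_span2:
  "x \<in> pr.span (g ` A) \<Longrightarrow> fst x \<in> fn.span ((\<lambda>a. fst (g a)) ` A)"
proof (induction rule: pr.span_induct_alt)
  case (step c x z)
  then have "fst x \<in> fn.span ((\<lambda>a. fst (g a)) ` A)" by (auto intro: fn.span_base)
  then show ?case using step by (simp only: fst_add scale2_simps fn.span_add fn.span_scale)
qed (simp only: fst_zero fn.span_zero)

end

context edge_rep
begin

section \<open>Relations at one vertex\<close>

definition wv :: "('f^2^2 \<Rightarrow> 'k) \<times> 'v" where "wv = (f0 \<eta>, hecke_U y)"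

text \<open>A preimage of \<omega>(pi) \<open>wv\<close> under S. The left translation by
  \<open>tm 1\<close> undoes the shift that U = S \<open>Pi\<close> causes on \<open>f0\<close>, and
  the factor \<omega>(pi) in the second component matches the one in \<open>f0_U\<close>.\<close>

definition uv :: "('f^2^2 \<Rightarrow> 'k) \<times> 'v" where
  "uv = ((\<lambda>g. f0 \<eta> (tm 1 ** g ** Pi)), scale (\<omega> pi) (act Pi y))"

lemma om_pi: "\<omega> pi \<noteq> 0"
  by (simp add: cchar_nz[OF \<omega>])

lemma f0_eig: "fn.Ieig \<omega> \<eta> (f0 \<eta>)"
  by (rule F_Iw[OF \<eta> twist_theta0[OF \<eta>]])

lemma uv_eig: "pr.Ieig \<omega> (\<lambda>u. \<omega> u * \<eta> (inverse u)) uv"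
proof -
  have "Ieig \<omega> (\<lambda>u. \<omega> u * \<eta> (inverse u)) (scale (\<omega> pi) (act Pi y))"
    using subspace_scale[OF Ieig_subspace, of "act Pi y"] Ieig_Pi(2)[OF \<omega> \<eta> y] by simp
  moreover have "fn.Ieig \<omega> (\<lambda>u. \<omega> u * \<eta> (inverse u)) (\<lambda>g. f0 \<eta> (tm 1 ** g ** Pi))"
    unfolding fn.Ieig_def
  proof (intro ballI ext)
    fix i g assume "i \<in> Iw"
    then have "ind_act i (ind_act Pi (f0 \<eta>)) (tm 1 ** g) = fun_scale (\<omega> (i $ 1 $ 1) * (\<omega> (i $ 2 $ 2 / i $ 1 $ 1)
        * \<eta> (inverse (i $ 2 $ 2 / i $ 1 $ 1)))) (ind_act Pi (f0 \<eta>)) (tm 1 ** g)"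
      using fn.Ieig_Pi(2)[OF \<omega> \<eta> f0_eig] by (simp add: fn.Ieig_def)
    then show "ind_act i (\<lambda>g. f0 \<eta> (tm 1 ** g ** Pi)) g = fun_scale (\<omega> (i $ 1 $ 1) * (\<omega> (i $ 2 $ 2 / i $ 1 $ 1)
        * \<eta> (inverse (i $ 2 $ 2 / i $ 1 $ 1)))) (\<lambda>g. f0 \<eta> (tm 1 ** g ** Pi)) g"
      by (simp add: ind_act_def fun_scale_def matrix_mul_assoc)
  qed
  ultimately show ?thesis by (simp add: pr_Ieig uv_def)
qed

lemma uv_S: "pr.hecke_S uv = scale2 (\<omega> pi) wv"
proof (rule prod_eqI)
  have "fn.hecke_S (fst uv) g = \<omega> pi * f0 \<eta> g" for g
  proof -
    have "fn.hecke_S (fst uv) g = (\<Sum>l\<in>L. f0 \<eta> (tm 1 ** g ** (uni l ** (swp ** Pi))))"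
      by (simp add: fn_hecke_S uv_def matrix_mul_assoc)
    also have "\<dots> = fn.hecke_U (f0 \<eta>) (tm 1 ** g)" by (simp add: swp_Pi fn_hecke_U)
    also have "\<dots> = \<omega> pi * f0 \<eta> g" by (simp add: f0_U matrix_mul_assoc tm_add tm_0)
    finally show ?thesis .
  qed
  then show "fst (pr.hecke_S uv) = fst (scale2 (\<omega> pi) wv)"
    by (auto simp: pr_hecke_S wv_def fun_scale_def)
  show "snd (pr.hecke_S uv) = snd (scale2 (\<omega> pi) wv)"
    using hecke_S_lin by (simp add: pr_hecke_S wv_def uv_def lin_def hecke_U_S)
qed

definition Vo :: "(('f^2^2 \<Rightarrow> 'k) \<times> 'v) set" where "Vo = pr.span ((\<lambda>k. act2 k wv) ` KK)"

text \<open>By \<open>KK_span\<close> this is the span of the GL2(O)-orbit of \<open>uv\<close>,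
  written with q + 1 generators.\<close>

definition Eo :: "(('f^2^2 \<Rightarrow> 'k) \<times> 'v) set" where
  "Eo = pr.span (insert uv ((\<lambda>l. act2 (uni l ** swp) uv) ` L))"

lemma Vo_stable: "pr.stable KK Vo"
  unfolding Vo_def by (rule pr.span_orbit_stable_KK)

lemma KK_uv: "k \<in> KK \<Longrightarrow> act2 k uv \<in> Eo"
  unfolding Eo_def by (rule pr.KK_span[OF uv_eig])

text \<open>\<open>wv\<close> is a multiple of S \<open>uv\<close>, which is a sum of
  GL2(O)-translates of \<open>uv\<close>.\<close>

lemma Vo_sub_Eo: "Vo \<subseteq> Eo"
  unfolding Vo_def
proof (rule pr.span_minimal)
  show "pr.subspace Eo" unfolding Eo_def by (rule pr.subspace_span)
  show "(\<lambda>k. act2 k wv) ` KK \<subseteq> Eo"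
  proof (rule image_subsetI)
    fix k assume k: "k \<in> KK"
    have "scale2 (\<omega> pi) (act2 k wv) = act2 k (pr.hecke_S uv)"
      using k by (simp add: uv_S pr.act_scale KK_GL2)
    also have "\<dots> = (\<Sum>l\<in>L. act2 (k ** (uni l ** swp)) uv)"
      using k by (simp add: pr.hecke_S_def pr.act_sum pr.act_mult KK_GL2)
    also have "\<dots> \<in> Eo"
      using k L_V0 \<open>pr.subspace Eo\<close> by (intro pr.subspace_sum KK_uv KK_mult pr.uni_swp_KK)
    finally have "scale2 (inverse (\<omega> pi)) (scale2 (\<omega> pi) (act2 k wv)) \<in> Eo"
      by (rule pr.subspace_scale[OF \<open>pr.subspace Eo\<close>])
    then show "act2 k wv \<in> Eo" using om_pi by simp
  qed
qed

lemma uv_at_uni: "b \<in> V 0 \<Longrightarrow> fst uv (swp ** uni b) = 0"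
  by (simp add: uv_def tm_def swp_def uni_def Pi_def F_mk) (auto simp: V_iff v_mult v_divide)

lemma uv_at_one: "fst uv (mat 1) \<noteq> 0"
  by (simp add: uv_def tm_def Pi_def F_mk om_pi theta0_def power2_eq_square ichar_1[OF \<eta>])

lemma uni_uv_at_uni:
  "fst (act2 (uni l ** swp) uv) (swp ** uni b) = (if b + l \<in> V 1 then \<omega> pi else 0)"
proof -
  have "tm 1 ** (swp ** uni b ** (uni l ** swp)) ** Pi = mk 0 pi pi (b + l)"
    by (simp add: tm_def swp_def uni_def Pi_def algebra_simps)
  moreover have "(b + l) / pi \<in> V 0 \<longleftrightarrow> b + l \<in> V 1" by (simp add: V_div_pi)
  ultimately show ?thesis
    by (simp add: uv_def ind_act_def F_mk theta0_def power2_eq_square ichar_1[OF \<eta>])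
qed

text \<open>The points \<open>swp ** uni (- l)\<close> separate the q translates, while
  \<open>uv\<close> itself vanishes at all of them and is detected at the identity.\<close>

lemma uni_uv_at_rep:
  assumes "l \<in> L" "l' \<in> L"
  shows "fst (act2 (uni l ** swp) uv) (swp ** uni (- l')) = (if l = l' then \<omega> pi else 0)"
proof -
  have "- l' + l \<in> V 1 \<longleftrightarrow> l = l'" using L_eqI[OF assms] by auto
  then show ?thesis by (simp only: uni_uv_at_uni)
qed

text \<open>The relation \<open>F_S\<close> expresses the translate by \<open>swp\<close> through
  \<open>f0\<close> and the translates with l \<noteq> 0, which saves one of the q + 1
  generators.\<close>

lemma f0_orbit_span:
  assumes "k \<in> KK"
  shows "ind_act k (f0 \<eta>) \<in> fn.span (insert (f0 \<eta>) ((\<lambda>l. ind_act (uni l ** swp) (f0 \<eta>)) ` (L - {0})))"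
    (is "_ \<in> fn.span ?T")
proof -
  define g where "g l = ind_act (uni l ** swp) (f0 \<eta>)" for l
  have "fn.hecke_S (f0 \<eta>) = g 0 + (\<Sum>l\<in>L - {0}. g l)"
    unfolding fn.hecke_S_def g_def by (rule sum.remove) auto
  then have "g 0 = fun_scale (\<Sum>l\<in>L. rho \<eta> l) (f0 \<eta>) - (\<Sum>l\<in>L - {0}. g l)"
    using F_S[OF \<eta> twist_theta0[OF \<eta>]] by (simp add: algebra_simps)
  also have "\<dots> \<in> fn.span ?T"
    by (intro fn.span_diff fn.span_scale fn.span_sum fn.span_base) (auto simp: g_def)
  finally have "g 0 \<in> fn.span ?T" .
  moreover have "g l \<in> fn.span ?T" if "l \<in> L - {0}" for l
    using that by (intro fn.span_base) (auto simp: g_def)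
  ultimately have "insert (f0 \<eta>) (g ` L) \<subseteq> fn.span ?T"
    by (auto simp: fn.span_base)
  then have "fn.span (insert (f0 \<eta>) (g ` L)) \<subseteq> fn.span ?T"
    by (intro fn.span_minimal fn.subspace_span)
  then show ?thesis using fn.KK_span[OF f0_eig assms] by (auto simp: g_def[abs_def])
qed

text \<open>The span of the K-orbit of f0 has dimension at most the size of the residue field, while the K-orbit
  of fst uv spans one dimension more.\<close>

lemma uv_notin: "fst uv \<notin> fn.span ((\<lambda>k. ind_act k (f0 \<eta>)) ` KK)"
proof
  let ?S = "fn.span ((\<lambda>k. ind_act k (f0 \<eta>)) ` KK)"
  assume uS: "fst uv \<in> ?S"
  define g where "g l = ind_act (uni l ** swp) (fst uv)" for l
  define T where "T = insert (f0 \<eta>) ((\<lambda>l. ind_act (uni l ** swp) (f0 \<eta>)) ` (L - {0}))"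
  have ST: "?S \<subseteq> fn.span T"
    by (rule fn.span_minimal[OF _ fn.subspace_span]) (use f0_orbit_span in \<open>auto simp: T_def\<close>)
  have "g l \<in> ?S" if "l \<in> L" for l
    unfolding g_def using fn.stableD(2)[OF fn.span_orbit_stable_KK _ uS] fn.uni_swp_KK[OF L_V0[OF that]] .
  then have sub: "insert (fst uv) (g ` L) \<subseteq> fn.span T" using ST uS by blast
  have at: "g l (swp ** uni (- l')) = (if l = l' then \<omega> pi else 0)" if "l \<in> L" "l' \<in> L" for l l'
    using uni_uv_at_rep[OF that] by (simp add: g_def)
  have inj: "inj_on g L"
  proof (rule inj_onI)
    fix l l' assume *: "l \<in> L" "l' \<in> L" "g l = g l'"
    show "l = l'"
    proof (rule ccontr)
      assume "l \<noteq> l'"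
      then have "g l' (swp ** uni (- l)) = 0" using at[OF *(2,1)] by simp
      moreover have "g l' (swp ** uni (- l)) = \<omega> pi" using at[OF *(1,1)] unfolding *(3) by simp
      ultimately show False using om_pi by simp
    qed
  qed
  have at0: "fst uv (swp ** uni (- l)) = 0" if "l \<in> L" for l
    using uv_at_uni[of "- l"] L_V0[OF that] by simp
  have notin: "fst uv \<notin> g ` L"
  proof
    assume "fst uv \<in> g ` L"
    then obtain l where l: "l \<in> L" "fst uv = g l" by blast
    then show False using at[OF l(1,1)] at0[OF l(1)] om_pi by simp
  qed
  have "fn.independent (insert (fst uv) (g ` L))"
  proof (rule fn.independent_if_scalars_zero)
    fix c x assume s: "(\<Sum>x\<in>insert (fst uv) (g ` L). fun_scale (c x) x) = 0" and x: "x \<in> insert (fst uv) (g ` L)"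
    have s': "fun_scale (c (fst uv)) (fst uv) + (\<Sum>l\<in>L. fun_scale (c (g l)) (g l)) = 0"
      using s notin by (simp add: sum.reindex[OF inj])
    have cg: "c (g l) = 0" if l: "l \<in> L" for l
    proof -
      have "0 = (fun_scale (c (fst uv)) (fst uv) + (\<Sum>l\<in>L. fun_scale (c (g l)) (g l))) (swp ** uni (- l))"
        using s' by simp
      also have "\<dots> = (\<Sum>l'\<in>L. c (g l') * g l' (swp ** uni (- l)))"
        using at0[OF l] by (simp add: sum_fun_apply fun_scale_apply)
      also have "\<dots> = (\<Sum>l'\<in>L. if l' = l then c (g l') * \<omega> pi else 0)"
        using at l by (intro sum.cong) auto
      finally show ?thesis using l om_pi by simp
    qed
    have "fun_scale (c (fst uv)) (fst uv) = 0" using s' cg by simp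
    then have "c (fst uv) * fst uv (mat 1) = 0" by (metis fun_scale_apply zero_fun_apply)
    then show "c x = 0" using x cg uv_at_one by auto
  qed simp
  then have "card (insert (fst uv) (g ` L)) \<le> card T"
    using fn.independent_span_bound[of T] sub by (simp add: T_def)
  moreover have "card T \<le> card L"
  proof -
    have "card ((\<lambda>l. ind_act (uni l ** swp) (f0 \<eta>)) ` (L - {0})) \<le> card (L - {0})"
      by (rule card_image_le) simp
    also have "\<dots> = card L - 1" by (rule card_Diff_singleton) simp
    finally show ?thesis
      unfolding T_def by (intro card_insert_le_m1) (use L_0 in \<open>auto simp: card_gt_0_iff simp del: L_0\<close>)
  qed
  ultimately show False using notin by (simp add: card_image[OF inj])
qed

text \<open>Inside \<open>Eo\<close> the values at \<open>swp ** uni (- l)\<close> kill the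
  coefficients of the q translates, and a remaining multiple of \<open>uv\<close> is excluded by
  \<open>uv_notin\<close>. The conclusion includes the second component: every relation of
  \<open>f0\<close> under GL2(O) also holds for U y.\<close>

lemma Vo_local:
  assumes e: "e \<in> Vo" and van: "\<And>b. b \<in> V 0 \<Longrightarrow> fst e (swp ** uni b) = 0"
  shows "e = 0"
proof -
  obtain k c where kc: "e = scale2 k uv + (\<Sum>l\<in>L. scale2 (c l) (act2 (uni l ** swp) uv))"
    using pr.span_insert_image_finite[OF finite_L] e Vo_sub_Eo unfolding Eo_def by blast
  have "c l = 0" if l: "l \<in> L" for l
  proof -
    have lV: "- l \<in> V 0" using L_V0[OF l] by simp
    have "0 = fst e (swp ** uni (- l))" using van[OF lV] by simp
    also have "\<dots> = (\<Sum>l'\<in>L. c l' * fst (act2 (uni l' ** swp) uv) (swp ** uni (- l)))"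
      unfolding kc using uv_at_uni[OF lV] by (simp add: fst_sum2 sum_fun_apply fun_scale_apply del: act2_simps)
    also have "\<dots> = (\<Sum>l'\<in>L. if l' = l then c l' * \<omega> pi else 0)"
      using uni_uv_at_rep l by (intro sum.cong) auto
    finally show ?thesis using l om_pi by simp
  qed
  then have ek: "e = scale2 k uv" by (simp add: kc)
  have "k = 0"
  proof (rule ccontr)
    assume k: "k \<noteq> 0"
    then have "uv = scale2 (inverse k) e" by (simp add: ek)
    then have "uv \<in> Vo" using e pr.stableD(1)[OF Vo_stable] by (simp add: pr.subspace_scale)
    then have "fst uv \<in> fn.span ((\<lambda>k. fst (act2 k wv)) ` KK)" unfolding Vo_def by (rule fst_span2)
    then show False using uv_notin by (simp add: wv_def)
  qed
  then show ?thesis by (simp add: ek)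
qed

text \<open>\<mu> is the minimum of the valuations of the bottom row. Right multiplication by GL2(O)
  changes neither \<mu> nor the valuation of the determinant, and on the support of
  \<open>f0\<close> the latter is 2 \<mu> because \<open>theta0\<close> lives on valuation
  0.\<close>

lemma Vo_support:
  assumes e: "e \<in> Vo" and nz: "fst e (mk a b c d) \<noteq> 0"
  shows "\<exists>\<mu>. c \<in> V \<mu> \<and> d \<in> V \<mu> \<and> \<not> (c \<in> V (\<mu> + 1) \<and> d \<in> V (\<mu> + 1)) \<and> v (a * d - b * c) = 2 * \<mu>"
proof -
  define P where "P = (\<exists>\<mu>. c \<in> V \<mu> \<and> d \<in> V \<mu> \<and> \<not> (c \<in> V (\<mu> + 1) \<and> d \<in> V (\<mu> + 1)) \<and> v (a * d - b * c) = 2 * \<mu>)"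
  have orb: P if k: "k \<in> KK" and nz: "f0 \<eta> (mk a b c d ** k) \<noteq> 0" for k
  proof -
    obtain k' where k': "k' \<in> KK" "k ** k' = mat 1" using KK_inverse[OF k] by blast
    obtain x1 x2 x3 x4 where kk: "k = mk x1 x2 x3 x4" by (rule mk_cases)
    obtain z1 z2 z3 z4 where kk': "k' = mk z1 z2 z3 z4" by (rule mk_cases)
    define c' d' D where "c' = c * x1 + d * x3" "d' = c * x2 + d * x4" "D = a * d - b * c"
    have V0: "x1 \<in> V 0" "x2 \<in> V 0" "x3 \<in> V 0" "x4 \<in> V 0" "z1 \<in> V 0" "z2 \<in> V 0" "z3 \<in> V 0" "z4 \<in> V 0"
      using k k'(1) by (simp_all add: kk kk')
    have u: "unit (x1 * x4 - x2 * x3)" using k by (simp add: kk)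
    have "mk a b c d ** k ** k' = mk a b c d" using k'(2) by (simp flip: matrix_mul_assoc)
    then have cd: "c = c' * z1 + d' * z3" "d = c' * z2 + d' * z4"
      by (simp_all add: kk kk' c'_d'_D_def)
    have det: "(a * x1 + b * x3) * d' - (a * x2 + b * x4) * c' = D * (x1 * x4 - x2 * x3)"
      by (simp add: c'_d'_D_def algebra_simps)
    have "F (theta0 \<eta>) (mk (a * x1 + b * x3) (a * x2 + b * x4) c' d') \<noteq> 0"
      using nz by (simp add: kk c'_d'_D_def)
    then have h: "D \<noteq> 0" "c' \<noteq> 0" "d' / c' \<in> V 0" "theta0 \<eta> (- (D * (x1 * x4 - x2 * x3)) / c'^2) \<noteq> 0"
      unfolding F_mk det by (auto split: if_splits)
    define \<mu> where "\<mu> = v c'"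
    have "v (- (D * (x1 * x4 - x2 * x3)) / c'^2) = 0" using h(4) by (auto simp: theta0_def split: if_splits)
    then have vD: "v D = 2 * \<mu>"
      using h u by (simp add: v_divide v_mult unit_def power2_eq_square \<mu>_def)
    have c'V: "c' \<in> V \<mu>" using h by (simp add: V_iff \<mu>_def)
    have "c' * (d' / c') \<in> V \<mu>" by (rule V_mult0'[OF c'V h(3)])
    then have d'V: "d' \<in> V \<mu>" using h by simp
    have "c \<in> V \<mu>" "d \<in> V \<mu>" unfolding cd using V0 c'V d'V by (auto intro!: V_add V_mult0')
    moreover have "\<not> (c \<in> V (\<mu> + 1) \<and> d \<in> V (\<mu> + 1))"
    proof
      assume "c \<in> V (\<mu> + 1) \<and> d \<in> V (\<mu> + 1)"
      then have "c' \<in> V (\<mu> + 1)" unfolding c'_d'_D_def using V0 by (auto intro!: V_add V_mult0')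
      then show False using h by (simp add: V_iff \<mu>_def)
    qed
    ultimately show P using vD by (auto simp: P_def c'_d'_D_def)
  qed
  have "fst e (mk a b c d) = 0 \<or> P"
    using e unfolding Vo_def
  proof (induction rule: pr.span_induct_alt)
    case (step k x z)
    then obtain i where "i \<in> KK" "x = act2 i wv" by blast
    then show ?case using orb[of i] step.IH by (auto simp: wv_def ind_act_def fun_scale_def)
  qed simp
  then show ?thesis using nz by (simp add: P_def)
qed

lemma Vo_central:
  assumes e: "e \<in> Vo" and z: "z \<noteq> 0"
  shows "fst e (mat z ** g) = \<omega> z * fst e g"
proof -
  have "fst e \<in> Univ"
    using e unfolding Vo_def
  proof (induction rule: pr.span_induct_alt)
    case base
    then show ?case using fn.subspace_0[OF fn.stableD(1)[OF Univ_stable]] by (simp only: fst_zero)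
  next
    case (step c x w)
    then obtain i where "i \<in> KK" "x = act2 i wv" by blast
    then have "fst x \<in> Univ" using fn.stableD(2)[OF Univ_stable KK_GL2 f0_Univ] by (simp add: wv_def)
    then show ?case using step fn.stableD(1)[OF Univ_stable]
      by (simp only: fst_add scale2_simps fn.subspace_add fn.subspace_scale)
  qed
  then show ?thesis using UnivD(1)[of "fst e" z z 0 g] z by (simp add: mat_mk ichar_1[OF \<eta>])
qed

section \<open>Sums over the vertices of the tree\<close>

definition vertex :: "'f \<times> int \<Rightarrow> 'f^2^2" where "vertex x = uni (fst x) ** tm (snd x)"

lemma vertex_GL2 [simp]: "vertex x \<in> GL2" by (simp add: vertex_def)

text \<open>For a vertex x of maximal level there are enough test points at which all other summands
  vanish. There \<open>Vo_local\<close> shows the summand of x to be zero, and induction removes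
  it.\<close>

lemma vertex_independent:
  assumes "finite A" "\<And>x. x \<in> A \<Longrightarrow> rep (snd x) (fst x) = fst x" "\<And>x. e x \<in> Vo"
    and "fst (\<Sum>x\<in>A. act2 (vertex x) (e x)) = 0"
  shows "\<forall>x\<in>A. e x = 0"
  using assms
proof (induction "card A" arbitrary: A)
  case (Suc n)
  have ne: "A \<noteq> {}" using Suc.hyps(2) by auto
  have "Max (snd ` A) \<in> snd ` A" using ne Suc.prems(1) by (intro Max_in) auto
  then obtain x where x: "x \<in> A" "snd x = Max (snd ` A)" by auto
  have mx: "snd z \<le> snd x" if "z \<in> A" for z using that Suc.prems(1) by (simp add: x(2))
  define m where "m = snd x"
  have "fst (e x) (swp ** uni b) = 0" if b: "b \<in> V 0" for b
  proof -
    \<comment> \<open>Chosen so that \<open>pt ** vertex x\<close> is a central matrix times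
      \<open>swp ** uni b\<close>; the factor \<open>tm m\<close> in \<open>pt\<close> adjusts the
      valuation of the determinant to the level of x.\<close>
    define b' where "b' = pi powi m * b - fst x"
    define pt where "pt = tm m ** swp ** uni b'"
    have ptv: "pt ** vertex z = mk 0 (pi powi m) (pi powi (snd z)) (b' + fst z)" for z
      by (simp add: pt_def vertex_def tm_def swp_def uni_def algebra_simps)
    have other: "fst (e z) (pt ** vertex z) = 0" if z: "z \<in> A" "z \<noteq> x" for z
    proof (rule ccontr)
      assume "fst (e z) (pt ** vertex z) \<noteq> 0"
      then obtain \<mu> where \<mu>: "pi powi (snd z) \<in> V \<mu>" "b' + fst z \<in> V \<mu>"
        "v (0 * (b' + fst z) - pi powi m * pi powi (snd z)) = 2 * \<mu>"
        using Vo_support[OF Suc.prems(3)] unfolding ptv by blast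
      \<comment> \<open>Together with \<mu> \<le> \<open>snd z\<close> \<le> m this leaves only
        \<open>snd z\<close> = \<mu> = m, and then z and x name the same ball.\<close>
      have "m + snd z = 2 * \<mu>" using \<mu>(3) by (simp add: v_mult)
      moreover have "\<mu> \<le> snd z" using \<mu>(1) by simp
      ultimately have eq: "snd z = m" "\<mu> = m" using mx[OF z(1)] by (auto simp: m_def)
      have "pi powi m * b \<in> V m" using b by (simp add: V_powi_mult)
      then have "(b' + fst z) - pi powi m * b \<in> V m" using \<mu>(2) eq by (intro V_diff) auto
      then have "fst z - fst x \<in> V m" by (simp add: b'_def)
      then have "rep m (fst z) = rep m (fst x)" by (simp add: rep_eq_iff)
      then have "fst z = fst x" using Suc.prems(2)[OF z(1)] Suc.prems(2)[OF x(1)] eq by (simp add: m_def)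
      then show False using z(2) eq by (simp add: m_def prod_eq_iff)
    qed
    have "0 = fst (\<Sum>x\<in>A. act2 (vertex x) (e x)) pt" using Suc.prems(4) by simp
    also have "\<dots> = (\<Sum>z\<in>A. fst (e z) (pt ** vertex z))"
      by (simp add: fst_sum2 sum_fun_apply ind_act_def)
    also have "\<dots> = fst (e x) (pt ** vertex x)"
      using other Suc.prems(1) x(1) by (subst sum.remove[OF _ x(1)]) auto
    also have "pt ** vertex x = mat (pi powi m) ** (swp ** uni b)"
      unfolding ptv by (simp add: m_def b'_def swp_def uni_def mat_mk)
    also have "fst (e x) (mat (pi powi m) ** (swp ** uni b)) = \<omega> (pi powi m) * fst (e x) (swp ** uni b)"
      by (rule Vo_central[OF Suc.prems(3)]) simp
    finally show ?thesis using cchar_nz[OF \<omega>, of "pi powi m"] by simp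
  qed
  then have ex: "e x = 0" using Vo_local[OF Suc.prems(3)] by blast
  have "fst (\<Sum>z\<in>A - {x}. act2 (vertex z) (e z)) = 0"
    using Suc.prems(4) ex by (subst (asm) sum.remove[OF Suc.prems(1) x(1)]) simp
  moreover have "n = card (A - {x})" using Suc.hyps(2) Suc.prems(1) x(1) by simp
  ultimately have "\<forall>z\<in>A - {x}. e z = 0" using Suc.prems by (intro Suc.hyps(1)) auto
  then show ?case using ex by blast
qed auto

definition Dw :: "(('f^2^2 \<Rightarrow> 'k) \<times> 'v) set" where "Dw = pr.span ((\<lambda>g. act2 g wv) ` GL2)"

lemma Dw_stable: "pr.stable GL2 Dw"
  unfolding Dw_def by (rule pr.span_orbit_stable_GL2)

text \<open>Translates are grouped by vertex: central factors become scalars, and factors in GL2(O)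
  are absorbed into \<open>Vo\<close>.\<close>

lemma Dw_decomp:
  assumes "x \<in> Dw"
  shows "\<exists>A e. finite A \<and> (\<forall>z\<in>A. rep (snd z) (fst z) = fst z) \<and> (\<forall>z. e z \<in> Vo) \<and> x = (\<Sum>z\<in>A. act2 (vertex z) (e z))"
  using assms unfolding Dw_def
proof (induction rule: pr.span_induct_alt)
  case base
  have "(0 :: ('f^2^2 \<Rightarrow> 'k) \<times> 'v) \<in> Vo" using pr.subspace_0[OF pr.stableD(1)[OF Vo_stable]] .
  then show ?case by (intro exI[of _ "{}"] exI[of _ "\<lambda>_. 0"]) simp
next
  case (step c x z)
  note sub = pr.stableD(1)[OF Vo_stable]
  obtain A e where Ae: "finite A" "\<forall>z\<in>A. rep (snd z) (fst z) = fst z" "\<forall>z. e z \<in> Vo" "z = (\<Sum>z\<in>A. act2 (vertex z) (e z))"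
    using step.IH by blast
  obtain g where g: "g \<in> GL2" "x = act2 g wv" using step.hyps by blast
  obtain \<zeta> a n k where gg: "\<zeta> \<noteq> 0" "rep n a = a" "k \<in> KK" "g = mat \<zeta> ** (uni a ** tm n) ** k"
    using pr.GL2_vertex[OF g(1)] .
  have kV: "act2 k wv \<in> Vo" unfolding Vo_def using gg(3) by (intro pr.span_base) blast
  have cen: "act2 (mat \<zeta>) wv = scale2 (\<omega> \<zeta>) wv"
    using F_central[OF gg(1)] central[OF gg(1)] by (intro prod_eqI) (simp_all add: wv_def)
  have zG: "mat \<zeta> \<in> GL2" using gg(1) by (simp add: mat_mk)
  have comm: "mat \<zeta> ** h = h ** mat \<zeta>" for h :: "'f^2^2"
    by (cases h rule: mk_cases) (simp add: mat_mk mult.commute)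
  have "g = vertex (a, n) ** k ** mat \<zeta>"
    unfolding gg(4) vertex_def fst_conv snd_conv matrix_mul_assoc[symmetric] comm[of "uni a ** (tm n ** k)"] by simp
  then have x: "x = scale2 (\<omega> \<zeta>) (act2 (vertex (a, n)) (act2 k wv))"
    using zG KK_GL2[OF gg(3)] by (simp add: g(2) pr.act_mult cen pr.act_scale)
  define e' where "e' w = (if w \<in> A then e w else 0) + (if w = (a, n) then scale2 (c * \<omega> \<zeta>) (act2 k wv) else 0)" for w
  have e'V: "e' w \<in> Vo" for w
    unfolding e'_def
  proof (rule pr.subspace_add[OF sub])
    show "(if w \<in> A then e w else 0) \<in> Vo" using Ae(3)[rule_format, of w] pr.subspace_0[OF sub] by simp
    show "(if w = (a, n) then scale2 (c * \<omega> \<zeta>) (act2 k wv) else 0) \<in> Vo"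
      using pr.subspace_scale[OF sub kV] pr.subspace_0[OF sub] by simp
  qed
  have "(\<Sum>w\<in>insert (a, n) A. act2 (vertex w) (e' w)) =
     (\<Sum>w\<in>insert (a, n) A. if w \<in> A then act2 (vertex w) (e w) else 0)
   + (\<Sum>w\<in>insert (a, n) A. if w = (a, n) then act2 (vertex w) (scale2 (c * \<omega> \<zeta>) (act2 k wv)) else 0)"
    unfolding sum.distrib[symmetric] by (intro sum.cong) (auto simp: e'_def pr.act_add)
  also have "(\<Sum>w\<in>insert (a, n) A. if w \<in> A then act2 (vertex w) (e w) else 0) = z"
    unfolding Ae(4) using Ae(1) by (intro sum.mono_neutral_cong_right) auto
  also have "(\<Sum>w\<in>insert (a, n) A. if w = (a, n) then act2 (vertex w) (scale2 (c * \<omega> \<zeta>) (act2 k wv)) else 0) = scale2 c x"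
    using Ae(1) by (simp add: x pr.act_scale)
  finally have "scale2 c x + z = (\<Sum>w\<in>insert (a, n) A. act2 (vertex w) (e' w))" by (simp add: add.commute)
  then show ?case
    using Ae(1,2) gg(2) e'V by (intro exI[of _ "insert (a, n) A"] exI[of _ e']) auto
qed

text \<open>\<open>Dw\<close> is a graph, so sending \<open>f0\<close> to U y extends
  G-equivariantly to everything that \<open>f0\<close> generates.\<close>

lemma Dw_graph:
  assumes "x \<in> Dw" "fst x = 0" shows "x = 0"
proof -
  obtain A e where *: "finite A" "\<forall>z\<in>A. rep (snd z) (fst z) = fst z" "\<forall>z. e z \<in> Vo" "x = (\<Sum>z\<in>A. act2 (vertex z) (e z))"
    using Dw_decomp[OF assms(1)] by blast
  then have "\<forall>z\<in>A. e z = 0" using assms(2) by (intro vertex_independent) auto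
  then show ?thesis using * by simp
qed

end

section \<open>Subquotients of principal series\<close>

lemma (in vector_space) span_image_explicit:
  assumes "x \<in> span (f ` S)"
  shows "\<exists>A c. finite A \<and> A \<subseteq> S \<and> x = (\<Sum>a\<in>A. scale (c a) (f a))"
proof -
  obtain t r where t: "finite t" "t \<subseteq> f ` S" "x = (\<Sum>a\<in>t. scale (r a) a)"
    using assms unfolding span_explicit by blast
  obtain A where A: "A \<subseteq> S" "finite A" "t = f ` A" using finite_subset_image[OF t(1,2)] by blast
  have "x \<in> span (f ` A)" unfolding t(3) A(3)[symmetric] by (intro span_sum span_scale span_base)
  then show ?thesis using span_image_finite[OF A(2)] A by blast
qed

context G_rep
begin

section \<open>Smooth vectors\<close>

definition smooth_vec :: "'v \<Rightarrow> bool" where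
  "smooth_vec y \<longleftrightarrow> (\<exists>n\<ge>1. \<forall>k\<in>Kn n. act k y = y)"

lemma smooth_vec_subspace: "subspace (Collect smooth_vec)"
  unfolding subspace_def
proof (intro conjI ballI allI)
  show "0 \<in> Collect smooth_vec" using Kn_GL2[of 1] by (auto simp: smooth_vec_def intro!: exI[of _ 1])
  fix x assume x: "x \<in> Collect smooth_vec"
  then obtain n where n: "n \<ge> 1" "\<forall>k\<in>Kn n. act k x = x" by (auto simp: smooth_vec_def)
  then show "scale c x \<in> Collect smooth_vec" for c
    using Kn_GL2[OF n(1)] by (auto simp: smooth_vec_def act_scale intro!: exI[of _ n])
  fix z assume "z \<in> Collect smooth_vec"
  then obtain m where m: "m \<ge> 1" "\<forall>k\<in>Kn m. act k z = z" by (auto simp: smooth_vec_def)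
  have "act k (x + z) = x + z" if "k \<in> Kn (max n m)" for k
    using that Kn_mono[OF that, of n] Kn_mono[OF that, of m] n m Kn_GL2[of n] by (simp add: act_add)
  then show "x + z \<in> Collect smooth_vec" using n by (auto simp: smooth_vec_def intro!: exI[of _ "max n m"])
qed

lemma smooth_vec_act:
  assumes y: "smooth_vec y" and g: "g \<in> GL2"
  shows "smooth_vec (act g y)"
proof -
  obtain n where n: "n \<ge> 1" "\<forall>k\<in>Kn n. act k y = y" using y by (auto simp: smooth_vec_def)
  obtain N where N: "N \<ge> 1" "\<forall>k\<in>Kn N. \<exists>k'\<in>Kn n. k ** g = g ** k'" using conj_Kn[OF g] by blast
  have "act k (act g y) = act g y" if k: "k \<in> Kn N" for k
  proof -
    obtain k' where k': "k' \<in> Kn n" "k ** g = g ** k'" using N(2) k by blast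
    have "act k (act g y) = act g (act k' y)"
      using g Kn_GL2[OF N(1) k] Kn_GL2[OF n(1) k'(1)] by (simp add: k'(2) flip: act_mult)
    then show ?thesis using n k' by simp
  qed
  then show ?thesis using N(1) unfolding smooth_vec_def by blast
qed

lemma span_orbit_smooth:
  assumes "smooth_vec y" "x \<in> span ((\<lambda>g. act g y) ` GL2)"
  shows "smooth_vec x"
  using span_minimal[OF _ smooth_vec_subspace, of "(\<lambda>g. act g y) ` GL2"] assms smooth_vec_act by blast

lemma Ieig_smooth: "cchar \<omega> \<Longrightarrow> ichar \<eta> \<Longrightarrow> Ieig \<omega> \<eta> y \<Longrightarrow> smooth_vec y"
  unfolding smooth_vec_def using Ieig_fixed Kn_Iw1[of 1] by blast

lemma pact_mem:
  assumes "subspace W" "\<And>z. z \<in> W \<Longrightarrow> T z \<in> W" "z \<in> W"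
  shows "pact T Q z \<in> W"
proof -
  have "(T ^^ i) z \<in> W" for i by (induction i) (auto simp: assms)
  then show ?thesis unfolding pact_def using assms(1) by (intro subspace_sum subspace_scale)
qed

end

context central_rep
begin

section \<open>Tamely ramified principal series and their generators\<close>

definition chim :: "('f \<Rightarrow> 'k) \<Rightarrow> 'k \<Rightarrow> 'f \<Rightarrow> 'f \<Rightarrow> 'k" where
  "chim \<eta> \<mu> a d = \<omega> d * thetam \<eta> \<mu> (a / d)"

lemma thetam_nz:
  assumes "ichar \<eta>" "\<mu> \<noteq> 0" "x \<noteq> 0" shows "thetam \<eta> \<mu> x \<noteq> 0"
  using assms ichar_nz[OF assms(1) unit_decomp[OF assms(3)]] by (simp add: thetam_def power_int_not_zero)

lemma chim_smooth:
  assumes \<eta>: "ichar \<eta>" and \<mu>: "\<mu> \<noteq> 0"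
  shows "smooth_char_T v (chim \<eta> \<mu>)"
  unfolding smooth_char_T_def
proof (intro conjI allI impI exI[of _ 1])
  show "chim \<eta> \<mu> a d \<noteq> 0" if "a \<noteq> 0" "d \<noteq> 0" for a d
    using that thetam_nz[OF assms] cchar_nz[OF \<omega>] by (simp add: chim_def)
  show "chim \<eta> \<mu> (a * a') (d * d') = chim \<eta> \<mu> a d * chim \<eta> \<mu> a' d'"
    if "a \<noteq> 0" "d \<noteq> 0" "a' \<noteq> 0" "d' \<noteq> 0" for a d a' d'
  proof -
    have "thetam \<eta> \<mu> (a / d * (a' / d')) = thetam \<eta> \<mu> (a / d) * thetam \<eta> \<mu> (a' / d')"
      using that by (intro thetam_mult[OF assms]) auto
    then show ?thesis using that by (simp add: chim_def cchar_mult[OF \<omega>])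
  qed
  show "chim \<eta> \<mu> a d = 1" if "a - 1 \<in> V 1" "d - 1 \<in> V 1" for a d
  proof -
    have u: "unit a" "unit d" using that by (simp_all add: unit_of_one)
    have "(a - d) / d \<in> V 1" using V_diff[OF that] by (simp add: V_div_unit[OF u(2)])
    then have "a / d - 1 \<in> V 1" using unit_nz[OF u(2)] by (simp add: diff_divide_distrib)
    then have "thetam \<eta> \<mu> (a / d) = 1"
      using \<eta> thetam_unit[OF unit_divide[OF u]] by (simp add: ichar_def)
    moreover have "\<omega> d = 1" using \<omega> that by (simp add: cchar_def)
    ultimately show ?thesis by (simp add: chim_def)
  qed
qed simp

lemma close_mat_ent: "close_mat v n g h \<longleftrightarrow> ent n (h - g)"
  by (simp add: close_mat_def ent_def)

lemma Ind_stable: "fn.stable GL2 (Ind v chi)"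
  unfolding fn.stable_def fn.subspace_def
proof (intro conjI ballI allI)
  show "0 \<in> Ind v chi" by (simp add: Ind_def locally_constant_on_G_def)
  fix f :: "'f^2^2 \<Rightarrow> 'k" assume f: "f \<in> Ind v chi"
  show "fun_scale c f \<in> Ind v chi" for c
    using f unfolding Ind_def locally_constant_on_G_def fun_scale_def mem_Collect_eq
    by (intro conjI ballI allI impI) (simp, metis, simp)
  show "ind_act h f \<in> Ind v chi" if h: "h \<in> GL2" for h
    unfolding Ind_def
  proof (intro CollectI conjI allI ballI impI)
    show "locally_constant_on_G v (ind_act h f)"
      unfolding locally_constant_on_G_def close_mat_ent
    proof
      fix g :: "'f^2^2" assume g: "g \<in> GL2"
      then have "g ** h \<in> GL2" using h by simp
      then obtain n where n: "\<forall>x\<in>GL2. ent n (x - g ** h) \<longrightarrow> f x = f (g ** h)"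
        using f unfolding Ind_def locally_constant_on_G_def close_mat_ent by blast
      obtain M where M: "ent (- M) h" using ent_exists by blast
      have "ind_act h f x = ind_act h f g" if "x \<in> GL2" "ent (n + M) (x - g)" for x
      proof -
        have "ent n ((x - g) ** h)" using ent_mult[OF that(2) M] by simp
        then show ?thesis using n h that(1) by (simp add: matrix_diff_rdistrib ind_act_def)
      qed
      then show "\<exists>n. \<forall>x\<in>GL2. ent n (x - g) \<longrightarrow> ind_act h f x = ind_act h f g" by blast
    qed
  qed (use f h in \<open>auto simp: Ind_def ind_act_def simp flip: matrix_mul_assoc\<close>)
  fix f' :: "'f^2^2 \<Rightarrow> 'k" assume f': "f' \<in> Ind v chi"
  show "f + f' \<in> Ind v chi"
    unfolding Ind_def
  proof (intro CollectI conjI allI ballI impI)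
    show "locally_constant_on_G v (f + f')"
      unfolding locally_constant_on_G_def close_mat_ent
    proof
      fix g :: "'f^2^2" assume g: "g \<in> GL2"
      obtain n where n: "\<forall>x\<in>GL2. ent n (x - g) \<longrightarrow> f x = f g"
        using f g unfolding Ind_def locally_constant_on_G_def close_mat_ent by blast
      obtain m where m: "\<forall>x\<in>GL2. ent m (x - g) \<longrightarrow> f' x = f' g"
        using f' g unfolding Ind_def locally_constant_on_G_def close_mat_ent by blast
      have "(f + f') x = (f + f') g" if "x \<in> GL2" "ent (max n m) (x - g)" for x
        using n m that ent_mono[OF that(2), of n] ent_mono[OF that(2), of m] by simp
      then show "\<exists>n. \<forall>x\<in>GL2. ent n (x - g) \<longrightarrow> (f + f') x = (f + f') g" by blast
    qed
  qed (use f f' in \<open>auto simp: Ind_def distrib_left\<close>)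
qed

text \<open>Local constancy comes from invariance under \<open>Kn 1\<close>, since matrices close to
  g differ from it by an element of \<open>Kn 1\<close> on the right.\<close>

lemma fm_Ind:
  assumes \<eta>: "ichar \<eta>" and \<mu>: "\<mu> \<noteq> 0"
  shows "fm \<eta> \<mu> \<in> Ind v (chim \<eta> \<mu>)"
  unfolding Ind_def
proof (intro CollectI conjI allI ballI impI)
  have eig: "fn.Ieig \<omega> \<eta> (fm \<eta> \<mu>)" by (rule F_Iw[OF \<eta> twist_thetam[OF assms]])
  show "locally_constant_on_G v (fm \<eta> \<mu>)"
    unfolding locally_constant_on_G_def close_mat_ent
  proof
    fix g :: "'f^2^2" assume "g \<in> GL2"
    then obtain N where N: "\<forall>h. ent N (h - g) \<longrightarrow> (\<exists>k\<in>Kn 1. h = g ** k)" using approx by blast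
    have "fm \<eta> \<mu> h = fm \<eta> \<mu> g" if "ent N (h - g)" for h
    proof -
      have "\<exists>k\<in>Kn 1. h = g ** k" using N that by blast
      then obtain k where k: "k \<in> Kn 1" "h = g ** k" by blast
      have "ind_act k (fm \<eta> \<mu>) = fm \<eta> \<mu>" using fn.Ieig_fixed[OF \<omega> \<eta> eig] Kn_Iw1[of 1] k(1) by simp
      then show ?thesis using k(2) by (metis ind_act_def)
    qed
    then show "\<exists>n. \<forall>h\<in>GL2. ent n (h - g) \<longrightarrow> fm \<eta> \<mu> h = fm \<eta> \<mu> g" by blast
  qed
  fix b g :: "'f^2^2" assume b: "b \<in> Borel" and "g \<in> GL2"
  obtain x z w where bb: "b = mk x z 0 w" "x \<noteq> 0" "w \<noteq> 0" using Borel_cases[OF b] .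
  define X where "X = - det g / (g $ 2 $ 1)^2"
  have "F (\<lambda>t. thetam \<eta> \<mu> (x / w * t)) g = thetam \<eta> \<mu> (x / w) * fm \<eta> \<mu> g"
  proof (cases "det g \<noteq> 0 \<and> g $ 2 $ 1 \<noteq> 0")
    case True
    then have "thetam \<eta> \<mu> (x / w * X) = thetam \<eta> \<mu> (x / w) * thetam \<eta> \<mu> X"
      using bb(2,3) by (intro thetam_mult[OF assms]) (auto simp: X_def)
    then show ?thesis unfolding F_def X_def[symmetric] by simp
  qed (auto simp: F_def)
  then show "fm \<eta> \<mu> (b ** g) = chim \<eta> \<mu> (b $ 1 $ 1) (b $ 2 $ 2) * fm \<eta> \<mu> g"
    using F_left[OF bb(2,3), of "thetam \<eta> \<mu>" z g] by (simp add: bb(1) chim_def)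
qed (rule F_notin)

end

locale supersingular_rep = central_rep v p pi scale act \<omega>
  for v :: "'f::field \<Rightarrow> int" and p :: nat and pi :: 'f
    and scale :: "'k::field \<Rightarrow> 'v::ab_group_add \<Rightarrow> 'v" and act :: "'f^2^2 \<Rightarrow> 'v \<Rightarrow> 'v"
    and \<omega> :: "'f \<Rightarrow> 'k" +
  assumes smooth: "smooth_vec z"
    and irred: "stable GL2 W \<Longrightarrow> W = {0} \<or> W = UNIV"
    and no_subquotient: "smooth_char_T v chi \<Longrightarrow> \<not> iso_subquotient_Ind v chi scale act"
begin

text \<open>A G-stable subspace of Ind x pi meeting 0 x pi trivially is the graph of a map from a subspace of Ind to pi.\<close>

lemma contains_second_factor:
  assumes D: "pr.stable GL2 D" and chi: "smooth_char_T v chi" and sub: "\<And>x. x \<in> D \<Longrightarrow> fst x \<in> Ind v chi"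
    and x: "x \<in> D" "snd x \<noteq> 0"
  shows "(0, z) \<in> D"
proof -
  note Ds = pr.stableD(1)[OF D] and Da = pr.stableD(2)[OF D]
  have Dadd: "a + b \<in> D" if "a \<in> D" "b \<in> D" for a b using pr.subspace_add[OF Ds that] .
  have Dsc: "scale2 c a \<in> D" if "a \<in> D" for a c using pr.subspace_scale[OF Ds that] .
  have D0: "0 \<in> D" using pr.subspace_0[OF Ds] .
  have img: "stable GL2 (snd ` D)"
    unfolding stable_def subspace_def
  proof (intro conjI ballI allI)
    show "0 \<in> snd ` D" using D0 by force
    show "a + b \<in> snd ` D" if "a \<in> snd ` D" "b \<in> snd ` D" for a b
      using that Dadd by (metis (no_types, lifting) imageE imageI snd_add)
    show "scale c a \<in> snd ` D" if "a \<in> snd ` D" for c a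
      using that Dsc by (metis (no_types, lifting) imageE imageI scale2_simps(2))
    show "act g a \<in> snd ` D" if "g \<in> GL2" "a \<in> snd ` D" for g a
      using that Da by (metis (no_types, lifting) imageE imageI act2_simps(2))
  qed
  then have onto: "snd ` D = UNIV" using irred[OF img] x by blast
  define K where "K = {z. (0, z) \<in> D}"
  have "stable GL2 K"
    unfolding stable_def subspace_def K_def mem_Collect_eq
  proof (intro conjI ballI allI impI)
    show "(0, 0) \<in> D" using D0 by (simp add: zero_prod_def)
    show "(0, a + b) \<in> D" if "a \<in> {z. (0, z) \<in> D}" "b \<in> {z. (0, z) \<in> D}" for a b
      using Dadd[OF that[unfolded mem_Collect_eq]] by simp
    show "(0, scale c a) \<in> D" if "a \<in> {z. (0, z) \<in> D}" for a c
      using Dsc[of "(0, a)" c] that by (simp add: scale2_def)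
    show "(0, act g a) \<in> D" if "g \<in> GL2" "a \<in> {z. (0, z) \<in> D}" for g a
      using Da[of g "(0, a)"] that by (simp add: act2_def)
  qed
  then consider "K = {0}" | "K = UNIV" using irred by blast
  then show ?thesis
  proof cases
    case 1
    have uniq: "a = b" if "(f, a) \<in> D" "(f, b) \<in> D" for f a b
    proof -
      have "(f, a) - (f, b) \<in> D" using pr.subspace_diff[OF Ds that] .
      then have "a - b \<in> K" by (simp add: K_def)
      then show ?thesis using 1 by simp
    qed
    define \<phi> where "\<phi> f = (THE a. (f, a) \<in> D)" for f
    have phi: "\<phi> f = a" if "(f, a) \<in> D" for f a
      unfolding \<phi>_def using that uniq by (intro the_equality) auto
    define W1 where "W1 = fst ` D"
    \<comment> \<open>\<open>W2\<close> is the kernel of \<phi>, so \<phi> identifies W1/W2 with the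
      representation, which \<open>no_subquotient\<close> forbids.\<close>
    define W2 where "W2 = {f. (f, 0) \<in> D}"
    have W1: "(f, \<phi> f) \<in> D" if "f \<in> W1" for f
      using that phi by (auto simp: W1_def)
    have W1I: "f \<in> W1" if "(f, a) \<in> D" for f a using that by (force simp: W1_def)
    have add: "(f + f', a + a') \<in> D" if "(f, a) \<in> D" "(f', a') \<in> D" for f f' a a'
      using Dadd[OF that] by simp
    have sc: "(fun_scale c f, scale c a) \<in> D" if "(f, a) \<in> D" for f a c
      using Dsc[OF that, of c] by (simp add: scale2_def)
    have ac: "(ind_act g f, act g a) \<in> D" if "(f, a) \<in> D" "g \<in> GL2" for f a g
      using Da[OF that(2,1)] by (simp add: act2_def)
    have zz: "(0, 0) \<in> D" using D0 by (simp add: zero_prod_def)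
    have "iso_subquotient_Ind v chi scale act"
      unfolding iso_subquotient_Ind_def
    proof (rule exI[of _ W1], rule exI[of _ W2], intro exI[of _ \<phi>] conjI ballI allI)
      show "W2 \<subseteq> W1" using W1I by (auto simp: W2_def)
      show "W1 \<subseteq> Ind v chi" using sub by (auto simp: W1_def)
      show "stable_subspace GL2 fun_scale ind_act W1"
        unfolding stable_subspace_def fn.subspace_def
        using W1I[OF zz] W1I[OF add[OF W1 W1]] W1I[OF sc[OF W1]] W1I[OF ac[OF W1]] by blast
      show "stable_subspace GL2 fun_scale ind_act W2"
        unfolding stable_subspace_def fn.subspace_def W2_def
        using add[of _ 0 _ 0] sc[of _ 0] ac[of _ 0] zz by auto
      show "\<phi> (f + f') = \<phi> f + \<phi> f'" if "f \<in> W1" "f' \<in> W1" for f f'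
        by (rule phi[OF add[OF W1[OF that(1)] W1[OF that(2)]]])
      show "\<phi> (fun_scale c f) = scale c (\<phi> f)" if "f \<in> W1" for c f
        by (rule phi[OF sc[OF W1[OF that]]])
      show "\<phi> (ind_act g f) = act g (\<phi> f)" if "g \<in> GL2" "f \<in> W1" for g f
        by (rule phi[OF ac[OF W1[OF that(2)] that(1)]])
      show "\<phi> ` W1 = UNIV"
      proof -
        have "a \<in> \<phi> ` W1" for a
        proof -
          have "a \<in> snd ` D" using onto by simp
          then obtain f where "(f, a) \<in> D" by force
          then show ?thesis using phi W1I by (metis imageI)
        qed
        then show ?thesis by blast
      qed
      show "\<phi> f = 0 \<longleftrightarrow> f \<in> W2" if "f \<in> W1" for f
      proof
        assume "\<phi> f = 0"
        then show "f \<in> W2" using W1[OF that] by (simp add: W2_def)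
      next
        assume "f \<in> W2"
        then show "\<phi> f = 0" by (intro phi) (simp add: W2_def)
      qed
    qed
    then show ?thesis using no_subquotient[OF chi] by blast
  next
    case 2
    then show ?thesis by (auto simp: K_def)
  qed
qed

lemma span_fm_Ind:
  assumes "ichar \<eta>" "\<mu> \<noteq> 0" "x \<in> pr.span ((\<lambda>g. act2 g (fm \<eta> \<mu>, a)) ` GL2)"
  shows "fst x \<in> Ind v (chim \<eta> \<mu>)"
proof -
  have "fst x \<in> fn.span ((\<lambda>g. fst (act2 g (fm \<eta> \<mu>, a))) ` GL2)" using assms(3) by (rule fst_span2)
  also have "\<dots> \<subseteq> Ind v (chim \<eta> \<mu>)"
    using fn.stableD[OF Ind_stable] fm_Ind[OF assms(1,2)] by (intro fn.span_minimal) auto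
  finally show ?thesis .
qed

end

section \<open>Specialization of the variable and a polynomial relation for U\<close>

locale supersingular_edge = supersingular_rep v p pi scale act \<omega> + edge_rep v p pi scale act \<omega> \<eta> y
  for v :: "'f::field \<Rightarrow> int" and p :: nat and pi :: 'f
    and scale :: "'k::field \<Rightarrow> 'v::ab_group_add \<Rightarrow> 'v" and act :: "'f^2^2 \<Rightarrow> 'v \<Rightarrow> 'v"
    and \<omega> \<eta> :: "'f \<Rightarrow> 'k" and y :: 'v
begin

text \<open>Where the sum is not identically zero, only m = - v x contributes, x being the argument
  of \<theta>. The range of m depends on g, so the sum over all integers is stated as eventual
  constancy of symmetric partial sums.\<close>

lemma f0_sum: "\<exists>N. \<forall>M\<ge>N. (\<Sum>m\<in>{-M..M}. f0 \<eta> (tm m ** g)) = fm \<eta> 1 g"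
proof -
  define x where "x = - det g / (g $ 2 $ 1)^2"
  show ?thesis
  proof (cases "det g \<noteq> 0 \<and> g $ 2 $ 1 \<noteq> 0 \<and> g $ 2 $ 2 / g $ 2 $ 1 \<in> V 0")
    case True
    then have x: "x \<noteq> 0" by (simp add: x_def)
    have "(\<Sum>m\<in>{-M..M}. f0 \<eta> (tm m ** g)) = fm \<eta> 1 g" if "M \<ge> \<bar>v x\<bar>" for M
    proof -
      have "theta0 \<eta> (pi powi m * x) = (if m = - v x then thetam \<eta> 1 x else 0)" for m
        using x by (auto simp: theta0_def thetam_def v_mult power_int_minus divide_inverse mult.commute)
      then have "f0 \<eta> (tm m ** g) = (if m = - v x then fm \<eta> 1 g else 0)" for m
        unfolding F_tm unfolding F_def x_def[symmetric] using True by simp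
      then show ?thesis using that by (simp add: abs_le_iff)
    qed
    then show ?thesis by blast
  next
    case False
    then have "F \<theta> g = 0" for \<theta> by (auto simp: F_def)
    then show ?thesis unfolding F_tm by simp
  qed
qed

text \<open>The linear combination of translates that gives x is applied to \<open>wv\<close>
  instead: the second component is the same, and summing over all m recovers the first.\<close>

lemma lift_to_Dw:
  assumes "x \<in> pr.span ((\<lambda>g. act2 g (fm \<eta> 1, hecke_U y)) ` GL2)"
  shows "\<exists>f. (f, snd x) \<in> Dw \<and> (\<forall>g. \<exists>N. \<forall>M\<ge>N. (\<Sum>m\<in>{-M..M}. f (tm m ** g)) = fst x g)"
  using assms
proof (induction rule: pr.span_induct_alt)
  case base
  have "(0, 0) \<in> Dw" using pr.subspace_0[OF pr.stableD(1)[OF Dw_stable]] by (simp add: zero_prod_def)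
  then have "(0, snd 0) \<in> Dw" by (simp only: snd_zero)
  then show ?case
  proof (intro exI conjI)
    show "\<forall>g. \<exists>N. \<forall>M\<ge>N. (\<Sum>m\<in>{-M..M}. 0 (tm m ** g)) = (fst 0 g :: 'k)" by simp
  qed
next
  case (step c x z)
  obtain h where h: "h \<in> GL2" "x = act2 h (fm \<eta> 1, hecke_U y)" using step.hyps by blast
  obtain f where f: "(f, snd z) \<in> Dw" "\<And>g. \<exists>N. \<forall>M\<ge>N. (\<Sum>m\<in>{-M..M}. f (tm m ** g)) = fst z g"
    using step.IH by blast
  define f' where "f' = fun_scale c (ind_act h (f0 \<eta>)) + f"
  have "act2 h wv \<in> Dw" unfolding Dw_def using h by (intro pr.span_base) blast
  then have "scale2 c (act2 h wv) + (f, snd z) \<in> Dw"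
    using f(1) pr.stableD(1)[OF Dw_stable] by (intro pr.subspace_add pr.subspace_scale)
  moreover have "scale2 c (act2 h wv) + (f, snd z) = (f', snd (scale2 c x + z))"
    by (rule prod_eqI) (simp_all add: f'_def wv_def h(2))
  moreover have "\<exists>N. \<forall>M\<ge>N. (\<Sum>m\<in>{-M..M}. f' (tm m ** g)) = fst (scale2 c x + z) g" for g
  proof -
    obtain N where N: "\<forall>M\<ge>N. (\<Sum>m\<in>{-M..M}. f (tm m ** g)) = fst z g" using f(2) by blast
    obtain N' where N': "\<forall>M\<ge>N'. (\<Sum>m\<in>{-M..M}. f0 \<eta> (tm m ** (g ** h))) = fm \<eta> 1 (g ** h)" using f0_sum by blast
    have "(\<Sum>m\<in>{-M..M}. f' (tm m ** g)) = fst (scale2 c x + z) g" if "M \<ge> max N N'" for M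
    proof -
      have "(\<Sum>m\<in>{-M..M}. f' (tm m ** g))
        = c * (\<Sum>m\<in>{-M..M}. f0 \<eta> (tm m ** (g ** h))) + (\<Sum>m\<in>{-M..M}. f (tm m ** g))"
        by (simp add: f'_def fun_scale_apply ind_act_def sum.distrib sum_distrib_left matrix_mul_assoc)
      then show ?thesis using N N' that by (simp add: h(2) fun_scale_apply ind_act_def)
    qed
    then show ?thesis by blast
  qed
  ultimately show ?case by (intro exI[of _ f']) simp
qed

text \<open>\<open>contains_second_factor\<close> puts (0, U y) into the specialized span. Its lift
  f specializes to 0 while \<open>f0\<close> does not, so f and \<open>f0\<close> are different
  functions with the same partner in \<open>Dw\<close>.\<close>

lemma Dw_kernel_nonzero:
  assumes "hecke_U y \<noteq> 0"
  shows "\<exists>f. f \<noteq> 0 \<and> (f, 0) \<in> Dw"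
proof -
  let ?D = "pr.span ((\<lambda>g. act2 g (fm \<eta> 1, hecke_U y)) ` GL2)"
  have "(fm \<eta> 1, hecke_U y) \<in> ?D"
    by (rule pr.span_base) (auto intro!: image_eqI[of _ _ "mat 1"])
  then have "(0, hecke_U y) \<in> ?D"
    using assms by (intro contains_second_factor[OF pr.span_orbit_stable_GL2 chim_smooth[OF \<eta>, of 1] span_fm_Ind[OF \<eta>]]) auto
  then obtain f where f: "(f, hecke_U y) \<in> Dw" "\<And>g. \<exists>N. \<forall>M\<ge>N. (\<Sum>m\<in>{-M..M}. f (tm m ** g)) = 0"
    using lift_to_Dw by fastforce
  have "wv \<in> Dw" unfolding Dw_def by (rule pr.span_base) (auto intro!: image_eqI[of _ _ "mat 1"])
  then have "wv - (f, hecke_U y) \<in> Dw" using f(1) pr.stableD(1)[OF Dw_stable] by (intro pr.subspace_diff)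
  then have "(f0 \<eta> - f, 0) \<in> Dw" by (simp add: wv_def)
  moreover have "f0 \<eta> - f \<noteq> 0"
  proof
    assume "f0 \<eta> - f = 0"
    then have "f = f0 \<eta>" by simp
    then obtain N where N: "\<forall>M\<ge>N. (\<Sum>m\<in>{-M..M}. f0 \<eta> (tm m ** swp)) = 0" using f(2) by blast
    obtain N' where N': "\<forall>M\<ge>N'. (\<Sum>m\<in>{-M..M}. f0 \<eta> (tm m ** swp)) = fm \<eta> 1 swp" using f0_sum by blast
    have "fm \<eta> 1 swp = 0" using N[rule_format, of "max N N'"] N'[rule_format, of "max N N'"] by simp
    moreover have "fm \<eta> 1 swp = 1" by (simp add: swp_def F_mk thetam_def cchar_1[OF \<omega>] ichar_1[OF \<eta>])
    ultimately show False by simp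
  qed
  ultimately show ?thesis by blast
qed

lemma fst_Dw_Univ: "x \<in> Dw \<Longrightarrow> fst x \<in> Univ"
proof -
  assume "x \<in> Dw"
  then have "fst x \<in> fn.span ((\<lambda>g. fst (act2 g wv)) ` GL2)" unfolding Dw_def by (rule fst_span2)
  also have "\<dots> \<subseteq> Univ"
    using fn.stableD[OF Univ_stable] f0_Univ by (intro fn.span_minimal) (auto simp: wv_def)
  finally show ?thesis .
qed

text \<open>R is the kernel of the map with graph \<open>Dw\<close>. It is G-stable with a nonzero
  smooth vector, so it contains an Iwahori eigenvector and hence some Q(U) \<open>f0\<close>, whose
  image under the map is Q(U) U y.\<close>

lemma polynomial_relation:
  assumes "hecke_U y \<noteq> 0"
  shows "\<exists>Q. Q \<noteq> 0 \<and> pact hecke_U Q (hecke_U y) = 0"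
proof -
  define R where "R = {f. (f, 0) \<in> Dw}"
  note Ds = pr.stableD(1)[OF Dw_stable] and Da = pr.stableD(2)[OF Dw_stable]
  have R: "fn.stable GL2 R"
    unfolding fn.stable_def fn.subspace_def
  proof (intro conjI ballI allI)
    show "0 \<in> R" using pr.subspace_0[OF Ds] by (simp add: R_def zero_prod_def)
    show "a + b \<in> R" if "a \<in> R" "b \<in> R" for a b
      using pr.subspace_add[OF Ds, of "(a, 0)" "(b, 0)"] that by (simp add: R_def)
    show "fun_scale c a \<in> R" if "a \<in> R" for c a
      using pr.subspace_scale[OF Ds, of "(a, 0)" c] that by (simp add: R_def scale2_def)
    show "ind_act g a \<in> R" if "g \<in> GL2" "a \<in> R" for g a
      using Da[of g "(a, 0)"] that by (simp add: R_def act2_def)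
  qed
  have RU: "R \<subseteq> Univ" using fst_Dw_Univ by (auto simp: R_def)
  obtain f where f: "f \<noteq> 0" "f \<in> R" using Dw_kernel_nonzero[OF assms] by (auto simp: R_def)
  have "pr.Ieig \<omega> \<eta> wv" using f0_eig Ieig_U[OF \<omega> \<eta> y] by (simp add: pr_Ieig wv_def)
  then have "pr.smooth_vec wv" by (rule pr.Ieig_smooth[OF \<omega> \<eta>])
  then have "pr.smooth_vec (f, 0)"
    by (rule pr.span_orbit_smooth) (use f(2) in \<open>simp add: R_def Dw_def\<close>)
  then obtain n where "\<forall>k\<in>Kn n. act2 k (f, 0) = (f, 0)" by (auto simp: pr.smooth_vec_def)
  then have fx: "\<forall>k\<in>Kn n. ind_act k f = f" by (simp add: act2_def)
  have RI: "fn.stable Iw R" using R by (rule fn.stable_mono) (auto simp: Iw_GL2)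
  have cen: "ind_act (mat z) g = fun_scale (\<omega> z) g" if "z \<noteq> 0" "g \<in> R" for z g
  proof
    fix h :: "'f^2^2"
    have "h ** mat z = mk z 0 0 z ** h" by (cases h rule: mk_cases) (simp add: mat_mk mult.commute)
    then show "ind_act (mat z) g h = fun_scale (\<omega> z) g h"
      using UnivD(1)[of g z z 0 h] that RU by (auto simp: ind_act_def fun_scale_def ichar_1[OF \<eta>])
  qed
  obtain f1 where f1: "f1 \<in> R" "f1 \<noteq> 0" "\<forall>k\<in>Iw1. ind_act k f1 = f1"
    using fn.pro_p_fixed[OF RI f(2,1) fx] by blast
  obtain f2 \<eta>' where f2: "f2 \<in> R" "f2 \<noteq> 0" "ichar \<eta>'" "fn.Ieig \<omega> \<eta>' f2"
    using fn.Iw_eigen[OF RI f1 \<omega> cen] by blast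
  obtain Q where Q: "Q \<noteq> 0" "fn.pact fn.hecke_U Q (f0 \<eta>) \<in> R"
    using polynomial_in_stable[OF R RU f2] by blast
  have DB: "pr.stable Borel Dw" using Dw_stable by (rule pr.stable_mono) (auto simp: Borel_GL2)
  have "wv \<in> Dw" unfolding Dw_def by (rule pr.span_base) (auto intro!: image_eqI[of _ _ "mat 1"])
  then have "pr.pact pr.hecke_U Q wv \<in> Dw"
    using pr.hecke_U_mem[OF DB] by (intro pr.pact_mem[OF Ds])
  \<comment> \<open>Both pairs lie in \<open>Dw\<close> and have first component Q(U)
    \<open>f0\<close>; in a graph their second components must agree.\<close>
  then have "pr.pact pr.hecke_U Q wv - (fn.pact fn.hecke_U Q (f0 \<eta>), 0) \<in> Dw"
    using Q(2) pr.subspace_diff[OF Ds] by (simp add: R_def)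
  then have "pr.pact pr.hecke_U Q wv - (fn.pact fn.hecke_U Q (f0 \<eta>), 0) = 0"
    by (rule Dw_graph) (simp add: pr_pact wv_def)
  then have "pact hecke_U Q (hecke_U y) = 0" by (simp add: pr_pact wv_def prod_eq_iff)
  then show ?thesis using Q(1) by blast
qed

lemma U_eigenvector:
  assumes W: "stable Borel W" "y \<in> W" "y \<noteq> 0"
  shows "\<exists>\<kappa> z. z \<in> W \<and> z \<noteq> 0 \<and> Ieig \<omega> \<eta> z \<and> hecke_U z = scale \<kappa> z"
proof (cases "hecke_U y = 0")
  case True
  then show ?thesis using W y by (intro exI[of _ 0] exI[of _ y]) simp
next
  case False
  obtain Q where "Q \<noteq> 0" "pact hecke_U Q (hecke_U y) = 0" using polynomial_relation[OF False] by blast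
  moreover have "subspace (W \<inter> {z. Ieig \<omega> \<eta> z})"
    by (rule subspace_inter[OF stableD(1)[OF W(1)] Ieig_subspace])
  ultimately have "\<exists>\<kappa> z. z \<in> W \<inter> {z. Ieig \<omega> \<eta> z} \<and> z \<noteq> 0 \<and> hecke_U z = scale \<kappa> z"
    using W hecke_U_mem[OF W(1)] Ieig_U[OF \<omega> \<eta>] y False
    by (intro eigen_poly[OF hecke_U_lin, of _ "hecke_U y" Q]) auto
  then show ?thesis by blast
qed

text \<open>An eigenvector of U with nonzero eigenvalue determines a map from a submodule of Ind to pi: pieces of a function
  can be cut into small balls, where linear relations are visible from the supports.\<close>

context
  fixes \<kappa> :: 'k
  assumes \<kappa>: "\<kappa> \<noteq> 0" and Uy: "hecke_U y = scale \<kappa> y"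
begin

text \<open>By \<open>fm_U\<close> the parameter for which \<open>fm\<close> has the same
  U-eigenvalue \<kappa> as y.\<close>

definition mu :: 'k where "mu = \<omega> pi / \<kappa>"
definition ev :: "('f^2^2 \<Rightarrow> 'k) \<times> 'v" where "ev = (fm \<eta> mu, y)"

lemma mu_nz: "mu \<noteq> 0"
  using \<kappa> om_pi by (simp add: mu_def)

lemma ev_eig: "pr.Ieig \<omega> \<eta> ev"
  using F_Iw[OF \<eta> twist_thetam[OF \<eta> mu_nz]] y by (simp add: pr_Ieig ev_def)

lemma ev_U: "pr.hecke_U ev = scale2 \<kappa> ev"
  using fm_U[OF \<eta> mu_nz] Uy om_pi by (simp add: pr_hecke_U ev_def scale2_def mu_def)

lemma ev_central:
  assumes "z \<noteq> 0" "h \<in> GL2" shows "act2 (mat z ** h) ev = scale2 (\<omega> z) (act2 h ev)"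
proof -
  have "mat z ** h = h ** mat z" by (cases h rule: mk_cases) (simp add: mat_mk mult.commute)
  moreover have "act2 (mat z) ev = scale2 (\<omega> z) ev"
    using F_central[OF assms(1)] central[OF assms(1)] by (intro prod_eqI) (simp_all add: ev_def)
  ultimately show ?thesis using assms by (simp add: pr.act_mult pr.act_scale mat_mk)
qed

lemma ev_diag: "unit u \<Longrightarrow> unit w \<Longrightarrow> \<exists>c. act2 (mk u 0 0 w) ev = scale2 c ev"
  using pr.IeigD[OF ev_eig, of u 0 0 w] by auto

section \<open>Cutting the orbit of an eigenpair into small balls\<close>

definition Bw :: "(('f^2^2 \<Rightarrow> 'k) \<times> 'v) set" where "Bw = pr.span ((\<lambda>g. act2 g ev) ` Borel)"

lemma Bw_stable: "pr.stable Borel Bw"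
  unfolding Bw_def
proof (rule pr.span_orbit_stable)
  show "g ** h \<in> Borel" if "g \<in> Borel" "h \<in> Borel" for g h :: "'f^2^2"
    using that by (elim Borel_cases) auto
qed (auto simp: Borel_GL2)

text \<open>Its first component lives over the ball of points with c/d in \<open>V M\<close>. The
  balls shrink with growing M towards the point c = 0, at which the first components of
  \<open>Bw\<close> vanish.\<close>

definition Sw :: "int \<Rightarrow> ('f^2^2 \<Rightarrow> 'k) \<times> 'v" where "Sw M = act2 (tm (- M) ** swp) ev"

text \<open>\<open>swp_U\<close>, applied with the eigenvalue \<kappa>: the ball around c = 0 is a
  smaller such ball together with pieces that belong to \<open>Bw\<close>.\<close>

lemma Sw_step: "Sw M - scale2 (\<omega> pi / \<kappa>) (Sw (M + 1)) \<in> Bw"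
proof -
  have ev: "ev \<in> Bw" unfolding Bw_def by (rule pr.span_base) (auto intro!: image_eqI[of _ _ "mat 1"])
  have "act2 (tm (- M)) (act2 swp (pr.hecke_U ev)) = act2 (tm (- M)) (act2 Pi ev)
      + act2 (tm (- M)) (\<Sum>l\<in>L - {0}. act2 (mk (- pi / l) 1 0 l) ev)"
    by (simp add: pr.swp_U[OF \<omega> \<eta> ev_eig] pr.act_add)
  moreover have "act2 (tm (- M)) (act2 swp (pr.hecke_U ev)) = scale2 \<kappa> (Sw M)"
    by (simp add: ev_U pr.act_scale Sw_def pr.act_mult)
  moreover have "act2 (tm (- M)) (act2 Pi ev) = scale2 (\<omega> pi) (Sw (M + 1))"
  proof -
    have "tm (- M) ** Pi = mat pi ** (tm (- (M + 1)) ** swp)"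
      by (simp add: tm_def Pi_def swp_def mat_mk power_int_diff)
    then show ?thesis by (simp add: Sw_def ev_central flip: pr.act_mult)
  qed
  moreover have "act2 (tm (- M)) (\<Sum>l\<in>L - {0}. act2 (mk (- pi / l) 1 0 l) ev) \<in> Bw"
    using Bw_stable ev by (intro pr.stableD(2)[OF Bw_stable] pr.subspace_sum[OF pr.stableD(1)[OF Bw_stable]]) auto
  ultimately have "scale2 \<kappa> (Sw M) - scale2 (\<omega> pi) (Sw (M + 1)) \<in> Bw" by simp
  then have "scale2 (inverse \<kappa>) (scale2 \<kappa> (Sw M) - scale2 (\<omega> pi) (Sw (M + 1))) \<in> Bw"
    by (rule pr.subspace_scale[OF pr.stableD(1)[OF Bw_stable]])
  then show ?thesis using \<kappa> by (simp add: pr.scale_right_diff_distrib divide_inverse mult.commute)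
qed

lemma Sw_steps: "\<exists>c. Sw M - scale2 c (Sw (M + int j)) \<in> Bw"
proof (induction j)
  case 0
  then show ?case using pr.subspace_0[OF pr.stableD(1)[OF Bw_stable]] by (intro exI[of _ 1]) simp
next
  case (Suc j)
  then obtain c where c: "Sw M - scale2 c (Sw (M + int j)) \<in> Bw" by blast
  have "scale2 c (Sw (M + int j) - scale2 (\<omega> pi / \<kappa>) (Sw (M + int j + 1))) \<in> Bw"
    by (rule pr.subspace_scale[OF pr.stableD(1)[OF Bw_stable] Sw_step])
  from pr.subspace_add[OF pr.stableD(1)[OF Bw_stable] c this]
  have "Sw M - scale2 (c * (\<omega> pi / \<kappa>)) (Sw (M + int (Suc j))) \<in> Bw"
    by (simp add: pr.scale_right_diff_distrib add_ac)
  then show ?case by blast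
qed

text \<open>The condition is asked for at all large M, so that two vectors can be compared with the
  same \<open>Sw M\<close>.\<close>

definition Xw :: "(('f^2^2 \<Rightarrow> 'k) \<times> 'v) set" where
  "Xw = {x. \<exists>N. \<forall>M\<ge>N. \<exists>c. x - scale2 c (Sw M) \<in> Bw}"

lemma Xw_subspace: "pr.subspace Xw"
  unfolding pr.subspace_def Xw_def
proof (intro conjI ballI allI CollectI)
  note sub = pr.stableD(1)[OF Bw_stable]
  show "\<exists>N. \<forall>M\<ge>N. \<exists>c. 0 - scale2 c (Sw M) \<in> Bw"
    using pr.subspace_0[OF sub] by (intro exI[of _ 0] allI impI) simp
  fix x assume "x \<in> {x. \<exists>N. \<forall>M\<ge>N. \<exists>c. x - scale2 c (Sw M) \<in> Bw}"
  then obtain N where N: "\<forall>M\<ge>N. \<exists>c. x - scale2 c (Sw M) \<in> Bw" by blast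
  show "\<exists>N. \<forall>M\<ge>N. \<exists>c. scale2 k x - scale2 c (Sw M) \<in> Bw" for k
  proof (intro exI[of _ N] allI impI)
    fix M assume "N \<le> M"
    then obtain c where "x - scale2 c (Sw M) \<in> Bw" using N by blast
    from pr.subspace_scale[OF sub this, of k]
    have "scale2 k x - scale2 (k * c) (Sw M) \<in> Bw" by (simp add: pr.scale_right_diff_distrib)
    then show "\<exists>c. scale2 k x - scale2 c (Sw M) \<in> Bw" by blast
  qed
  fix z assume "z \<in> {x. \<exists>N. \<forall>M\<ge>N. \<exists>c. x - scale2 c (Sw M) \<in> Bw}"
  then obtain N' where N': "\<forall>M\<ge>N'. \<exists>c. z - scale2 c (Sw M) \<in> Bw" by blast
  show "\<exists>N. \<forall>M\<ge>N. \<exists>c. x + z - scale2 c (Sw M) \<in> Bw"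
  proof (intro exI[of _ "max N N'"] allI impI)
    fix M assume "max N N' \<le> M"
    then obtain c c' where "x - scale2 c (Sw M) \<in> Bw" "z - scale2 c' (Sw M) \<in> Bw" using N N' by (metis max.bounded_iff)
    from pr.subspace_add[OF sub this]
    have "x + z - scale2 (c + c') (Sw M) \<in> Bw" by (simp add: pr.scale_left_distrib algebra_simps)
    then show "\<exists>c. x + z - scale2 c (Sw M) \<in> Bw" by blast
  qed
qed

lemma Borel_split:
  assumes "b \<in> Borel"
  obtains z a n u where "z \<noteq> 0" "unit u" "b = mat z ** (uni a ** tm n ** mk u 0 0 1)"
  using Borel_decomp[OF assms] by (metis matrix_mul_assoc)

lemma orbit_Xw:
  assumes "g \<in> GL2" shows "act2 g ev \<in> Xw"
  using GL2_decomp[OF assms]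
proof (elim disjE bexE)
  fix b x assume b: "b \<in> Borel" "x \<in> V 1" "g = b ** low x"
  then have "act2 g ev = act2 b ev" by (simp add: pr.act_mult Borel_GL2 pr.Ieig_low[OF \<omega> \<eta> ev_eig])
  then have "act2 g ev \<in> Bw" unfolding Bw_def using b(1) by (auto intro: pr.span_base)
  then show ?thesis by (auto simp: Xw_def intro!: exI[of _ 0])
next
  fix b x assume b: "b \<in> Borel" "x \<in> V 0" "g = b ** swp ** uni x"
  obtain z a n u where zz: "z \<noteq> 0" "unit u" "b = mat z ** (uni a ** tm n ** mk u 0 0 1)"
    using Borel_split[OF b(1)] .
  obtain c where c: "act2 (mk 1 0 0 u) ev = scale2 c ev" using ev_diag[of 1 u] zz(2) by auto
  have u0: "u \<noteq> 0" using zz(2) by (rule unit_nz)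
  have "act2 g ev = act2 (b ** swp) ev"
    using b by (simp add: pr.act_mult Borel_GL2 pr.Ieig_uni[OF \<omega> \<eta> ev_eig])
  also have "b ** swp = mat z ** (uni a ** tm n ** swp ** mk 1 0 0 u)"
    by (simp add: zz(3) swp_def uni_def tm_def mat_mk)
  also have "act2 \<dots> ev = scale2 (\<omega> z) (act2 (uni a ** tm n ** swp ** mk 1 0 0 u) ev)"
    using zz(1) u0 by (intro ev_central) simp_all
  also have "act2 (uni a ** tm n ** swp ** mk 1 0 0 u) ev = scale2 c (act2 (uni a ** tm n ** swp) ev)"
    using u0 by (simp add: pr.act_mult c pr.act_scale)
  finally have gX: "act2 g ev = scale2 (\<omega> z * c) (act2 (uni a ** tm n ** swp) ev)" by simp
  obtain M0 where M0: "M0 \<ge> 0" "a \<in> V (- M0)" using V_exists by blast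
  have "act2 (uni a ** tm n ** swp) ev \<in> Xw"
    unfolding Xw_def
  \<comment> \<open>\<open>M0 + 1\<close> puts pi^M a into the maximal ideal, so that a lower
    unipotent factor fixes \<open>ev\<close>; \<open>- n\<close> makes the number M + n of steps
    nonnegative.\<close>
  proof (intro CollectI exI[of _ "max (M0 + 1) (- n)"] allI impI)
    fix M assume M: "max (M0 + 1) (- n) \<le> M"
    define j where "j = nat (M + n)"
    have jM: "0 + int j = M + n" using M by (simp add: j_def)
    obtain c' where c': "Sw 0 - scale2 c' (Sw (0 + int j)) \<in> Bw" using Sw_steps by blast
    have "act2 (uni a ** tm n) (Sw 0 - scale2 c' (Sw (0 + int j))) \<in> Bw"
      by (rule pr.stableD(2)[OF Bw_stable _ c']) (simp add: uni_def tm_def)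
    moreover have "act2 (uni a ** tm n) (Sw 0) = act2 (uni a ** tm n ** swp) ev"
      by (simp add: Sw_def tm_0 pr.act_mult)
    moreover have "act2 (uni a ** tm n) (Sw (0 + int j)) = Sw M"
    proof -
      have "pi powi M * a \<in> V 1" using M M0 V_mono[OF M0(2), of "1 - M"] by (simp add: V_powi_mult)
      then have fixd: "act2 (low (pi powi M * a)) ev = ev" by (rule pr.Ieig_low[OF \<omega> \<eta> ev_eig])
      have "uni a ** tm n ** (tm (- (0 + int j)) ** swp) = tm (- M) ** swp ** low (pi powi M * a)"
        unfolding jM by (simp add: uni_def tm_def swp_def low_def power_int_minus power_int_add power_int_diff field_simps)
      then have "act2 (uni a ** tm n) (Sw (0 + int j)) = act2 (tm (- M) ** swp) (act2 (low (pi powi M * a)) ev)"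
        by (simp add: Sw_def flip: pr.act_mult)
      then show ?thesis by (simp add: fixd Sw_def)
    qed
    ultimately have "act2 (uni a ** tm n ** swp) ev - scale2 c' (Sw M) \<in> Bw"
      by (simp add: pr.lin_diff[OF pr.act_lin] pr.act_scale)
    then show "\<exists>c. act2 (uni a ** tm n ** swp) ev - scale2 c (Sw M) \<in> Bw" by blast
  qed
  then show ?thesis unfolding gX by (rule pr.subspace_scale[OF Xw_subspace])
qed

text \<open>Only one level n is allowed: for normalized a the first components of the generators
  live over the pairwise disjoint balls -a + \<open>V n\<close>.\<close>

definition Tw :: "int \<Rightarrow> (('f^2^2 \<Rightarrow> 'k) \<times> 'v) set" where
  "Tw n = pr.span ((\<lambda>a. act2 (uni a ** tm n) ev) ` {a. rep n a = a})"

lemma Tw_mem: "act2 (uni a ** tm n) ev \<in> Tw n"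
proof -
  have x: "(a - rep n a) / pi powi n \<in> V 0"
    using rep_diff[of n a] by (simp add: V_div_powi V_diff_commute)
  have "uni a ** tm n = uni (rep n a) ** tm n ** uni ((a - rep n a) / pi powi n)"
    by (simp add: uni_def tm_def)
  then have "act2 (uni a ** tm n) ev = act2 (uni (rep n a) ** tm n) ev"
    by (simp add: pr.act_mult pr.Ieig_uni[OF \<omega> \<eta> ev_eig x])
  then show ?thesis unfolding Tw_def by (auto intro!: pr.span_base)
qed

text \<open>\<kappa> \<open>ev\<close> = U \<open>ev\<close> cuts a ball of level n into q balls of
  level n + 1, and \<kappa> \<noteq> 0 can be divided out.\<close>

lemma Tw_Suc: "Tw n \<subseteq> Tw (n + 1)"
  unfolding Tw_def[of n]
proof (rule pr.span_minimal)
  show sub: "pr.subspace (Tw (n + 1))" unfolding Tw_def by (rule pr.subspace_span)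
  show "(\<lambda>a. act2 (uni a ** tm n) ev) ` {a. rep n a = a} \<subseteq> Tw (n + 1)"
  proof (rule image_subsetI)
    fix a
    have "scale2 \<kappa> (act2 (uni a ** tm n) ev) = act2 (uni a ** tm n) (pr.hecke_U ev)"
      by (simp add: ev_U pr.act_scale)
    also have "\<dots> = (\<Sum>l\<in>L. act2 (uni (a + pi powi n * l) ** tm (n + 1)) ev)"
    proof -
      have "uni a ** tm n ** (uni l ** tm 1) = uni (a + pi powi n * l) ** tm (n + 1)" for l
        by (simp add: uni_def tm_def power_int_add add.commute)
      then show ?thesis by (simp add: pr.hecke_U_def pr.act_sum flip: pr.act_mult)
    qed
    also have "\<dots> \<in> Tw (n + 1)" by (intro pr.subspace_sum[OF sub] Tw_mem)
    finally have "scale2 (inverse \<kappa>) (scale2 \<kappa> (act2 (uni a ** tm n) ev)) \<in> Tw (n + 1)"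
      by (rule pr.subspace_scale[OF sub])
    then show "act2 (uni a ** tm n) ev \<in> Tw (n + 1)" using \<kappa> by simp
  qed
qed

lemma Tw_mono: "n \<le> m \<Longrightarrow> Tw n \<subseteq> Tw m"
proof (induction m rule: int_ge_induct)
  case (step i)
  then show ?case using Tw_Suc by blast
qed simp

lemma Bw_Tw: "x \<in> Bw \<Longrightarrow> \<exists>n. x \<in> Tw n"
  unfolding Bw_def
proof (induction rule: pr.span_induct_alt)
  case base
  then show ?case unfolding Tw_def using pr.span_zero by blast
next
  case (step c x z)
  obtain b where b: "b \<in> Borel" "x = act2 b ev" using step.hyps by blast
  obtain \<zeta> a n u where zz: "\<zeta> \<noteq> 0" "unit u" "b = mat \<zeta> ** (uni a ** tm n ** mk u 0 0 1)"
    using Borel_split[OF b(1)] .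
  obtain c' where c': "act2 (mk u 0 0 1) ev = scale2 c' ev" using ev_diag[of u 1] zz(2) by auto
  have u0: "u \<noteq> 0" using zz(2) by (rule unit_nz)
  have "x = scale2 (\<omega> \<zeta>) (act2 (uni a ** tm n ** mk u 0 0 1) ev)"
    unfolding b(2) zz(3) using zz(1) u0 by (intro ev_central) simp_all
  also have "act2 (uni a ** tm n ** mk u 0 0 1) ev = scale2 c' (act2 (uni a ** tm n) ev)"
    using u0 by (simp add: pr.act_mult c' pr.act_scale)
  finally have "x \<in> Tw n" using Tw_mem[of a n] unfolding Tw_def by (simp add: pr.span_scale)
  moreover obtain m where "z \<in> Tw m" using step.IH by blast
  ultimately have "x \<in> Tw (max n m)" "z \<in> Tw (max n m)"
    using Tw_mono[of n "max n m"] Tw_mono[of m "max n m"] by auto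
  then have "scale2 c x + z \<in> Tw (max n m)" unfolding Tw_def by (intro pr.span_add pr.span_scale)
  then show ?case by blast
qed

text \<open>Because the supports are disjoint, evaluation at \<open>swp ** uni (- a)\<close> reads
  off the coefficient of the generator for a.\<close>

lemma Tw_graph:
  assumes "x \<in> Tw n" "fst x = 0" shows "x = 0"
proof -
  obtain A c where A: "finite A" "A \<subseteq> {a. rep n a = a}" "x = (\<Sum>a\<in>A. scale2 (c a) (act2 (uni a ** tm n) ev))"
    using pr.span_image_explicit[OF assms(1)[unfolded Tw_def]] by blast
  define C where "C = \<omega> (pi powi n) * thetam \<eta> mu (pi powi n / (pi powi n)^2)"
  have C: "C \<noteq> 0"
    unfolding C_def using cchar_nz[OF \<omega>] thetam_nz[OF \<eta> mu_nz] by simp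
  have val: "fst (act2 (uni a ** tm n) ev) (swp ** uni b) = (if b + a \<in> V n then C else 0)" for a b
  proof -
    have "swp ** uni b ** (uni a ** tm n) = mk 0 1 (pi powi n) (b + a)"
      by (simp add: swp_def uni_def tm_def add.commute)
    moreover have "(b + a) / pi powi n \<in> V 0 \<longleftrightarrow> b + a \<in> V n" by (simp add: V_div_powi)
    ultimately show ?thesis by (simp add: ev_def ind_act_def F_mk C_def)
  qed
  have "c a = 0" if a: "a \<in> A" for a
  proof -
    have "0 = fst x (swp ** uni (- a))" using assms(2) by simp
    also have "\<dots> = (\<Sum>b\<in>A. c b * fst (act2 (uni b ** tm n) ev) (swp ** uni (- a)))"
      unfolding A(3) by (simp add: fst_sum2 sum_fun_apply fun_scale_apply)
    also have "\<dots> = (\<Sum>b\<in>A. if b = a then c b * C else 0)"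
    proof (rule sum.cong[OF refl])
      fix b assume b: "b \<in> A"
      have "- a + b \<in> V n \<longleftrightarrow> rep n b = rep n a" by (simp add: rep_eq_iff)
      also have "rep n b = b" using A(2) b by blast
      also have "rep n a = a" using A(2) a by blast
      finally show "c b * fst (act2 (uni b ** tm n) ev) (swp ** uni (- a)) = (if b = a then c b * C else 0)"
        unfolding val by simp
    qed
    finally show ?thesis using A(1) a C by simp
  qed
  then show ?thesis by (simp add: A(3))
qed

text \<open>The value at the identity detects only the \<open>Sw M\<close> part, which must
  therefore vanish; the rest lies in \<open>Bw\<close> and can be brought to a single level.\<close>

lemma orbit_graph:
  assumes "x \<in> pr.span ((\<lambda>g. act2 g ev) ` GL2)" "fst x = 0" shows "x = 0"
proof -
  have "pr.span ((\<lambda>g. act2 g ev) ` GL2) \<subseteq> Xw"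
    using orbit_Xw by (intro pr.span_minimal Xw_subspace) auto
  then have "x \<in> Xw" using assms(1) by blast
  then obtain M c where c: "x - scale2 c (Sw M) \<in> Bw" unfolding Xw_def by blast
  have B1: "fst z (mat 1) = 0" if "z \<in> Bw" for z
    using that unfolding Bw_def
  proof (induction rule: pr.span_induct_alt)
    case (step k z w)
    then obtain b where "b \<in> Borel" "z = act2 b ev" by blast
    then show ?case using step.IH by (auto elim!: Borel_cases simp: ev_def ind_act_def fun_scale_def F_mk)
  qed simp
  have "fst (Sw M) (mat 1) = thetam \<eta> mu (pi powi (- M))"
    by (simp add: Sw_def ev_def ind_act_def tm_def swp_def F_mk cchar_1[OF \<omega>])
  then have "fst (Sw M) (mat 1) \<noteq> 0" using thetam_nz[OF \<eta> mu_nz] by simp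
  moreover have "c * fst (Sw M) (mat 1) = 0"
    using B1[OF c] assms(2) by (simp add: fun_scale_apply)
  ultimately have "c = 0" by simp
  then have "x \<in> Bw" using c by simp
  then show ?thesis using Bw_Tw Tw_graph assms(2) by blast
qed

lemma eigenvalue_contradiction: "y = 0"
proof (rule ccontr)
  assume "y \<noteq> 0"
  let ?D = "pr.span ((\<lambda>g. act2 g (fm \<eta> mu, y)) ` GL2)"
  have "(fm \<eta> mu, y) \<in> ?D"
    by (rule pr.span_base) (auto intro!: image_eqI[of _ _ "mat 1"])
  then have "(0, y) \<in> ?D"
    using \<open>y \<noteq> 0\<close> mu_nz
    by (intro contains_second_factor[OF pr.span_orbit_stable_GL2 chim_smooth[OF \<eta> mu_nz] span_fm_Ind[OF \<eta> mu_nz]]) auto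
  then have "(0, y) = (0 :: ('f^2^2 \<Rightarrow> 'k) \<times> 'v)" by (intro orbit_graph) (auto simp: ev_def)
  then show False using \<open>y \<noteq> 0\<close> by (simp add: zero_prod_def)
qed

end

end

section \<open>Irreducibility over the Borel subgroup\<close>

context supersingular_rep
begin

lemma Borel_irreducible:
  assumes W: "stable Borel W" and "W \<noteq> {0}"
  shows "W = UNIV"
proof -
  note Ws = stableD(1)[OF W] and Wa = stableD(2)[OF W]
  obtain w where w: "w \<in> W" "w \<noteq> 0" using \<open>W \<noteq> {0}\<close> subspace_0[OF Ws] by blast
  obtain n where n: "n \<ge> 1" "\<forall>k\<in>Kn n. act k w = w" using smooth[of w] by (auto simp: smooth_vec_def)
  \<comment> \<open>Moving a lower unipotent matrix past \<open>tm n\<close> multiplies its entry by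
    pi^n, so n^-(m) fixes w'. This supplies the part of the Iwahori action that stability under B
    does not control.\<close>
  define w' where "w' = act (tm n) w"
  have w'W: "w' \<in> W" "w' \<noteq> 0" using w Wa by (simp_all add: w'_def)
  \<comment> \<open>\<open>pro_p_fixed\<close> needs an Iwahori-stable space, and \<open>Y\<close>
    is the largest one inside W. It contains w' because the Iwahori subgroup is its upper triangular
    part times n^-(m).\<close>
  define Y where "Y = {z \<in> W. \<forall>i\<in>Iw. act i z \<in> W}"
  have "stable Iw Y"
    unfolding stable_def subspace_def Y_def using Ws
    by (auto simp: subspace_0 act_add act_scale Iw_GL2 subspace_add subspace_scale Iw_mult simp flip: act_mult)
  have low: "act (low x) w' = w'" if "x \<in> V 1" for x
  proof -
    have "pi powi n * x \<in> V n" using V_mono[OF that, of 0] by (simp add: V_powi_mult)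
    then have "low (pi powi n * x) \<in> Kn n" by (simp add: low_def)
    moreover have "act (low x) w' = act (tm n) (act (low (pi powi n * x)) w)"
      by (simp add: w'_def low_tm flip: act_mult)
    ultimately show ?thesis using n by (simp add: w'_def)
  qed
  have w'Y: "w' \<in> Y"
    unfolding Y_def
  proof (intro CollectI conjI ballI w'W)
    fix i assume i: "i \<in> Iw"
    obtain a b c d where ii: "i = mk a b c d" by (rule mk_cases)
    have d: "d \<noteq> 0" "unit d" using i by (auto simp: ii unit_nz)
    have det: "a * d - b * c \<noteq> 0" using Iw_GL2[OF i] by (simp add: ii)
    have b: "mk ((a * d - b * c) / d) b 0 d \<in> Borel" using d det by simp
    have "i = mk ((a * d - b * c) / d) b 0 d ** low (c / d)"
      using d by (simp add: ii low_def diff_divide_distrib)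
    moreover have "c / d \<in> V 1" using i d by (simp add: ii V_div_unit)
    ultimately have "act i w' = act (mk ((a * d - b * c) / d) b 0 d) w'"
      using Borel_GL2[OF b] by (simp add: act_mult low)
    then show "act i w' \<in> W" using Wa[OF b] w'W by simp
  qed
  obtain m where m: "\<forall>k\<in>Kn m. act k w' = w'" using smooth[of w'] by (auto simp: smooth_vec_def)
  obtain y1 where y1: "y1 \<in> Y" "y1 \<noteq> 0" "\<forall>k\<in>Iw1. act k y1 = y1"
    using pro_p_fixed[OF \<open>stable Iw Y\<close> w'Y w'W(2) m] by blast
  obtain y \<eta> where y: "y \<in> Y" "y \<noteq> 0" "ichar \<eta>" "Ieig \<omega> \<eta> y"
    using Iw_eigen[OF \<open>stable Iw Y\<close> y1 \<omega> central] by blast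
  have yW: "y \<in> W" using y(1) by (simp add: Y_def)
  interpret ye: supersingular_edge v p pi scale act \<omega> \<eta> y
    by unfold_locales (use y in auto)
  obtain \<kappa> z where z: "z \<in> W" "z \<noteq> 0" "Ieig \<omega> \<eta> z" "hecke_U z = scale \<kappa> z"
    using ye.U_eigenvector[OF W yW y(2)] by blast
  \<comment> \<open>z has the same character \<eta> as y, so the exclusion of nonzero eigenvalues
    applies with z in the place of y.\<close>
  interpret ze: supersingular_edge v p pi scale act \<omega> \<eta> z
    by unfold_locales (use y z in auto)
  have "\<kappa> = 0" using ze.eigenvalue_contradiction[of \<kappa>] z by blast
  then have U0: "hecke_U z = 0" using z by simp
  \<comment> \<open>The largest G-stable subspace of W; by irreducibility one nonzero vector in it
    is enough.\<close>
  define G where "G = {x. \<forall>g\<in>GL2. act g x \<in> W}"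
  have "stable GL2 G"
    unfolding stable_def subspace_def G_def using Ws
    by (auto simp: subspace_0 act_add act_scale subspace_add subspace_scale simp flip: act_mult)
  moreover have "z \<in> G" using U_kernel[OF \<omega> y(3) z(3) W z(1) U0] by (simp add: G_def)
  ultimately have "G = UNIV" using irred z(2) by blast
  then have "act (mat 1) x \<in> W" for x using one_GL2 by (auto simp only: G_def)
  then show ?thesis by auto
qed

end

theorem theorem4p3:
  fixes v :: "'f::field \<Rightarrow> int" and p :: nat
    and smul :: "'k::field \<Rightarrow> 'v::ab_group_add \<Rightarrow> 'v"
    and act :: "'f^2^2 \<Rightarrow> 'v \<Rightarrow> 'v"
  assumes "nonarch_local_field v p"
    and "is_alg_closure_of_Fp TYPE('k) p"
    and "supersingular v smul act"
  shows "irreducible_rep (Borel :: ('f^2^2) set) smul act"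
proof -
  obtain pi where pi: "pi \<noteq> 0" "v pi = 1" using assms(1) unfolding nonarch_local_field_def by blast
  have sm: "smooth_rep v smul act" and irr: "irreducible_rep (GL2 :: ('f^2^2) set) smul act"
    and cc: "has_central_character smul act"
    and nosub: "\<not> (\<exists>chi :: 'f \<Rightarrow> 'f \<Rightarrow> 'k. smooth_char_T v chi \<and> iso_subquotient_Ind v chi smul act)"
    using assms(3) by (simp_all add: supersingular_def)
  interpret vector_space smul using sm by (simp add: smooth_rep_def)
  interpret G_rep v p pi smul act
  proof unfold_locales
    show "finite ((\<lambda>x. {y \<in> val_ideal v 0. x - y \<in> val_ideal v 1}) ` val_ideal v 0)"
      using assms(1) by (simp add: nonarch_local_field_def)
    show "\<forall>q :: 'k poly. degree q > 0 \<longrightarrow> (\<exists>x. poly q x = 0)" "CHAR('k) = p"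
      using assms(2) by (simp_all add: is_alg_closure_of_Fp_def)
  qed (use assms(1) pi sm in \<open>auto simp: nonarch_local_field_def smooth_rep_def\<close>)
  obtain \<omega> where \<omega>: "\<And>z x. z \<noteq> 0 \<Longrightarrow> act (mat z) x = smul (\<omega> z) x"
    using cc unfolding has_central_character_def by blast
  have smooth: "smooth_vec x" for x
  proof -
    have "G_open v {g \<in> GL2. act g x = x}" using sm by (simp add: smooth_rep_def)
    moreover have "mat 1 \<in> {g \<in> GL2. act g x = x}" using sm by (simp add: smooth_rep_def)
    ultimately obtain n where n: "\<forall>h\<in>GL2. close_mat v n (mat 1) h \<longrightarrow> h \<in> {g \<in> GL2. act g x = x}"
      unfolding G_open_def by blast
    have "act k x = x" if k: "k \<in> Kn (max n 1)" for k
    proof -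
      have "close_mat v n (mat 1) k"
        using Kn_mono[OF k, of n] by (simp add: Kn_def close_mat_def ent_def)
      then show ?thesis using n Kn_GL2[OF _ k] by simp
    qed
    then show ?thesis unfolding smooth_vec_def by (intro exI[of _ "max n 1"]) simp
  qed
  obtain x0 :: 'v where x0: "x0 \<noteq> 0" using irr unfolding irreducible_rep_def by blast
  \<comment> \<open>\<omega> is given as a bare function. A nonzero vector fixed by
    \<open>Iw1\<close> determines its values, and shows that it is trivial on 1 + m since scalars
    from there lie in \<open>Iw1\<close>.\<close>
  have "stable Iw UNIV" by (simp add: stable_def)
  moreover obtain n where "\<forall>k\<in>Kn n. act k x0 = x0" using smooth[of x0] by (auto simp: smooth_vec_def)
  ultimately obtain x1 where x1: "x1 \<noteq> 0" "\<forall>k\<in>Iw1. act k x1 = x1" using pro_p_fixed[of UNIV x0 n] x0 by blast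
  have uniq: "a = b" if "smul a x1 = smul b x1" for a b using that x1(1) by simp
  have cch: "cchar \<omega>"
    unfolding cchar_def
  proof (intro conjI allI impI)
    fix u w :: 'f assume *: "u \<noteq> 0" "w \<noteq> 0"
    have "smul (\<omega> (u * w)) x1 = act (mat u ** mat w) x1" using * by (simp add: mat_mk flip: \<omega>)
    also have "\<dots> = smul (\<omega> u) (smul (\<omega> w) x1)" using * by (subst act_mult) (simp_all add: mat_mk \<omega>[unfolded mat_mk])
    finally show "\<omega> (u * w) = \<omega> u * \<omega> w" by (intro uniq) simp
  next
    fix z assume z: "z - 1 \<in> V 1"
    then have "mat z \<in> Iw1" "z \<noteq> 0" by (auto simp: mat_mk unit_nz[OF unit_of_one])
    then have "smul (\<omega> z) x1 = smul 1 x1" using x1(2) by (simp flip: \<omega>)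
    then show "\<omega> z = 1" by (rule uniq)
  next
    fix u :: 'f assume u: "u \<noteq> 0"
    then have "act (mat u) x1 \<noteq> 0" using x1(1) by (simp add: mat_mk)
    then show "\<omega> u \<noteq> 0" using \<omega>[OF u, of x1] by auto
  qed
  interpret supersingular_rep v p pi smul act \<omega>
  proof unfold_locales
    show "W = {0} \<or> W = UNIV" if "stable GL2 W" for W
      using irr that by (auto simp: irreducible_rep_def stable_subspace_def stable_def)
    show "\<not> iso_subquotient_Ind v chi smul act" if "smooth_char_T v chi" for chi
      using nosub that by blast
  qed (use cch \<omega> smooth in auto)
  show ?thesis
    unfolding irreducible_rep_def
  proof (intro conjI allI impI)
    show "\<exists>x::'v. x \<noteq> 0" using x0 by blast
    fix W assume "stable_subspace Borel smul act W"
    then have "stable Borel W" by (simp add: stable_subspace_def stable_def)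
    then show "W = {0} \<or> W = UNIV" using Borel_irreducible by blast
  qed
qed

end
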